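(* Let $\Sigma$ be a connected $2$-dimensional simplicial complex on $n$ vertices that PL embeds into $\mathbb{R}^3$. Then $f_2(\Sigma)\leq 2\left(f_1(\Sigma)-\beta_1(\Sigma)-n\right)$.
   Context: Simplicial complexes are finite. $\Sigma$ PL embeds into $\mathbb{R}^k$ if some subdivision of its geometric realisation $\|\Sigma\|$ has a linear embedding (geometric realisation) in $\mathbb{R}^k$. $f_i(\Sigma)$ is the number of $i$-dimensional faces and $\beta_i(\Sigma)=\dim H_i(\Sigma;\mathbb{Z}_2)$.
   Formalization: The formal theorem additionally assumes that the complex has at least two triangles, f_2 ≥ 2; with exactly one triangle the inequality always fails (a single full triangle has n = f_1 = 3, β_1 = 0, and would need 1 ≤ 0). *)

theory Defs
  imports "HOL-Analysis.Analysis" "HOL-Algebra.Generated_Groups" "HOL-Library.Z2"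
begin

text \<open>
  A finite abstract simplicial complex is given by its set of nonempty faces, so its vertex set
  is \<open>\<Union>K\<close>. The vertices are taken from a type of class \<open>finite\<close>, which need not be exhausted by
  \<open>\<Union>K\<close>; this provides \<open>real^'a\<close> as the ambient space of the geometric realisation.
\<close>

definition abstract_complex :: "'a::finite set set \<Rightarrow> bool" where
  "abstract_complex K \<longleftrightarrow> {} \<notin> K \<and> (\<forall>s\<in>K. \<forall>t. t \<subseteq> s \<and> t \<noteq> {} \<longrightarrow> t \<in> K)"

definition faces :: "'a::finite set set \<Rightarrow> nat \<Rightarrow> 'a set set" where
  "faces K i = {s \<in> K. card s = i + 1}"

definition f_number :: "'a::finite set set \<Rightarrow> nat \<Rightarrow> nat" where
  "f_number K i = card (faces K i)"

definition has_dimension :: "'a::finite set set \<Rightarrow> nat \<Rightarrow> bool" where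
  "has_dimension K d \<longleftrightarrow> faces K d \<noteq> {} \<and> (\<forall>s\<in>K. card s \<le> d + 1)"


definition geometric_simplex :: "'a::finite set \<Rightarrow> (real^'a) set" where
  "geometric_simplex s = convex hull ((\<lambda>v. axis v 1) ` s)"

definition realisation :: "'a::finite set set \<Rightarrow> (real^'a) set" where
  "realisation K = (\<Union>s\<in>K. geometric_simplex s)"

text \<open>
  \<open>L\<close> is a geometric simplicial complex, in the sense of HOL-Analysis, with the same underlying
  space as the realisation of \<open>K\<close>. HOL-Analysis counts \<open>{}\<close> as a simplex, \<open>abstract_complex\<close> does
  not; the containment condition is insensitive to this as soon as \<open>K\<close> is nonempty.
\<close>

definition subdivides :: "(real^'a) set set \<Rightarrow> 'a::finite set set \<Rightarrow> bool" where
  "subdivides L K \<longleftrightarrow> simplicial_complex L \<and> \<Union>L = realisation K \<and>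
     (\<forall>S\<in>L. \<exists>s\<in>K. S \<subseteq> geometric_simplex s)"

text \<open>
  A linear embedding is an injective map of the underlying space that is affine on each simplex.
  Continuity, also of the inverse, is automatic: there are finitely many simplices, all compact.
\<close>

definition linear_embedding ::
    "'e::euclidean_space set set \<Rightarrow> ('e \<Rightarrow> 'f::euclidean_space) \<Rightarrow> bool" where
  "linear_embedding L f \<longleftrightarrow> inj_on f (\<Union>L) \<and>
     (\<forall>S\<in>L. \<exists>A b. linear A \<and> (\<forall>x\<in>S. f x = A x + b))"

definition PL_embeds :: "'a::finite set set \<Rightarrow> 'f::euclidean_space itself \<Rightarrow> bool" where
  "PL_embeds K (_ :: 'f itself) \<longleftrightarrow>
     (\<exists>L. subdivides L K \<and> (\<exists>f :: real^'a \<Rightarrow> 'f. linear_embedding L f))"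


definition chains2 :: "'a::finite set set \<Rightarrow> nat \<Rightarrow> ('a set \<Rightarrow> bit) set" where
  "chains2 K i = {c. \<forall>s. c s \<noteq> 0 \<longrightarrow> s \<in> faces K i}"

text \<open>
  This is the boundary operator in all degrees at once. As \<open>{}\<close> is not a face, it vanishes on
  0-chains, so the homology is unreduced.
\<close>

definition boundary2 :: "'a::finite set set \<Rightarrow> ('a set \<Rightarrow> bit) \<Rightarrow> ('a set \<Rightarrow> bit)" where
  "boundary2 K c =
     (\<lambda>t. if t \<in> K then (\<Sum>s | s \<in> K \<and> t \<subseteq> s \<and> card s = card t + 1. c s) else 0)"

definition cycle_group2 :: "'a::finite set set \<Rightarrow> nat \<Rightarrow> ('a set \<Rightarrow> bit) monoid" where
  "cycle_group2 K i =
     \<lparr>carrier = {c \<in> chains2 K i. boundary2 K c = (\<lambda>_. 0)},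
      monoid.mult = (\<lambda>c d s. c s + d s), one = (\<lambda>_. 0)\<rparr>"

definition homology_group2 :: "'a::finite set set \<Rightarrow> nat \<Rightarrow> ('a set \<Rightarrow> bit) set monoid" where
  "homology_group2 K i = cycle_group2 K i Mod (boundary2 K ` chains2 K (i + 1))"

text \<open>
  The dimension over the field with two elements is the least size of a spanning set. The only
  scalars being 0 and 1, the linear span of a set is the subgroup it generates.
\<close>

definition betti2 :: "'a::finite set set \<Rightarrow> nat \<Rightarrow> nat" where
  "betti2 K i = (LEAST k. \<exists>A. finite A \<and> card A = k \<and> A \<subseteq> carrier (homology_group2 K i) \<and>
     generate (homology_group2 K i) A = carrier (homology_group2 K i))"

end

theory Submission
  imports Defs
begin

text \<open>
  By the Euler characteristic the claim amounts to \<open>2 (\<beta>\<^sub>2 + 1) \<le> f\<^sub>2\<close>. Consider the graph whose vertices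
  are the components of the complement of the embedded complex and whose edges are the triangles, each
  joining the components on its two sides. The mod 2 cycles of triangles are exactly the cuts of this
  graph. A component with nonempty boundary therefore borders at least four triangles, and a triangle
  borders at most two components, so there are at most \<open>f\<^sub>2 / 2\<close> such components; as complementary sets of
  components define the same cut, the cuts have dimension less than that.

  Cycles and cuts are compared in general position: for two generic triangles \<open>s\<close> and \<open>t\<close> in space, the
  number of edges of \<open>s\<close> meeting \<open>t\<close> plus the number of edges of \<open>t\<close> meeting \<open>s\<close> is even. Summing over
  the triangles \<open>t\<close> of a cycle shows that the parity of the crossings of a segment with the cycle depends
  only on its endpoints, so the cycle is a cut. Summing over the triangles \<open>t\<close> of a cut, with a small
  \<open>s\<close> pierced by a single edge, shows that the cut is a cycle. Cycles of the complex correspond to cycles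
  of its subdivision, because an open triangle stays connected when the vertices of the subdivision are
  removed, and so a cycle contains all or none of the pieces of a triangle.

  Dimensions over the field with two elements enter only through cardinalities.
\<close>

section \<open>Parity of the intersection of two triangles in space\<close>

text \<open>Connectedness gives \<open>\<beta>\<^sub>0 = 1\<close>, so the Euler characteristic
  turns the right-hand side of the claim into \<open>2 * (f\<^sub>2 - \<beta>\<^sub>2 - 1)\<close>.
  The number four is the size of the smallest nonempty mod 2 cycle of triangles, the boundary of a
  tetrahedron. A triangle does not come with two regions attached to it. Its sides are sampled by
  two points whose segment crosses this triangle only, and the sampled regions must be shown not to
  depend on the points. Crossing parities are likewise reliable only for segments in general
  position, so the parity is extended to all points off the triangles as a locally constant
  function. Genericity is always phrased as avoiding finitely many sets of dimension at most two, so
  that generic points exist in every nonempty open set. The embedding is affine only on the pieces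
  of the subdivision, whereas the counting concerns the triangles of the complex itself; this is why
  cycles have to be carried to the subdivision and back.\<close>

lemma segment_meets_hyperplane_once:
  fixes n p q :: "'a::euclidean_space"
  assumes "(n \<bullet> p - \<beta>) * (n \<bullet> q - \<beta>) < 0"
  shows "closed_segment p q \<inter> {x. n \<bullet> x = \<beta>} =
    {((\<beta> - n \<bullet> q) / (n \<bullet> p - n \<bullet> q)) *\<^sub>R p + ((n \<bullet> p - \<beta>) / (n \<bullet> p - n \<bullet> q)) *\<^sub>R q}"
proof -
  define P Q where "P = n \<bullet> p - \<beta>" and "Q = n \<bullet> q - \<beta>"
  have PQ: "P * Q < 0" using assms by (simp add: P_def Q_def)
  have ne: "P - Q \<noteq> 0" using PQ by (metis eq_iff_diff_eq_0 not_square_less_zero)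
  have coeff: "\<beta> - n \<bullet> q = - Q" "n \<bullet> p - \<beta> = P" "n \<bullet> p - n \<bullet> q = P - Q"
    by (simp_all add: P_def Q_def)
  have iff: "n \<bullet> ((1 - u) *\<^sub>R p + u *\<^sub>R q) = \<beta> \<longleftrightarrow> u = P / (P - Q)" for u
  proof -
    have "n \<bullet> ((1 - u) *\<^sub>R p + u *\<^sub>R q) - \<beta> = P - u * (P - Q)"
      by (simp add: P_def Q_def inner_add_right algebra_simps)
    then show ?thesis using ne by (auto simp: field_simps)
  qed
  have u01: "0 \<le> P / (P - Q)" "P / (P - Q) \<le> 1"
    using PQ ne by (auto simp: divide_simps mult_less_0_iff)
  have e: "1 - P / (P - Q) = - Q / (P - Q)" using ne by (simp add: field_simps)
  have "closed_segment p q \<inter> {x. n \<bullet> x = \<beta>} = {(1 - P / (P - Q)) *\<^sub>R p + (P / (P - Q)) *\<^sub>R q}"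
  proof
    show "closed_segment p q \<inter> {x. n \<bullet> x = \<beta>} \<subseteq> {(1 - P / (P - Q)) *\<^sub>R p + (P / (P - Q)) *\<^sub>R q}"
    proof
      fix z assume "z \<in> closed_segment p q \<inter> {x. n \<bullet> x = \<beta>}"
      then obtain u where "z = (1 - u) *\<^sub>R p + u *\<^sub>R q" "n \<bullet> z = \<beta>" by (auto simp: in_segment)
      then show "z \<in> {(1 - P / (P - Q)) *\<^sub>R p + (P / (P - Q)) *\<^sub>R q}" using iff[of u] by simp
    qed
    show "{(1 - P / (P - Q)) *\<^sub>R p + (P / (P - Q)) *\<^sub>R q} \<subseteq> closed_segment p q \<inter> {x. n \<bullet> x = \<beta>}"
      using iff[of "P / (P - Q)"] u01 unfolding in_segment Int_iff by (auto simp only: in_segment)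
  qed
  then show ?thesis unfolding coeff e .
qed

lemma segment_misses_hyperplane:
  fixes n p q :: "'a::euclidean_space"
  assumes "(n \<bullet> p - \<beta>) * (n \<bullet> q - \<beta>) > 0"
  shows "closed_segment p q \<inter> {x. n \<bullet> x = \<beta>} = {}"
proof -
  have False if u: "0 \<le> u" "u \<le> 1" and z: "n \<bullet> ((1 - u) *\<^sub>R p + u *\<^sub>R q) = \<beta>" for u
  proof -
    define P Q where "P = n \<bullet> p - \<beta>" and "Q = n \<bullet> q - \<beta>"
    have PQ: "P * Q > 0" using assms by (simp add: P_def Q_def)
    have 0: "(1 - u) * P + u * Q = 0"
      using z by (simp add: P_def Q_def inner_add_right algebra_simps)
    from PQ consider "P > 0" "Q > 0" | "P < 0" "Q < 0" by (auto simp: zero_less_mult_iff)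
    then show False
    proof cases
      case 1
      then have "0 \<le> (1 - u) * P" "0 \<le> u * Q" using u by auto
      then have "(1 - u) * P = 0" "u * Q = 0" using 0 by linarith+
      then show False using 1 by simp
    next
      case 2
      then have "(1 - u) * P \<le> 0" "u * Q \<le> 0" using u by (auto intro: mult_nonneg_nonpos)
      then have "(1 - u) * P = 0" "u * Q = 0" using 0 by linarith+
      then show False using 2 by simp
    qed
  qed
  then show ?thesis unfolding closed_segment_def by auto
qed

lemma triangle_misses_hyperplane:
  fixes n p q r :: "'a::euclidean_space"
  assumes "(n \<bullet> p - \<beta>) * (n \<bullet> q - \<beta>) > 0" "(n \<bullet> p - \<beta>) * (n \<bullet> r - \<beta>) > 0"
  shows "convex hull {p, q, r} \<inter> {x. n \<bullet> x = \<beta>} = {}"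
proof -
  consider "{p,q,r} \<subseteq> {x. n \<bullet> x < \<beta>}" | "{p,q,r} \<subseteq> {x. n \<bullet> x > \<beta>}"
    using assms by (auto simp: zero_less_mult_iff)
  then show ?thesis
  proof cases
    case 1
    from hull_minimal[OF this, of convex] show ?thesis by (auto simp: convex_halfspace_lt)
  next
    case 2
    from hull_minimal[OF this, of convex] show ?thesis by (auto simp: convex_halfspace_gt)
  qed
qed

text \<open>Here \<open>p\<close> lies alone on its side of the plane, so the slice runs between the
  points where the plane cuts the two edges at \<open>p\<close>.\<close>

lemma triangle_slice_apex:
  fixes n p q r :: "'a::euclidean_space"
  assumes q: "(n \<bullet> p - \<beta>) * (n \<bullet> q - \<beta>) < 0" and r: "(n \<bullet> p - \<beta>) * (n \<bullet> r - \<beta>) < 0"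
    and x: "closed_segment p q \<inter> {x. n \<bullet> x = \<beta>} = {x}"
    and y: "closed_segment p r \<inter> {x. n \<bullet> x = \<beta>} = {y}"
  shows "convex hull {p, q, r} \<inter> {x. n \<bullet> x = \<beta>} = closed_segment x y"
proof
  have "x \<in> closed_segment p q" "y \<in> closed_segment p r" "n \<bullet> x = \<beta>" "n \<bullet> y = \<beta>" using x y by auto
  moreover have "closed_segment p q \<subseteq> convex hull {p, q, r}" "closed_segment p r \<subseteq> convex hull {p, q, r}"
    by (auto simp: segment_convex_hull intro!: hull_mono)
  ultimately show "closed_segment x y \<subseteq> convex hull {p, q, r} \<inter> {x. n \<bullet> x = \<beta>}"
    by (intro closed_segment_subset convex_Int convex_hyperplane) auto
next
  define P Q R where "P = n \<bullet> p - \<beta>" and "Q = n \<bullet> q - \<beta>" and "R = n \<bullet> r - \<beta>"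
  have PQ: "P * Q < 0" "P * R < 0" using q r by (simp_all add: P_def Q_def R_def)
  have ne: "P - Q \<noteq> 0" "P - R \<noteq> 0" "P \<noteq> 0" using PQ
    by (metis eq_iff_diff_eq_0 not_square_less_zero, metis eq_iff_diff_eq_0 not_square_less_zero, auto)
  have xx: "x = (- Q / (P - Q)) *\<^sub>R p + (P / (P - Q)) *\<^sub>R q"
    using segment_meets_hyperplane_once[OF q] x by (simp add: P_def Q_def)
  have yy: "y = (- R / (P - R)) *\<^sub>R p + (P / (P - R)) *\<^sub>R r"
    using segment_meets_hyperplane_once[OF r] y by (simp add: P_def R_def)
  show "convex hull {p, q, r} \<inter> {x. n \<bullet> x = \<beta>} \<subseteq> closed_segment x y"
  proof
    fix z assume z: "z \<in> convex hull {p, q, r} \<inter> {x. n \<bullet> x = \<beta>}"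
    then obtain a b c where abc: "0 \<le> a" "0 \<le> b" "0 \<le> c" "a + b + c = 1" "z = a *\<^sub>R p + b *\<^sub>R q + c *\<^sub>R r"
      by (auto simp: convex_hull_3)
    have "n \<bullet> z = \<beta>" using z by simp
    then have "a * (n \<bullet> p) + b * (n \<bullet> q) + c * (n \<bullet> r) = (a + b + c) * \<beta>"
      using abc by (simp add: inner_add_right)
    then have 0: "a * P + b * Q + c * R = 0" by (simp add: P_def Q_def R_def algebra_simps)
    \<comment> \<open>In \<open>v *\<^sub>R x + u *\<^sub>R y\<close> the vertex \<open>q\<close>
      occurs only through \<open>x\<close> and \<open>r\<close> only through \<open>y\<close>;
      comparing coefficients with \<open>z\<close> forces these weights.\<close>
    define u v where "u = c * (P - R) / P" and "v = b * (P - Q) / P"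
    have aP: "a = (- b * Q - c * R) / P" using 0 ne by (simp add: field_simps)
    have "u + v = b + c + (- b * Q - c * R) / P" using ne by (simp add: u_def v_def field_simps)
    then have uv: "u + v = 1" using abc aP by simp
    have "0 \<le> (P - R) / P" "0 \<le> (P - Q) / P" using PQ by (auto simp: divide_simps mult_less_0_iff)
    then have "0 \<le> u" "0 \<le> v" using abc unfolding u_def v_def
      by (metis mult_nonneg_nonneg times_divide_eq_right)+
    have co: "v * (- Q / (P - Q)) = - b * Q / P" "v * (P / (P - Q)) = b"
      "u * (- R / (P - R)) = - c * R / P" "u * (P / (P - R)) = c"
      using ne by (simp_all add: u_def v_def)
    have "v *\<^sub>R x + u *\<^sub>R y = (v * (- Q / (P - Q)) + u * (- R / (P - R))) *\<^sub>R p
      + (v * (P / (P - Q))) *\<^sub>R q + (u * (P / (P - R))) *\<^sub>R r"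
      by (simp only: xx yy scaleR_add_right scaleR_left_distrib scaleR_scaleR ac_simps)
    moreover have "a = - b * Q / P + - c * R / P" unfolding aP by (simp add: diff_divide_distrib)
    ultimately have "z = v *\<^sub>R x + u *\<^sub>R y" using abc unfolding co by simp
    then show "z \<in> closed_segment x y" unfolding closed_segment_def
      using uv \<open>0 \<le> u\<close> \<open>0 \<le> v\<close> by (auto intro!: exI[of _ u] simp: eq_diff_eq[THEN iffD2, OF uv[unfolded add.commute[of u]]])
  qed
qed

text \<open>Counting is phrased through arbitrary subsets \<open>C\<close> of the plane, so that the choice of the
  vertex that lies alone on its side of the plane disappears from the statement.\<close>

lemma triangle_slice:
  fixes n p q r :: "'a::euclidean_space"
  assumes "n \<bullet> p \<noteq> \<beta>" "n \<bullet> q \<noteq> \<beta>" "n \<bullet> r \<noteq> \<beta>"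
  shows "(closed_segment p q \<union> closed_segment q r \<union> closed_segment p r \<union> convex hull {p, q, r})
            \<inter> {x. n \<bullet> x = \<beta>} = {} \<or>
    (\<exists>x y. convex hull {p, q, r} \<inter> {x. n \<bullet> x = \<beta>} = closed_segment x y
       \<and> {x, y} \<subseteq> closed_segment p q \<union> closed_segment q r \<union> closed_segment p r
       \<and> (\<forall>C \<subseteq> {x. n \<bullet> x = \<beta>}. of_bool (closed_segment p q \<inter> C \<noteq> {}) + of_bool (closed_segment q r \<inter> C \<noteq> {})
            + of_bool (closed_segment p r \<inter> C \<noteq> {}) = (of_bool (x \<in> C) + of_bool (y \<in> C) :: nat)))"
    (is "?N p q r \<or> ?E p q r")
proof -
  \<comment> \<open>The edge opposite to the lone vertex misses the plane and each other edge meets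
    it in one point, so the edge counts become membership of \<open>x\<close> and \<open>y\<close>
    in \<open>C\<close>.\<close>
  have apex: "?E p q r"
    if h: "(n \<bullet> p - \<beta>) * (n \<bullet> q - \<beta>) < 0" "(n \<bullet> p - \<beta>) * (n \<bullet> r - \<beta>) < 0" for p q r
  proof -
    obtain x y where x: "closed_segment p q \<inter> {x. n \<bullet> x = \<beta>} = {x}"
      and y: "closed_segment p r \<inter> {x. n \<bullet> x = \<beta>} = {y}"
      using segment_meets_hyperplane_once[OF h(1)] segment_meets_hyperplane_once[OF h(2)] by blast
    have "(n \<bullet> q - \<beta>) * (n \<bullet> r - \<beta>) > 0" using h by (auto simp: mult_less_0_iff zero_less_mult_iff)
    from segment_misses_hyperplane[OF this]
    have qr: "closed_segment q r \<inter> {x. n \<bullet> x = \<beta>} = {}" .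
    have "of_bool (closed_segment p q \<inter> C \<noteq> {}) + of_bool (closed_segment q r \<inter> C \<noteq> {})
            + of_bool (closed_segment p r \<inter> C \<noteq> {}) = (of_bool (x \<in> C) + of_bool (y \<in> C) :: nat)"
      if C: "C \<subseteq> {x. n \<bullet> x = \<beta>}" for C
    proof -
      have "closed_segment q r \<inter> C = {}" using qr C by blast
      moreover have "closed_segment p q \<inter> C = {x} \<inter> C" using C unfolding x[symmetric] by blast
      moreover have "closed_segment p r \<inter> C = {y} \<inter> C" using C unfolding y[symmetric] by blast
      ultimately show ?thesis by simp
    qed
    moreover have "{x, y} \<subseteq> closed_segment p q \<union> closed_segment q r \<union> closed_segment p r" using x y by blast
    ultimately show ?thesis using triangle_slice_apex[OF h x y] by blast
  qed
  have sym1: "?E p q r" if "?E q p r"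
    using that by (simp add: insert_commute[of q p] closed_segment_commute[of q p] ac_simps Un_ac)
  have sym2: "?E p q r" if "?E r p q"
    using that by (simp add: insert_commute[of r p] insert_commute[of r q] closed_segment_commute[of r p] closed_segment_commute[of r q] ac_simps Un_ac)
  have none: "?N p q r"
    if h: "(n \<bullet> p - \<beta>) * (n \<bullet> q - \<beta>) > 0" "(n \<bullet> p - \<beta>) * (n \<bullet> r - \<beta>) > 0"
  proof -
    have "(n \<bullet> q - \<beta>) * (n \<bullet> r - \<beta>) > 0" using h by (auto simp: zero_less_mult_iff)
    then show ?thesis
      using segment_misses_hyperplane[OF h(1)] segment_misses_hyperplane[OF h(2)]
        segment_misses_hyperplane[of n q \<beta> r] triangle_misses_hyperplane[OF h] by blast
  qed
  have "n \<bullet> p - \<beta> \<noteq> 0" "n \<bullet> q - \<beta> \<noteq> 0" "n \<bullet> r - \<beta> \<noteq> 0" using assms by auto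
  \<comment> \<open>Three nonzero reals share their sign, or one of them differs in sign from the
    other two; \<open>sym1\<close> and \<open>sym2\<close> move that vertex to the front.\<close>
  then consider "(n \<bullet> p - \<beta>) * (n \<bullet> q - \<beta>) > 0" "(n \<bullet> p - \<beta>) * (n \<bullet> r - \<beta>) > 0"
    | "(n \<bullet> p - \<beta>) * (n \<bullet> q - \<beta>) < 0" "(n \<bullet> p - \<beta>) * (n \<bullet> r - \<beta>) < 0"
    | "(n \<bullet> q - \<beta>) * (n \<bullet> p - \<beta>) < 0" "(n \<bullet> q - \<beta>) * (n \<bullet> r - \<beta>) < 0"
    | "(n \<bullet> r - \<beta>) * (n \<bullet> p - \<beta>) < 0" "(n \<bullet> r - \<beta>) * (n \<bullet> q - \<beta>) < 0"
    unfolding zero_less_mult_iff mult_less_0_iff by linarith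
  then show ?thesis
  proof cases
    case 1 then show ?thesis using none by blast
  next
    case 2 then show ?thesis using apex by blast
  next
    case 3 from sym1[OF apex[OF this]] show ?thesis by blast
  next
    case 4 from sym2[OF apex[OF this]] show ?thesis by blast
  qed
qed

text \<open>Two intervals of a line without a common endpoint are disjoint, nested or interlaced,
  and then 0, 2 or 1 + 1 endpoints lie in the other interval. Degenerate intervals are
  included.\<close>

lemma collinear_segments_parity:
  fixes x y u v :: "'a::euclidean_space"
  assumes "collinear {x, y, u, v}" "{x, y} \<inter> {u, v} = {}"
  shows "even (of_bool (x \<in> closed_segment u v) + of_bool (y \<in> closed_segment u v)
    + of_bool (u \<in> closed_segment x y) + of_bool (v \<in> closed_segment x y) :: nat)"
proof -
  from assms(1) obtain d where d: "\<And>a b. a \<in> {x,y,u,v} \<Longrightarrow> b \<in> {x,y,u,v} \<Longrightarrow> \<exists>c. a - b = c *\<^sub>R d"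
    unfolding collinear_def by blast
  obtain b c e where b: "y - x = b *\<^sub>R d" and c: "u - x = c *\<^sub>R d" and e: "v - x = e *\<^sub>R d"
    using d[of y x] d[of u x] d[of v x] by auto
  have d0: "d \<noteq> 0" using c assms(2) by auto
  have eqs: "x = x + 0 *\<^sub>R d" "y = x + b *\<^sub>R d" "u = x + c *\<^sub>R d" "v = x + e *\<^sub>R d"
    using b c e by (simp_all add: algebra_simps)
  have seg: "x + s *\<^sub>R d \<in> closed_segment (x + s1 *\<^sub>R d) (x + s2 *\<^sub>R d) \<longleftrightarrow> s \<in> closed_segment s1 s2" for s s1 s2 :: real
  proof -
    have "x + s *\<^sub>R d \<in> closed_segment (x + s1 *\<^sub>R d) (x + s2 *\<^sub>R d) \<longleftrightarrow>
      (\<exists>w. 0 \<le> w \<and> w \<le> 1 \<and> s *\<^sub>R d = ((1 - w) * s1 + w * s2) *\<^sub>R d)"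
      unfolding closed_segment_def by (auto simp: algebra_simps)
    also have "\<dots> \<longleftrightarrow> s \<in> closed_segment s1 s2"
      unfolding closed_segment_def using d0 by auto
    finally show ?thesis .
  qed
  have dist: "0 \<noteq> c" "0 \<noteq> e" "b \<noteq> c" "b \<noteq> e"
    using assms(2) b c e by (auto, metis diff_add_cancel, metis diff_add_cancel)
  have mem: "x \<in> closed_segment u v \<longleftrightarrow> 0 \<in> closed_segment c e" "y \<in> closed_segment u v \<longleftrightarrow> b \<in> closed_segment c e"
    "u \<in> closed_segment x y \<longleftrightarrow> c \<in> closed_segment 0 b" "v \<in> closed_segment x y \<longleftrightarrow> e \<in> closed_segment 0 b"
    by (metis eqs seg)+
  show ?thesis unfolding mem closed_segment_eq_real_ivl using dist by auto
qed

text \<open>The point \<open>a\<close> lies on the first plane but not on the second, so the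
  intersection is a proper affine subspace of a plane. The point \<open>p\<close> serves to exclude
  \<open>n = 0\<close>.\<close>

lemma collinear_Int_planes:
  fixes n n' :: "real^3"
  assumes "n \<bullet> a = \<beta>" "n \<bullet> p \<noteq> \<beta>" "n' \<bullet> a \<noteq> \<beta>'"
  shows "collinear ({x. n \<bullet> x = \<beta>} \<inter> {x. n' \<bullet> x = \<beta>'})"
proof -
  let ?H = "{x. n \<bullet> x = \<beta>}" and ?H' = "{x. n' \<bullet> x = \<beta>'}"
  have "n \<noteq> 0" using assms by auto
  then have dim: "aff_dim ?H = 2" by (simp add: aff_dim_hyperplane)
  have "affine (?H \<inter> ?H')" "affine ?H" by (intro affine_Int affine_hyperplane)+
  moreover have "?H \<inter> ?H' \<subset> ?H" using assms by auto
  ultimately have "affine hull (?H \<inter> ?H') \<subset> affine hull ?H" by (metis hull_same)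
  then have "aff_dim (?H \<inter> ?H') < aff_dim ?H" by (rule aff_dim_psubset)
  then show ?thesis using dim by (simp add: collinear_aff_dim)
qed

text \<open>Both triangles meet the common line of their planes in a segment, and the six counts record
  which endpoints of one segment lie in the other.\<close>

lemma triangle_pair_parity:
  fixes a b c p q r n n' :: "real^3"
  assumes t: "n \<bullet> a = \<beta>" "n \<bullet> b = \<beta>" "n \<bullet> c = \<beta>" and s: "n' \<bullet> p = \<beta>'" "n' \<bullet> q = \<beta>'" "n' \<bullet> r = \<beta>'"
    and nt: "n \<bullet> p \<noteq> \<beta>" "n \<bullet> q \<noteq> \<beta>" "n \<bullet> r \<noteq> \<beta>" and ns: "n' \<bullet> a \<noteq> \<beta>'" "n' \<bullet> b \<noteq> \<beta>'" "n' \<bullet> c \<noteq> \<beta>'"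
    and disj: "(closed_segment p q \<union> closed_segment q r \<union> closed_segment p r) \<inter>
               (closed_segment a b \<union> closed_segment b c \<union> closed_segment a c) = {}"
  shows "even (of_bool (closed_segment p q \<inter> convex hull {a, b, c} \<noteq> {})
      + of_bool (closed_segment q r \<inter> convex hull {a, b, c} \<noteq> {})
      + of_bool (closed_segment p r \<inter> convex hull {a, b, c} \<noteq> {})
      + (of_bool (closed_segment a b \<inter> convex hull {p, q, r} \<noteq> {})
      + of_bool (closed_segment b c \<inter> convex hull {p, q, r} \<noteq> {})
      + of_bool (closed_segment a c \<inter> convex hull {p, q, r} \<noteq> {})) :: nat)"
proof -
  let ?H = "{x. n \<bullet> x = \<beta>}" and ?H' = "{x. n' \<bullet> x = \<beta>'}"
  let ?t = "convex hull {a, b, c}" and ?s = "convex hull {p, q, r}"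
  have tH: "?t \<subseteq> ?H" using t by (intro hull_minimal convex_hyperplane) auto
  have sH: "?s \<subseteq> ?H'" using s by (intro hull_minimal convex_hyperplane) auto
  have edges: "closed_segment p q \<union> closed_segment q r \<union> closed_segment p r \<subseteq> ?s"
    "closed_segment a b \<union> closed_segment b c \<union> closed_segment a c \<subseteq> ?t"
    by (auto simp: segment_convex_hull intro: hull_mono[THEN subsetD, rotated])
  \<comment> \<open>If one triangle misses the plane of the other, all six counts vanish; otherwise
    both slices are segments.\<close>
  consider (no1) "(closed_segment p q \<union> closed_segment q r \<union> closed_segment p r \<union> ?s) \<inter> ?H = {}"
    | (no2) "(closed_segment a b \<union> closed_segment b c \<union> closed_segment a c \<union> ?t) \<inter> ?H' = {}"
    | (ex) x y u v where "?s \<inter> ?H = closed_segment x y" "?t \<inter> ?H' = closed_segment u v"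
      "{x, y} \<subseteq> closed_segment p q \<union> closed_segment q r \<union> closed_segment p r"
      "{u, v} \<subseteq> closed_segment a b \<union> closed_segment b c \<union> closed_segment a c"
      "of_bool (closed_segment p q \<inter> ?t \<noteq> {}) + of_bool (closed_segment q r \<inter> ?t \<noteq> {})
            + of_bool (closed_segment p r \<inter> ?t \<noteq> {}) = (of_bool (x \<in> ?t) + of_bool (y \<in> ?t) :: nat)"
      "of_bool (closed_segment a b \<inter> ?s \<noteq> {}) + of_bool (closed_segment b c \<inter> ?s \<noteq> {})
            + of_bool (closed_segment a c \<inter> ?s \<noteq> {}) = (of_bool (u \<in> ?s) + of_bool (v \<in> ?s) :: nat)"
    using triangle_slice[OF nt] triangle_slice[OF ns] tH sH by (elim disjE exE conjE) metis+
  then show ?thesis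
  proof cases
    case no1
    then have "closed_segment p q \<inter> ?t = {}" "closed_segment q r \<inter> ?t = {}" "closed_segment p r \<inter> ?t = {}"
      "closed_segment a b \<inter> ?s = {}" "closed_segment b c \<inter> ?s = {}" "closed_segment a c \<inter> ?s = {}"
      using tH edges by blast+
    then show ?thesis by simp
  next
    case no2
    then have "closed_segment p q \<inter> ?t = {}" "closed_segment q r \<inter> ?t = {}" "closed_segment p r \<inter> ?t = {}"
      "closed_segment a b \<inter> ?s = {}" "closed_segment b c \<inter> ?s = {}" "closed_segment a c \<inter> ?s = {}"
      using sH edges by blast+
    then show ?thesis by simp
  next
    case ex
    have xy: "{x, y} \<subseteq> ?s \<inter> ?H" and uv: "{u, v} \<subseteq> ?t \<inter> ?H'" using ex(1,2) by auto
    \<comment> \<open>Each triangle lies in its own plane, so an endpoint of one slice that belongs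
      to the other triangle already belongs to the slice of that triangle.\<close>
    have "x \<in> ?t \<longleftrightarrow> x \<in> closed_segment u v" "y \<in> ?t \<longleftrightarrow> y \<in> closed_segment u v"
      "u \<in> ?s \<longleftrightarrow> u \<in> closed_segment x y" "v \<in> ?s \<longleftrightarrow> v \<in> closed_segment x y"
      using xy uv sH tH ex(1,2) by blast+
    moreover have "collinear {x, y, u, v}"
      using xy uv sH tH by (intro collinear_subset[OF collinear_Int_planes[OF t(1) nt(1) ns(1)]]) blast
    moreover have "{x, y} \<inter> {u, v} = {}" using disj ex(3,4) by blast
    ultimately show ?thesis
      unfolding ex(5,6) using collinear_segments_parity[of x y u v] by (simp add: add.assoc)
  qed
qed

section \<open>Cycles of triangles in space are cuts of the region graph\<close>

text \<open>Sets of lower dimension lie in hyperplanes and are negligible, while a nonempty open set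
  is not. This is the source of \<open>general_point_exists\<close>.\<close>

lemma avoid_finitely_many_affine:
  fixes U :: "'a::euclidean_space set"
  assumes "open U" "U \<noteq> {}" "finite \<A>" "\<And>A. A \<in> \<A> \<Longrightarrow> aff_dim A < DIM('a)"
  obtains x where "x \<in> U" "\<And>A. A \<in> \<A> \<Longrightarrow> x \<notin> A"
proof -
  have "negligible A" if A: "A \<in> \<A>" for A
  proof -
    obtain a b where "a \<noteq> 0" "A \<subseteq> {x. a \<bullet> x = b}"
      using aff_lowdim_subset_hyperplane[OF assms(4)[OF A]] .
    then show ?thesis using negligible_hyperplane negligible_subset by blast
  qed
  then have "negligible (\<Union>\<A>)" using assms(3) by blast
  then have "\<not> U \<subseteq> \<Union>\<A>" using open_not_negligible[OF assms(1,2)] negligible_subset by blast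
  then show thesis using that by blast
qed

lemma aff_dim_three_points: "aff_dim {a, b, c :: 'a::euclidean_space} \<le> 2"
  using aff_dim_le_card[of "{a, b, c}"] card_insert_le_m1[of 3 "{b, c}" a] card_insert_le_m1[of 2 "{c}" b] by simp

lemma closed_UN_hulls:
  fixes A :: "'a::euclidean_space set set"
  assumes "finite A" "\<And>t. t \<in> A \<Longrightarrow> finite t"
  shows "closed (\<Union>t\<in>A. convex hull t)"
  using assms by (intro closed_UN) (auto intro: compact_imp_closed finite_imp_compact_convex_hull)

lemma affine_independent_vertex_in_hull:
  assumes "\<not> affine_dependent t" "c \<subseteq> t" "u \<in> t" "u \<in> convex hull c"
  shows "u \<in> c"
proof (rule ccontr)
  assume "u \<notin> c"
  then have "convex hull c \<subseteq> affine hull (t - {u})"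
    using assms(2) convex_hull_subset_affine_hull hull_mono[of c "t - {u}" affine] by blast
  then show False using assms(1,3,4) unfolding affine_dependent_def by blast
qed

text \<open>The hull of \<open>c\<close> is a face of the simplex, and a face that contains an inner
  point of a segment of the simplex contains both ends.\<close>

lemma affine_independent_segment_in_hull:
  fixes t :: "'a::euclidean_space set"
  assumes "\<not> affine_dependent t" "c \<subseteq> t" "u \<in> t" "w \<in> t" "u \<noteq> w" "x \<in> open_segment u w" "x \<in> convex hull c"
  shows "{u, w} \<subseteq> c"
proof -
  have "convex hull c face_of convex hull t"
    using assms(1,2) by (auto simp: face_of_convex_hull_affine_independent)
  moreover have "u \<in> convex hull t" "w \<in> convex hull t" using assms by (auto simp: hull_inc)
  ultimately have "u \<in> convex hull c" "w \<in> convex hull c"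
    using assms(6,7) unfolding face_of_def by blast+
  then show ?thesis using affine_independent_vertex_in_hull[OF assms(1,2)] assms(3,4) by blast
qed

lemma triangle_edges:
  assumes "a \<noteq> b" "b \<noteq> c" "a \<noteq> c"
  shows "{e. card e = 2 \<and> e \<subseteq> {a, b, c}} = {{a, b}, {b, c}, {a, c}}"
  using assms by (auto simp: card_2_iff doubleton_eq_iff)

text \<open>A chain over the field with two elements is encoded by its support. The condition may
  run over all pairs, since a pair that lies in no triangle is contained in 0 members of
  \<open>z\<close>.\<close>

definition mod2_cycles :: "'b set set \<Rightarrow> 'b set set set" where
  "mod2_cycles T = {z. z \<subseteq> T \<and> (\<forall>e. card e = 2 \<longrightarrow> even (card {t \<in> z. e \<subseteq> t}))}"

text \<open>With \<open>s1 t\<close> and \<open>s2 t\<close> as the ends of the edge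
  \<open>t\<close> of a graph, this is the cut between \<open>G\<close> and the other nodes. A loop,
  where both ends agree, lies in no cut.\<close>

definition separated_triangles :: "('b set \<Rightarrow> 'r) \<Rightarrow> ('b set \<Rightarrow> 'r) \<Rightarrow> 'b set set \<Rightarrow> 'r set \<Rightarrow> 'b set set" where
  "separated_triangles s1 s2 T G = {t \<in> T. (s1 t \<in> G) \<noteq> (s2 t \<in> G)}"

text \<open>Triangles are given by their vertex sets. An embedded complex enters through its
  triangles, which carry all 2-chains, and regions are components of the complement of their
  union.\<close>

locale triangle_complex =
  fixes T :: "(real^3) set set"
  assumes finite_T: "finite T"
    and card_T: "t \<in> T \<Longrightarrow> card t = 3"
    and indep_T: "t \<in> T \<Longrightarrow> \<not> affine_dependent t"
    and meet_T: "t \<in> T \<Longrightarrow> t' \<in> T \<Longrightarrow> convex hull t \<inter> convex hull t' = convex hull (t \<inter> t')"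
begin

definition support :: "(real^3) set" where
  "support = (\<Union>t\<in>T. convex hull t)"

definition edges :: "(real^3) set set" where
  "edges = {e. card e = 2 \<and> (\<exists>t\<in>T. e \<subseteq> t)}"

definition crosses :: "real^3 \<Rightarrow> real^3 \<Rightarrow> (real^3) set \<Rightarrow> bool" where
  "crosses p q t \<longleftrightarrow> closed_segment p q \<inter> convex hull t \<noteq> {}"

definition avoids_edges :: "real^3 \<Rightarrow> real^3 \<Rightarrow> bool" where
  "avoids_edges p q \<longleftrightarrow> (\<forall>e\<in>edges. closed_segment p q \<inter> convex hull e = {})"

definition off_planes :: "real^3 \<Rightarrow> bool" where
  "off_planes p \<longleftrightarrow> (\<forall>t\<in>T. p \<notin> affine hull t)"

text \<open>These conditions supply the hypotheses of \<open>triangle_pair_parity\<close> for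
  \<open>p\<close>, \<open>q\<close>, \<open>r\<close> together with an arbitrary member of
  \<open>T\<close>.\<close>

definition general_triangle :: "real^3 \<Rightarrow> real^3 \<Rightarrow> real^3 \<Rightarrow> bool" where
  "general_triangle p q r \<longleftrightarrow> off_planes p \<and> off_planes q \<and> off_planes r
     \<and> avoids_edges p q \<and> avoids_edges q r \<and> avoids_edges p r
     \<and> (\<exists>n \<beta>. n \<bullet> p = \<beta> \<and> n \<bullet> q = \<beta> \<and> n \<bullet> r = \<beta> \<and> (\<forall>v\<in>\<Union>T. n \<bullet> v \<noteq> \<beta>))"

lemma fin_t: "t \<in> T \<Longrightarrow> finite t"
  using card_T by (metis card.infinite zero_neq_numeral)

lemma finite_vertices: "finite (\<Union>T)"
  using finite_T fin_t by blast

lemma finite_edges: "finite edges"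
proof -
  have "edges \<subseteq> Pow (\<Union>T)" by (auto simp: edges_def)
  then show ?thesis using finite_vertices by (meson finite_Pow_iff finite_subset)
qed

lemma vertex_in_edge:
  assumes "v \<in> \<Union>T"
  obtains e where "e \<in> edges" "v \<in> e"
proof -
  obtain t where t: "t \<in> T" "v \<in> t" using assms by blast
  then have "card (t - {v}) = 2" using card_T fin_t by simp
  then obtain w where "w \<in> t" "w \<noteq> v" by (metis Diff_iff card.empty equals0I insertCI zero_neq_numeral)
  then have "{v, w} \<in> edges" using t by (auto simp: edges_def card_2_iff)
  then show thesis using that by blast
qed

lemma plane_of:
  assumes "t \<in> T"
  obtains n \<beta> where "n \<noteq> 0" "affine hull t = {x. n \<bullet> x = \<beta>}"
proof -
  have "aff_dim t = DIM(real^3) - 1"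
    using aff_dim_affine_independent[OF indep_T[OF assms]] card_T[OF assms] by simp
  then show thesis using aff_dim_eq_hyperplane that by blast
qed

lemma hull_in_plane: "convex hull t \<subseteq> affine hull t"
  by (rule convex_hull_subset_affine_hull)

lemma closed_support: "closed support"
  unfolding support_def using finite_T fin_t by (intro closed_UN_hulls)

lemma off_planes_off_support: "off_planes p \<Longrightarrow> p \<notin> support"
  unfolding off_planes_def support_def using hull_in_plane by blast

lemma general_triangle_parity:
  assumes g: "general_triangle p q r" and t: "t \<in> T"
  shows "even (of_bool (crosses p q t) + of_bool (crosses q r t) + of_bool (crosses p r t)
    + card {e. card e = 2 \<and> e \<subseteq> t \<and> convex hull e \<inter> convex hull {p, q, r} \<noteq> {}})"
proof -
  obtain a b c where abc: "t = {a, b, c}" "a \<noteq> b" "b \<noteq> c" "a \<noteq> c"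
    using card_T[OF t] by (auto simp: card_3_iff)
  obtain n \<beta> where n: "affine hull t = {x. n \<bullet> x = \<beta>}" using plane_of[OF t] by blast
  have "t \<subseteq> {x. n \<bullet> x = \<beta>}" unfolding n[symmetric] by (rule hull_subset)
  then have t_n: "n \<bullet> a = \<beta>" "n \<bullet> b = \<beta>" "n \<bullet> c = \<beta>" by (auto simp: abc)
  have s_n: "n \<bullet> p \<noteq> \<beta>" "n \<bullet> q \<noteq> \<beta>" "n \<bullet> r \<noteq> \<beta>"
    using g t n unfolding general_triangle_def off_planes_def by auto
  obtain m \<gamma> where s_m: "m \<bullet> p = \<gamma>" "m \<bullet> q = \<gamma>" "m \<bullet> r = \<gamma>" and "\<forall>v\<in>\<Union>T. m \<bullet> v \<noteq> \<gamma>"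
    using g unfolding general_triangle_def by blast
  then have t_m: "m \<bullet> a \<noteq> \<gamma>" "m \<bullet> b \<noteq> \<gamma>" "m \<bullet> c \<noteq> \<gamma>" using t abc by auto
  have E: "{a, b} \<in> edges" "{b, c} \<in> edges" "{a, c} \<in> edges"
    using abc t by (auto simp: edges_def intro!: bexI[OF _ t])
  have disj: "(closed_segment p q \<union> closed_segment q r \<union> closed_segment p r) \<inter>
               (closed_segment a b \<union> closed_segment b c \<union> closed_segment a c) = {}"
    using g E unfolding general_triangle_def avoids_edges_def segment_convex_hull by blast
  have "{e. card e = 2 \<and> e \<subseteq> t \<and> convex hull e \<inter> convex hull {p, q, r} \<noteq> {}}
      = {e \<in> {{a, b}, {b, c}, {a, c}}. convex hull e \<inter> convex hull {p, q, r} \<noteq> {}}"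
    unfolding triangle_edges[OF abc(2-4), symmetric] abc(1) by blast
  then have "card {e. card e = 2 \<and> e \<subseteq> t \<and> convex hull e \<inter> convex hull {p, q, r} \<noteq> {}}
    = (\<Sum>e\<in>{{a, b}, {b, c}, {a, c}}. of_bool (convex hull e \<inter> convex hull {p, q, r} \<noteq> {}))"
    by (simp add: sum_of_bool_eq Int_def)
  also have "\<dots> = of_bool (convex hull {a, b} \<inter> convex hull {p, q, r} \<noteq> {})
      + of_bool (convex hull {b, c} \<inter> convex hull {p, q, r} \<noteq> {})
      + of_bool (convex hull {a, c} \<inter> convex hull {p, q, r} \<noteq> {})"
    using abc by (simp add: doubleton_eq_iff)
  finally show ?thesis
    using triangle_pair_parity[OF t_n s_m s_n t_m disj] unfolding crosses_def abc(1) segment_convex_hull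
    by (simp only:)
qed

text \<open>Pairs of a triangle of \<open>z\<close> and one of its edges meeting the hull of
  \<open>p\<close>, \<open>q\<close>, \<open>r\<close> are counted by triangles and by edges. The
  last sum is even when \<open>z\<close> is a cycle, and it is a single degree when only one edge is
  met; these are the two uses.\<close>

lemma general_triangle_sum_parity:
  assumes g: "general_triangle p q r" and z: "z \<subseteq> T"
  shows "even (card {t \<in> z. crosses p q t} + card {t \<in> z. crosses q r t} + card {t \<in> z. crosses p r t}
    + (\<Sum>e | e \<in> edges \<and> convex hull e \<inter> convex hull {p, q, r} \<noteq> {}. card {t \<in> z. e \<subseteq> t}))"
proof -
  have fz: "finite z" using z finite_T finite_subset by blast
  let ?C = "\<lambda>e. convex hull e \<inter> convex hull {p, q, r} \<noteq> {}"
  have "even (\<Sum>t\<in>z. of_bool (crosses p q t) + of_bool (crosses q r t) + of_bool (crosses p r t)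
    + card {e. card e = 2 \<and> e \<subseteq> t \<and> ?C e})"
    using general_triangle_parity[OF g] z by (intro dvd_sum) blast
  also have "(\<Sum>t\<in>z. of_bool (crosses p q t) + of_bool (crosses q r t) + of_bool (crosses p r t)
    + card {e. card e = 2 \<and> e \<subseteq> t \<and> ?C e}) =
    card {t \<in> z. crosses p q t} + card {t \<in> z. crosses q r t} + card {t \<in> z. crosses p r t}
    + (\<Sum>t\<in>z. card {e. card e = 2 \<and> e \<subseteq> t \<and> ?C e})"
    using fz by (simp add: sum.distrib sum_of_bool_eq Int_def)
  also have "(\<Sum>t\<in>z. card {e. card e = 2 \<and> e \<subseteq> t \<and> ?C e}) =
    (\<Sum>t\<in>z. card {e \<in> {e \<in> edges. ?C e}. e \<subseteq> t})"
    using z by (intro sum.cong arg_cong[of _ _ card]) (auto simp: edges_def)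
  also have "\<dots> = (\<Sum>e | e \<in> edges \<and> ?C e. card {t \<in> z. e \<subseteq> t})"
    using sum_multicount_gen[of z "{e \<in> edges. ?C e}" "\<lambda>t e. e \<subseteq> t" "\<lambda>e. card {t \<in> z. e \<subseteq> t}"] fz finite_edges by simp
  finally show ?thesis .
qed

lemma proper_face_disjoint:
  assumes "t \<in> T" "c \<subseteq> t" "c \<noteq> t"
  shows "rel_interior (convex hull t) \<inter> convex hull c = {}"
proof -
  have "convex hull c face_of convex hull t"
    using assms indep_T by (auto simp: face_of_convex_hull_affine_independent)
  moreover obtain u where "u \<in> t" "u \<notin> c" using assms(2,3) by blast
  then have "convex hull c \<noteq> convex hull t"
    using affine_independent_vertex_in_hull[OF indep_T[OF assms(1)] assms(2)] by (metis hull_inc)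
  ultimately show ?thesis using face_of_disjoint_rel_interior by blast
qed

text \<open>Different triangles have equally many vertices, so they share a proper face of each, and
  that misses the relative interior.\<close>

lemma rel_interior_disjoint:
  assumes "t \<in> T" "t' \<in> T" "t \<noteq> t'"
  shows "rel_interior (convex hull t) \<inter> convex hull t' = {}"
proof -
  have "t \<inter> t' \<noteq> t" using assms card_T fin_t by (metis card_subset_eq inf.absorb_iff1 inf.commute)
  then have "rel_interior (convex hull t) \<inter> convex hull (t \<inter> t') = {}"
    using proper_face_disjoint[OF assms(1)] by blast
  then show ?thesis using meet_T[OF assms(1,2)] rel_interior_subset[of "convex hull t"] by blast
qed

lemma rel_interior_or_edge:
  assumes "t \<in> T" "x \<in> convex hull t"
  shows "x \<in> rel_interior (convex hull t) \<or> (\<exists>e\<in>edges. x \<in> convex hull e)"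
proof (cases "x \<in> rel_interior (convex hull t)")
  case False
  then have "x \<in> rel_frontier (convex hull t)"
    using assms(2) closure_subset by (auto simp: rel_frontier_def)
  then obtain v where v: "v \<in> t" "x \<in> convex hull (t - {v})"
    using rel_frontier_convex_hull_cases[OF indep_T[OF assms(1)]] by auto
  have "t - {v} \<in> edges" using v assms(1) card_T fin_t by (auto simp: edges_def)
  then show ?thesis using v by blast
qed simp

text \<open>Both ends are off the plane of \<open>t\<close>, so the segment passes through it in one
  point; a point of \<open>t\<close> on no edge lies in the relative interior.\<close>

lemma crossing_point:
  assumes "off_planes p" "off_planes q" "avoids_edges p q" "t \<in> T" "crosses p q t"
    and n: "affine hull t = {x. n \<bullet> x = \<beta>}"
  obtains x where "closed_segment p q \<inter> affine hull t = {x}" "x \<in> rel_interior (convex hull t)"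
    "(n \<bullet> p - \<beta>) * (n \<bullet> q - \<beta>) < 0"
proof -
  obtain y where y: "y \<in> closed_segment p q" "y \<in> convex hull t" using assms(5) by (auto simp: crosses_def)
  then have "y \<in> affine hull t" using hull_in_plane by blast
  have "n \<bullet> p - \<beta> \<noteq> 0" "n \<bullet> q - \<beta> \<noteq> 0" using assms(1,2,4) n by (auto simp: off_planes_def)
  moreover have "\<not> (n \<bullet> p - \<beta>) * (n \<bullet> q - \<beta>) > 0"
    using segment_misses_hyperplane[of n p \<beta> q] y \<open>y \<in> affine hull t\<close> n by blast
  ultimately have neg: "(n \<bullet> p - \<beta>) * (n \<bullet> q - \<beta>) < 0"
    by (metis linorder_neqE_linordered_idom mult_eq_0_iff)
  have "closed_segment p q \<inter> affine hull t = {y}"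
    using segment_meets_hyperplane_once[OF neg] y(1) \<open>y \<in> affine hull t\<close> unfolding n by (metis IntI singletonD)
  moreover have "y \<in> rel_interior (convex hull t)"
    using rel_interior_or_edge[OF assms(4) y(2)] assms(3) y(1) by (auto simp: avoids_edges_def)
  ultimately show thesis using neg that by blast
qed

section \<open>Components of the complement and the two sides of a triangle\<close>

definition region :: "real^3 \<Rightarrow> (real^3) set" where
  "region p = connected_component_set (- support) p"

lemma region_segment:
  assumes "closed_segment p q \<inter> support = {}"
  shows "region p = region q"
proof -
  have "connected_component (- support) p q"
    unfolding connected_component_def using assms by (intro exI[of _ "closed_segment p q"]) auto
  then show ?thesis unfolding region_def by (metis connected_component_eq mem_Collect_eq)
qed

text \<open>The path from \<open>p\<close> through \<open>x\<close> and \<open>y\<close> to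
  \<open>a\<close> stays in the closed halfspace above the plane of \<open>t\<close> and away from
  all other triangles. Pushed slightly in direction \<open>n\<close> it leaves the plane and so
  misses every triangle.\<close>

lemma region_same_side_aux:
  assumes t: "t \<in> T" and n: "affine hull t = {x. n \<bullet> x = \<beta>}" "n \<noteq> 0"
    and p: "n \<bullet> p > \<beta>" and a: "n \<bullet> a > \<beta>"
    and x: "x \<in> rel_interior (convex hull t)" and y: "y \<in> rel_interior (convex hull t)"
    and px: "\<And>t'. t' \<in> T \<Longrightarrow> t' \<noteq> t \<Longrightarrow> closed_segment p x \<inter> convex hull t' = {}"
    and ay: "\<And>t'. t' \<in> T \<Longrightarrow> t' \<noteq> t \<Longrightarrow> closed_segment a y \<inter> convex hull t' = {}"
  shows "region p = region a"
proof -
  let ?O = "\<Union>t'\<in>T - {t}. convex hull t'"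
  let ?S = "closed_segment p x \<union> closed_segment x y \<union> closed_segment y a"
  have "closed ?O" using finite_T fin_t by (intro closed_UN_hulls) auto
  moreover have "closed_segment x y \<subseteq> rel_interior (convex hull t)"
    using x y by (intro closed_segment_subset convex_rel_interior) auto
  then have "?S \<inter> ?O = {}"
    using px ay rel_interior_disjoint[OF t] by (fastforce simp: closed_segment_commute)
  moreover have "compact ?S" by (intro compact_Un compact_segment)
  ultimately obtain \<delta> where \<delta>: "\<delta> > 0" "\<And>u v. u \<in> ?S \<Longrightarrow> v \<in> ?O \<Longrightarrow> \<delta> \<le> dist u v"
    using separate_compact_closed by metis
  \<comment> \<open>A push by half of the distance \<open>\<delta>\<close> cannot reach another
    triangle.\<close>
  define w where "w = (\<delta> / (2 * norm n)) *\<^sub>R n"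
  have nw: "norm w = \<delta> / 2" "n \<bullet> w > 0" using \<delta>(1) n(2) by (auto simp: w_def)
  have "n \<bullet> x = \<beta>" "n \<bullet> y = \<beta>" using x y rel_interior_subset hull_in_plane n by blast+
  then have "?S \<subseteq> {v. n \<bullet> v \<ge> \<beta>}"
    using p a by (intro Un_least closed_segment_subset convex_halfspace_ge) auto
  then have off: "v + s *\<^sub>R w \<notin> support" if "v \<in> ?S" "0 \<le> s" "s \<le> 1" "n \<bullet> (v + s *\<^sub>R w) > \<beta>" for v s
  proof -
    have "dist v (v + s *\<^sub>R w) = s * (\<delta> / 2)" using that(2) nw(1) by (simp add: dist_norm)
    also have "\<dots> \<le> \<delta> / 2" using that(3) \<delta>(1) by (simp add: mult_left_le_one_le)
    finally have "dist v (v + s *\<^sub>R w) < \<delta>" using \<delta>(1) by linarith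
    then have "v + s *\<^sub>R w \<notin> ?O" using \<delta>(2)[OF that(1)] by force
    moreover have "v + s *\<^sub>R w \<notin> convex hull t" using that(4) hull_in_plane n(1) by fastforce
    ultimately show ?thesis unfolding support_def by blast
  qed
  have vert: "region v = region (v + w)" if "v \<in> ?S" "n \<bullet> v > \<beta>" for v
  proof (rule region_segment)
    have "v + s *\<^sub>R w \<notin> support" if s: "0 \<le> s" "s \<le> 1" for s
    proof (rule off[OF \<open>v \<in> ?S\<close> s])
      show "\<beta> < n \<bullet> (v + s *\<^sub>R w)"
        using \<open>n \<bullet> v > \<beta>\<close> mult_nonneg_nonneg[OF s(1) less_imp_le[OF nw(2)]] by (simp add: inner_add_right)
    qed
    then show "closed_segment v (v + w) \<inter> support = {}"
      by (auto simp: closed_segment_def algebra_simps)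
  qed
  have shift: "v + w \<notin> support" if "v \<in> ?S" for v
  proof -
    have "n \<bullet> v \<ge> \<beta>" using \<open>?S \<subseteq> {v. n \<bullet> v \<ge> \<beta>}\<close> that by blast
    then have "n \<bullet> (v + 1 *\<^sub>R w) > \<beta>" using nw(2) by (simp add: inner_add_right)
    from off[OF that _ _ this] show ?thesis by simp
  qed
  have seg: "region (u + w) = region (v + w)" if "closed_segment u v \<subseteq> ?S" for u v
  proof (rule region_segment)
    have "closed_segment (u + w) (v + w) = (\<lambda>z. z + w) ` closed_segment u v"
      using closed_segment_translation[of w u v] by (simp add: add.commute)
    then show "closed_segment (u + w) (v + w) \<inter> support = {}" using shift that by auto
  qed
  have "region p = region (p + w)" using vert p by auto
  also have "\<dots> = region (x + w)" by (rule seg) blast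
  also have "\<dots> = region (y + w)" by (rule seg) blast
  also have "\<dots> = region (a + w)" by (rule seg) blast
  also have "\<dots> = region a" using vert a by auto
  finally show ?thesis .
qed

text \<open>Two generic points on opposite sides of \<open>t\<close> witness its two sides: their
  segment meets no other triangle, so they lie in the regions that \<open>t\<close> borders. It is a
  relation because no choice of the points is canonical.\<close>

definition side_pair :: "(real^3) set \<Rightarrow> real^3 \<Rightarrow> real^3 \<Rightarrow> bool" where
  "side_pair t a b \<longleftrightarrow> t \<in> T \<and> off_planes a \<and> off_planes b \<and> avoids_edges a b
     \<and> (\<forall>t'\<in>T. crosses a b t' \<longleftrightarrow> t' = t)"

lemma crosses_commute: "crosses p q t \<longleftrightarrow> crosses q p t"
  by (simp add: crosses_def closed_segment_commute)

lemma avoids_edges_commute: "avoids_edges p q \<longleftrightarrow> avoids_edges q p"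
  by (simp add: avoids_edges_def closed_segment_commute)

lemma side_pair_commute: "side_pair t a b \<longleftrightarrow> side_pair t b a"
  by (auto simp: side_pair_def crosses_commute[of a b] avoids_edges_commute[of a b])

lemma side_pair_crossing:
  assumes "side_pair t a b" "affine hull t = {x. n \<bullet> x = \<beta>}"
  obtains x where "x \<in> closed_segment a b" "x \<in> rel_interior (convex hull t)" "(n \<bullet> a - \<beta>) * (n \<bullet> b - \<beta>) < 0"
proof -
  have "off_planes a" "off_planes b" "avoids_edges a b" "t \<in> T" "crosses a b t"
    using assms(1) by (auto simp: side_pair_def)
  from crossing_point[OF this assms(2)] show thesis using that by blast
qed

lemma side_pair_region:
  assumes ab: "side_pair t a b" and pq: "side_pair t p q"
    and n: "affine hull t = {x. n \<bullet> x = \<beta>}" "n \<noteq> 0" and "n \<bullet> a > \<beta>" "n \<bullet> p > \<beta>"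
  shows "region a = region p \<and> region b = region q"
proof -
  have t: "t \<in> T" using ab by (simp add: side_pair_def)
  obtain x where x: "x \<in> closed_segment a b" "x \<in> rel_interior (convex hull t)"
    and "(n \<bullet> a - \<beta>) * (n \<bullet> b - \<beta>) < 0" using side_pair_crossing[OF ab n(1)] .
  then have "n \<bullet> b < \<beta>" using \<open>n \<bullet> a > \<beta>\<close> by (simp add: mult_less_0_iff)
  obtain y where y: "y \<in> closed_segment p q" "y \<in> rel_interior (convex hull t)"
    and "(n \<bullet> p - \<beta>) * (n \<bullet> q - \<beta>) < 0" using side_pair_crossing[OF pq n(1)] .
  then have "n \<bullet> q < \<beta>" using \<open>n \<bullet> p > \<beta>\<close> by (simp add: mult_less_0_iff)
  have sub: "closed_segment a x \<subseteq> closed_segment a b" "closed_segment b x \<subseteq> closed_segment a b"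
    "closed_segment p y \<subseteq> closed_segment p q" "closed_segment q y \<subseteq> closed_segment p q"
    using x(1) y(1) by (auto simp: subset_closed_segment closed_segment_commute)
  have miss: "closed_segment a b \<inter> convex hull t' = {}" "closed_segment p q \<inter> convex hull t' = {}"
    if "t' \<in> T" "t' \<noteq> t" for t'
    using ab pq that by (auto simp: side_pair_def crosses_def)
  \<comment> \<open>Reversing the normal turns the side of \<open>b\<close> and \<open>q\<close>
    into the positive one.\<close>
  have "affine hull t = {x. (- n) \<bullet> x = - \<beta>}" using n by simp
  then have "region b = region q"
    using region_same_side_aux[of t "- n" "- \<beta>" b q x y] t n(2) \<open>n \<bullet> b < \<beta>\<close> \<open>n \<bullet> q < \<beta>\<close> x(2) y(2) sub(2,4) miss
    by (simp add: disjoint_iff subset_iff)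
  moreover have "region a = region p"
    using region_same_side_aux[OF t n \<open>n \<bullet> a > \<beta>\<close> \<open>n \<bullet> p > \<beta>\<close> x(2) y(2)] sub(1,3) miss by blast
  ultimately show ?thesis by blast
qed

text \<open>Up to order the two regions do not depend on the witnesses, and being separated by
  \<open>G\<close> is symmetric in them. The four cases are the possible orientations of the two
  segments.\<close>

lemma side_pair_unique:
  assumes ab: "side_pair t a b" and pq: "side_pair t p q"
  shows "(region a \<in> G) \<noteq> (region b \<in> G) \<longleftrightarrow> (region p \<in> G) \<noteq> (region q \<in> G)"
proof -
  have t: "t \<in> T" using ab by (simp add: side_pair_def)
  obtain n \<beta> where n: "n \<noteq> 0" "affine hull t = {x. n \<bullet> x = \<beta>}" using plane_of[OF t] .
  have pos: "n \<bullet> u > \<beta> \<or> n \<bullet> v > \<beta>" if "side_pair t u v" for u v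
    using side_pair_crossing[OF that n(2)] by (force simp: mult_less_0_iff)
  have ba: "side_pair t b a" and qp: "side_pair t q p" using ab pq side_pair_commute by blast+
  consider "n \<bullet> a > \<beta>" "n \<bullet> p > \<beta>" | "n \<bullet> b > \<beta>" "n \<bullet> p > \<beta>" | "n \<bullet> a > \<beta>" "n \<bullet> q > \<beta>" | "n \<bullet> b > \<beta>" "n \<bullet> q > \<beta>"
    using pos[OF ab] pos[OF pq] by blast
  then show ?thesis
  proof cases
    case 1 then show ?thesis using side_pair_region[OF ab pq n(2,1)] by metis
  next
    case 2 then show ?thesis using side_pair_region[OF ba pq n(2,1)] by metis
  next
    case 3 then show ?thesis using side_pair_region[OF ab qp n(2,1)] by metis
  next
    case 4 then show ?thesis using side_pair_region[OF ba qp n(2,1)] by metis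
  qed
qed

text \<open>A segment crossing several triangles is cut at a point between two of the crossings.\<close>

lemma segment_jump_parity:
  assumes J: "J \<subseteq> T" "\<And>t a b. side_pair t a b \<Longrightarrow> t \<in> J \<longleftrightarrow> (region a \<in> G) \<noteq> (region b \<in> G)"
    and "off_planes p" "off_planes q" "avoids_edges p q"
  shows "(region p \<in> G) \<noteq> (region q \<in> G) \<longleftrightarrow> odd (card {t \<in> J. crosses p q t})"
  using assms(3-)
\<comment> \<open>Crossings with all of \<open>T\<close> are counted here, not only those with
  \<open>J\<close>, since the base case needs a segment free of the whole
  \<open>support\<close>.\<close>
proof (induction "card {t \<in> T. crosses p q t}" arbitrary: p q rule: less_induct)
  case less
  have fin: "finite {t \<in> T. crosses p q t}" for p q using finite_T by simp
  have finJ: "finite J" using J(1) finite_T finite_subset by blast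
  consider "{t \<in> T. crosses p q t} = {}" | t where "{t \<in> T. crosses p q t} = {t}"
    | t t' where "t \<in> T" "t' \<in> T" "crosses p q t" "crosses p q t'" "t \<noteq> t'"
  proof -
    have "S = {} \<or> (\<exists>t. S = {t}) \<or> (\<exists>t t'. t \<in> S \<and> t' \<in> S \<and> t \<noteq> t')" for S :: "(real^3) set set" by blast
    from this[of "{t \<in> T. crosses p q t}"] show ?thesis using that by blast
  qed
  then show ?case
  proof cases
    case 1
    then have "closed_segment p q \<inter> support = {}" by (auto simp: support_def crosses_def)
    then have "region p = region q" by (rule region_segment)
    moreover have "{t \<in> J. crosses p q t} = {}" using 1 J(1) by blast
    ultimately show ?thesis by (metis card.empty even_zero)
  next
    case 2
    then have "side_pair t p q" using less.prems by (auto simp: side_pair_def)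
    from J(2)[OF this] have "t \<in> J \<longleftrightarrow> (region p \<in> G) \<noteq> (region q \<in> G)" .
    moreover have "{t \<in> J. crosses p q t} = (if t \<in> J then {t} else {})" using 2 J(1) by auto
    ultimately show ?thesis by simp
  next
    case 3
    have pt: "\<exists>x. closed_segment p q \<inter> affine hull s = {x} \<and> x \<in> rel_interior (convex hull s)"
      if "s \<in> T" "crosses p q s" for s
    proof -
      obtain n \<beta> where "affine hull s = {x. n \<bullet> x = \<beta>}" using plane_of[OF \<open>s \<in> T\<close>] by blast
      from crossing_point[OF less.prems that this] show ?thesis by blast
    qed
    obtain x where x: "closed_segment p q \<inter> affine hull t = {x}" "x \<in> rel_interior (convex hull t)" using pt 3 by blast
    obtain y where y: "closed_segment p q \<inter> affine hull t' = {y}" "y \<in> rel_interior (convex hull t')" using pt 3 by blast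
    have "x \<noteq> y" using rel_interior_disjoint[OF 3(1,2,5)] x y rel_interior_subset by blast
    \<comment> \<open>The segment meets the finitely many planes in finitely many points, so some
      \<open>m\<close> strictly between \<open>x\<close> and \<open>y\<close> is off all of
      them.\<close>
    have "finite (closed_segment p q \<inter> affine hull s)" if "s \<in> T" for s
    proof -
      obtain n \<beta> where n: "affine hull s = {x. n \<bullet> x = \<beta>}" using plane_of[OF \<open>s \<in> T\<close>] by blast
      have "n \<bullet> p \<noteq> \<beta>" "n \<bullet> q \<noteq> \<beta>" using less.prems that n by (auto simp: off_planes_def)
      then have "(n \<bullet> p - \<beta>) * (n \<bullet> q - \<beta>) < 0 \<or> (n \<bullet> p - \<beta>) * (n \<bullet> q - \<beta>) > 0"
        by (metis eq_iff_diff_eq_0 linorder_neqE_linordered_idom mult_eq_0_iff)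
      then show ?thesis unfolding n
        using segment_meets_hyperplane_once[of n p \<beta> q] segment_misses_hyperplane[of n p \<beta> q] by auto
    qed
    then have "finite (\<Union>s\<in>T. closed_segment p q \<inter> affine hull s)" using finite_T by blast
    moreover have "infinite (open_segment x y)" using \<open>x \<noteq> y\<close> by (simp add: finite_open_segment)
    ultimately have "\<not> open_segment x y \<subseteq> (\<Union>s\<in>T. closed_segment p q \<inter> affine hull s)"
      using finite_subset by blast
    then obtain m where m: "m \<in> open_segment x y" "m \<notin> (\<Union>s\<in>T. closed_segment p q \<inter> affine hull s)"
      by blast
    have xy: "x \<in> closed_segment p q" "y \<in> closed_segment p q" using x y by auto
    then have "closed_segment x y \<subseteq> closed_segment p q" by (simp add: subset_closed_segment)
    then have mpq: "m \<in> closed_segment p q" using m(1) open_closed_segment by blast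
    then have off_m: "off_planes m" using m(2) unfolding off_planes_def by blast
    have split: "closed_segment p m \<union> closed_segment m q = closed_segment p q" "closed_segment p m \<inter> closed_segment m q = {m}"
      using Un_closed_segment[OF mpq] Int_closed_segment[of m p q] mpq by simp_all
    \<comment> \<open>A triangle crossed by both halves would be crossed at \<open>m\<close>, as the
      segment has only one point in its plane; but \<open>m\<close> is off all planes.\<close>
    have sel: "crosses p q s \<longleftrightarrow> crosses p m s \<or> crosses m q s" "\<not> (crosses p m s \<and> crosses m q s)" if s: "s \<in> T" for s
    proof -
      show "crosses p q s \<longleftrightarrow> crosses p m s \<or> crosses m q s"
        unfolding crosses_def split(1)[symmetric] by blast
      show "\<not> (crosses p m s \<and> crosses m q s)"
      proof
        assume c: "crosses p m s \<and> crosses m q s"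
        then obtain w where w: "closed_segment p q \<inter> affine hull s = {w}"
          using pt[OF s] \<open>crosses p q s \<longleftrightarrow> crosses p m s \<or> crosses m q s\<close> by blast
        obtain w1 w2 where "w1 \<in> closed_segment p m" "w2 \<in> closed_segment m q" "w1 \<in> convex hull s" "w2 \<in> convex hull s"
          using c unfolding crosses_def by blast
        moreover from this have "w1 \<in> {w}" "w2 \<in> {w}"
          unfolding w[symmetric] split(1)[symmetric] using hull_in_plane[of s] by blast+
        ultimately have "m \<in> convex hull s" using split(2) by (metis IntI singletonD)
        then show False using s off_m hull_in_plane unfolding off_planes_def by blast
      qed
    qed
    \<comment> \<open>As \<open>m\<close> is an endpoint of each half and lies strictly between
      \<open>x\<close> and \<open>y\<close>, no half contains both of them. Hence each half crosses
      fewer triangles than the whole segment.\<close>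
    have sides: "(x \<in> closed_segment p m \<and> y \<in> closed_segment m q) \<or> (y \<in> closed_segment p m \<and> x \<in> closed_segment m q)"
    proof (rule ccontr)
      assume "\<not> ?thesis"
      then have "(x \<in> closed_segment p m \<and> y \<in> closed_segment p m) \<or> (x \<in> closed_segment m q \<and> y \<in> closed_segment m q)"
        using xy unfolding split(1)[symmetric] by blast
      moreover have "m extreme_point_of closed_segment p m" "m extreme_point_of closed_segment m q"
        by (simp_all add: extreme_point_of_segment)
      ultimately show False using m(1) unfolding extreme_point_of_def by blast
    qed
    have xt: "x \<in> convex hull t" "y \<in> convex hull t'" using x y rel_interior_subset by blast+
    have ne: "{s \<in> T. crosses p m s} \<noteq> {}" "{s \<in> T. crosses m q s} \<noteq> {}"
      using sides xt 3(1,2) unfolding crosses_def by (elim disjE conjE; blast)+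
    have un: "{s \<in> T. crosses p q s} = {s \<in> T. crosses p m s} \<union> {s \<in> T. crosses m q s}" using sel(1) by blast
    have dis: "{s \<in> T. crosses p m s} \<inter> {s \<in> T. crosses m q s} = {}" using sel(2) by blast
    have lt: "card {s \<in> T. crosses p m s} < card {s \<in> T. crosses p q s}" "card {s \<in> T. crosses m q s} < card {s \<in> T. crosses p q s}"
      unfolding un card_Un_disjoint[OF fin fin dis] using ne by (auto simp: card_gt_0_iff fin)
    have av: "avoids_edges p m" "avoids_edges m q"
      using less.prems(3) unfolding avoids_edges_def split(1)[symmetric] by blast+
    have "{s \<in> J. crosses p q s} = {s \<in> J. crosses p m s} \<union> {s \<in> J. crosses m q s}"
      "{s \<in> J. crosses p m s} \<inter> {s \<in> J. crosses m q s} = {}" using un dis J(1) by blast+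
    then have "card {s \<in> J. crosses p q s} = card {s \<in> J. crosses p m s} + card {s \<in> J. crosses m q s}"
      using finJ by (simp add: card_Un_disjoint)
    then show ?thesis
      using less.hyps[OF lt(1) less.prems(1) off_m av(1)] less.hyps[OF lt(2) off_m less.prems(2) av(2)]
      by (simp only: odd_add) blast
  qed
qed

section \<open>Points in general position\<close>

definition general_pair :: "real^3 \<Rightarrow> real^3 \<Rightarrow> bool" where
  "general_pair p q \<longleftrightarrow> (\<forall>e\<in>edges. aff_dim (insert p (insert q e)) = 3)"

text \<open>This and \<open>general_pair\<close> are stated by dimensions because, once all points
  but one are fixed, they ask the last point to avoid finitely many planes.\<close>

definition general_triple :: "real^3 \<Rightarrow> real^3 \<Rightarrow> real^3 \<Rightarrow> bool" where
  "general_triple p q r \<longleftrightarrow> (\<forall>v\<in>\<Union>T. aff_dim {p, q, r, v} = 3)"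

lemma general_pair_commute: "general_pair p q \<longleftrightarrow> general_pair q p"
  by (simp add: general_pair_def insert_commute)

lemma edge_in_triangle:
  assumes "e \<in> edges"
  obtains t where "t \<in> T" "e \<subseteq> t" "card e = 2" "finite e"
  using assms fin_t by (auto simp: edges_def intro: finite_subset)

lemma off_planes_not_in_edge:
  assumes "off_planes p" "e \<in> edges"
  shows "p \<notin> affine hull e"
proof -
  obtain t where "t \<in> T" "e \<subseteq> t" using edge_in_triangle[OF assms(2)] by blast
  then show ?thesis using assms(1) hull_mono[of e t affine] by (auto simp: off_planes_def)
qed

lemma off_planes_edge_dim:
  assumes "off_planes p" "e \<in> edges"
  shows "aff_dim (insert p e) = 2"
proof -
  obtain x y where "e = {x, y}" "x \<noteq> y" using assms(2) by (auto simp: edges_def card_2_iff)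
  then have "aff_dim e = 1" by simp
  then show ?thesis using off_planes_not_in_edge[OF assms] by (simp add: aff_dim_insert)
qed

text \<open>If the segment met \<open>e\<close> in a point \<open>x\<close>, then \<open>q\<close>
  would lie on the line through \<open>p\<close> and \<open>x\<close>, hence in the plane spanned by
  \<open>p\<close> and \<open>e\<close>.\<close>

lemma general_pair_avoids_edges:
  assumes "off_planes p" "general_pair p q"
  shows "avoids_edges p q"
  unfolding avoids_edges_def
proof (rule ballI, rule ccontr)
  fix e assume e: "e \<in> edges" and "closed_segment p q \<inter> convex hull e \<noteq> {}"
  then obtain u where u: "(1 - u) *\<^sub>R p + u *\<^sub>R q \<in> affine hull e"
    using convex_hull_subset_affine_hull by (fastforce simp: closed_segment_def)
  define x where "x = (1 - u) *\<^sub>R p + u *\<^sub>R q"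
  have x: "x \<in> affine hull e" using u by (simp add: x_def)
  have "x \<noteq> p" using x off_planes_not_in_edge[OF assms(1) e] by blast
  then have u0: "u \<noteq> 0" by (auto simp: x_def)
  have "u *\<^sub>R q = x - (1 - u) *\<^sub>R p" by (simp add: x_def)
  then have "q = (1 / u) *\<^sub>R (x - (1 - u) *\<^sub>R p)" using u0 by (metis divide_self_if scaleR_one scaleR_scaleR times_divide_eq_left mult_1)
  then have q: "q = (1 / u) *\<^sub>R x + (1 - 1 / u) *\<^sub>R p"
    using u0 by (simp add: scaleR_diff_right algebra_simps diff_divide_distrib scaleR_diff_left)
  have "affine (affine hull (insert p e))" "x \<in> affine hull (insert p e)" "p \<in> affine hull (insert p e)"
    using x hull_mono[of e "insert p e" affine] by (auto simp: hull_inc)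
  then have "(1 / u) *\<^sub>R x + (1 - 1 / u) *\<^sub>R p \<in> affine hull (insert p e)"
    unfolding affine_def by simp
  then have "aff_dim (insert q (insert p e)) = 2"
    using off_planes_edge_dim[OF assms(1) e] q by (simp add: aff_dim_insert)
  then show False using assms(2) e by (simp add: general_pair_def insert_commute)
qed

lemma hyperplane_misses:
  fixes n :: "real^3"
  assumes "n \<noteq> 0" "aff_dim (insert v S) = 3" "\<And>x. x \<in> S \<Longrightarrow> n \<bullet> x = \<beta>"
  shows "n \<bullet> v \<noteq> \<beta>"
proof
  assume "n \<bullet> v = \<beta>"
  then have "insert v S \<subseteq> {x. n \<bullet> x = \<beta>}" using assms(3) by auto
  from aff_dim_subset[OF this] show False using assms(1,2) by (simp add: aff_dim_hyperplane)
qed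

lemma general_triangleI:
  assumes "off_planes p" "off_planes q" "off_planes r"
    "general_pair p q" "general_pair q r" "general_pair p r" "general_triple p q r"
  shows "general_triangle p q r"
proof -
  have "aff_dim {p, q, r} < DIM(real^3)"
    using aff_dim_three_points[of p q r] by simp
  then obtain n \<beta> where n: "n \<noteq> 0" "{p, q, r} \<subseteq> {x. n \<bullet> x = \<beta>}"
    using aff_lowdim_subset_hyperplane by blast
  have "n \<bullet> v \<noteq> \<beta>" if "v \<in> \<Union>T" for v
  proof (rule hyperplane_misses[OF n(1)])
    show "aff_dim (insert v {p, q, r}) = 3"
      using assms(7) that unfolding general_triple_def insert_commute[of v p] insert_commute[of v q] insert_commute[of v r]
      by blast
  qed (use n(2) in auto)
  then have "\<exists>n \<beta>. n \<bullet> p = \<beta> \<and> n \<bullet> q = \<beta> \<and> n \<bullet> r = \<beta> \<and> (\<forall>v\<in>\<Union>T. n \<bullet> v \<noteq> \<beta>)"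
    using n(2) by (intro exI[of _ n] exI[of _ \<beta>]) simp
  then show ?thesis
    unfolding general_triangle_def using assms general_pair_avoids_edges[OF assms(1,4)]
      general_pair_avoids_edges[OF assms(2,5)] general_pair_avoids_edges[OF assms(1,6)] by simp
qed

text \<open>Adding the other end of an edge at \<open>v\<close> gives dimension three, and one point
  raises the dimension by at most one.\<close>

lemma general_pair_vertex_dim:
  assumes "general_pair p q" "v \<in> \<Union>T"
  shows "aff_dim {p, q, v} = 2"
proof -
  obtain e where e: "e \<in> edges" "v \<in> e" using vertex_in_edge[OF assms(2)] .
  then obtain w where "e = {v, w}" by (auto simp: edges_def card_2_iff)
  then have "aff_dim (insert w {p, q, v}) = 3" using assms(1) e(1) by (auto simp: general_pair_def insert_commute)
  then have "aff_dim {p, q, v} \<ge> 2" by (simp add: aff_dim_insert split: if_splits)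
  then show ?thesis using aff_dim_three_points[of p q v] by linarith
qed

text \<open>\<open>P\<close> and \<open>Q\<close> list the points and pairs with which the new point
  has to be in general position; \<open>\<A>\<close> collects further sets to be avoided. Each
  demand removes a set of dimension at most two.\<close>

lemma general_point_exists:
  assumes "open U" "U \<noteq> {}" "finite P" "\<And>p. p \<in> P \<Longrightarrow> off_planes p"
    "finite Q" "\<And>p q. (p, q) \<in> Q \<Longrightarrow> general_pair p q"
    and "finite \<A>" "\<And>A. A \<in> \<A> \<Longrightarrow> aff_dim A < 3"
  obtains r where "r \<in> U" "off_planes r" "\<And>p. p \<in> P \<Longrightarrow> general_pair p r"
    "\<And>p q. (p, q) \<in> Q \<Longrightarrow> general_triple p q r" "\<And>A. A \<in> \<A> \<Longrightarrow> r \<notin> A"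
proof -
  let ?A1 = "(\<lambda>t. affine hull t) ` T"
  let ?A2 = "(\<lambda>(p, e). affine hull (insert p e)) ` (P \<times> edges)"
  let ?A3 = "(\<lambda>((p, q), v). affine hull {p, q, v}) ` (Q \<times> \<Union>T)"
  have "finite (?A1 \<union> ?A2 \<union> ?A3 \<union> \<A>)"
    using finite_T finite_edges finite_vertices assms by (intro finite_UnI finite_imageI finite_cartesian_product)
  moreover have "aff_dim A < DIM(real^3)" if A: "A \<in> ?A1 \<union> ?A2 \<union> ?A3 \<union> \<A>" for A
  proof -
    from A consider (1) t where "t \<in> T" "A = affine hull t" | (2) p e where "p \<in> P" "e \<in> edges" "A = affine hull (insert p e)"
      | (3) p q v where "(p, q) \<in> Q" "v \<in> \<Union>T" "A = affine hull {p, q, v}" | (4) "A \<in> \<A>" by fast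
    then show ?thesis
    proof cases
      case 1
      then show ?thesis using aff_dim_affine_independent[OF indep_T[OF 1(1)]] card_T[OF 1(1)] by simp
    next
      case 2
      then show ?thesis using off_planes_edge_dim assms(4) by simp
    next
      case 3
      then show ?thesis using general_pair_vertex_dim assms(6) by simp
    next
      case 4
      then show ?thesis using assms(8) by simp
    qed
  qed
  ultimately obtain r where r: "r \<in> U" "\<And>A. A \<in> ?A1 \<union> ?A2 \<union> ?A3 \<union> \<A> \<Longrightarrow> r \<notin> A"
    using avoid_finitely_many_affine[OF assms(1,2), of "?A1 \<union> ?A2 \<union> ?A3 \<union> \<A>"] by metis
  have "off_planes r" using r(2) by (auto simp: off_planes_def)
  moreover have "general_pair p r" if p: "p \<in> P" for p
  proof -
    have "aff_dim (insert r (insert p e)) = 3" if e: "e \<in> edges" for e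
    proof -
      have "r \<notin> affine hull (insert p e)" using p e by (intro r(2)) force
      then show ?thesis using off_planes_edge_dim[OF assms(4)[OF p] e] by (simp add: aff_dim_insert)
    qed
    then show ?thesis by (simp add: general_pair_def insert_commute)
  qed
  moreover have "general_triple p q r" if p: "(p, q) \<in> Q" for p q
  proof -
    have "aff_dim (insert r {p, q, v}) = 3" if v: "v \<in> \<Union>T" for v
    proof -
      have "r \<notin> affine hull {p, q, v}" using p v by (intro r(2)) force
      then show ?thesis using general_pair_vertex_dim[OF assms(6)[OF p] v] by (simp add: aff_dim_insert)
    qed
    then show ?thesis by (simp add: general_triple_def insert_commute)
  qed
  ultimately show thesis using that r by blast
qed

text \<open>A small ball around a relative interior point \<open>c\<close> of \<open>t\<close> meets
  no other triangle, and its part in the plane of \<open>t\<close> lies in \<open>t\<close>. Generic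
  points of the ball on either side of the plane are the witnesses.\<close>

lemma side_pair_exists:
  assumes t: "t \<in> T"
  obtains a b where "side_pair t a b" "general_pair a b"
proof -
  obtain n \<beta> where n: "n \<noteq> 0" "affine hull t = {x. n \<bullet> x = \<beta>}" using plane_of[OF t] .
  have "convex hull t \<noteq> {}" using card_T[OF t] by auto
  then have "rel_interior (convex hull t) \<noteq> {}" using rel_interior_eq_empty[of "convex hull t"] convex_convex_hull by blast
  then obtain c where c: "c \<in> rel_interior (convex hull t)" by blast
  let ?O = "\<Union>t'\<in>T - {t}. convex hull t'"
  have "closed ?O" using finite_T fin_t by (intro closed_UN_hulls) auto
  moreover have "c \<notin> ?O" using rel_interior_disjoint[OF t] c by blast
  ultimately obtain \<delta>1 where \<delta>1: "\<delta>1 > 0" "ball c \<delta>1 \<inter> ?O = {}"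
    by (metis disjoint_eq_subset_Compl open_Compl open_contains_ball ComplI)
  obtain \<delta>2 where \<delta>2: "\<delta>2 > 0" "ball c \<delta>2 \<inter> affine hull (convex hull t) \<subseteq> rel_interior (convex hull t)"
    using openin_rel_interior[of "convex hull t"] c unfolding openin_contains_ball by blast
  define \<delta> where "\<delta> = min \<delta>1 \<delta>2"
  have \<delta>: "\<delta> > 0" "ball c \<delta> \<inter> ?O = {}" "ball c \<delta> \<inter> affine hull t \<subseteq> rel_interior (convex hull t)"
    using \<delta>1 \<delta>2 by (auto simp: \<delta>_def)
  have nc: "n \<bullet> c = \<beta>" using c rel_interior_subset hull_in_plane n(2) by blast
  define w where "w = (\<delta> / (2 * norm n)) *\<^sub>R n"
  have nw: "norm w = \<delta> / 2" "n \<bullet> w > 0" using \<delta>(1) n(1) by (auto simp: w_def)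
  have "c + w \<in> ball c \<delta> \<inter> {x. n \<bullet> x > \<beta>}" "c - w \<in> ball c \<delta> \<inter> {x. n \<bullet> x < \<beta>}"
    using nw nc \<delta>(1) by (auto simp: dist_norm inner_add_right inner_diff_right)
  then have ne: "ball c \<delta> \<inter> {x. n \<bullet> x > \<beta>} \<noteq> {}" "ball c \<delta> \<inter> {x. n \<bullet> x < \<beta>} \<noteq> {}" by blast+
  have op: "open (ball c \<delta> \<inter> {x. n \<bullet> x > \<beta>})" "open (ball c \<delta> \<inter> {x. n \<bullet> x < \<beta>})"
    by (intro open_Int open_ball open_halfspace_gt open_halfspace_lt)+
  obtain a where a: "a \<in> ball c \<delta> \<inter> {x. n \<bullet> x > \<beta>}" "off_planes a"
    using general_point_exists[OF op(1) ne(1), of "{}" "{}" "{}"] by auto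
  obtain b where b: "b \<in> ball c \<delta> \<inter> {x. n \<bullet> x < \<beta>}" "off_planes b" "general_pair a b"
    using general_point_exists[OF op(2) ne(2), of "{a}" "{}" "{}"] a(2) by auto
  have sub: "closed_segment a b \<subseteq> ball c \<delta>" using a b by (intro closed_segment_subset) auto
  have "(n \<bullet> a - \<beta>) * (n \<bullet> b - \<beta>) < 0" using a b by (simp add: mult_less_0_iff)
  from segment_meets_hyperplane_once[OF this] obtain x where "x \<in> closed_segment a b" "x \<in> affine hull t"
    unfolding n(2) by blast
  then have "crosses a b t" using sub \<delta>(3) rel_interior_subset[of "convex hull t"] unfolding crosses_def by blast
  moreover have "\<not> crosses a b t'" if "t' \<in> T" "t' \<noteq> t" for t'
    using that sub \<delta>(2) unfolding crosses_def by blast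
  ultimately have "side_pair t a b"
    using t a b general_pair_avoids_edges unfolding side_pair_def by blast
  then show thesis using that b(3) by blast
qed

section \<open>Cuts are cycles\<close>

text \<open>For an edge \<open>e\<close> with midpoint \<open>m\<close>, a small triangle with
  barycentre \<open>m\<close> is placed in a generic plane through \<open>m\<close>, so that it
  meets no edge but \<open>e\<close>. Going around its sides returns to the starting region, so they
  cross the cut evenly often by \<open>segment_jump_parity\<close>; then
  \<open>general_triangle_sum_parity\<close> makes the degree of \<open>e\<close> even.\<close>

lemma separated_triangles_in_cycles:
  assumes sides: "\<And>t. t \<in> T \<Longrightarrow> \<exists>a b. side_pair t a b \<and> s1 t = region a \<and> s2 t = region b"
  shows "separated_triangles s1 s2 T G \<in> mod2_cycles T"
proof -
  define J where "J = separated_triangles s1 s2 T G"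
  have JT: "J \<subseteq> T" by (auto simp: J_def separated_triangles_def)
  have J: "t \<in> J \<longleftrightarrow> (region a \<in> G) \<noteq> (region b \<in> G)" if ab: "side_pair t a b" for t a b
  proof -
    have "t \<in> T" using ab by (simp add: side_pair_def)
    then obtain a' b' where "side_pair t a' b'" "s1 t = region a'" "s2 t = region b'" using sides by blast
    then show ?thesis using side_pair_unique[OF ab] \<open>t \<in> T\<close> by (simp add: J_def separated_triangles_def)
  qed
  have "even (card {t \<in> J. e \<subseteq> t})" if e2: "card e = 2" for e
  proof (cases "e \<in> edges")
    case False
    then have "{t \<in> J. e \<subseteq> t} = {}" using JT e2 by (auto simp: edges_def)
    then show ?thesis by (metis card.empty even_zero)
  next
    case e: True
    obtain u w where uw: "e = {u, w}" "u \<noteq> w" using e2 by (auto simp: card_2_iff)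
    define m where "m = midpoint u w"
    have m_open: "m \<in> open_segment u w" using uw(2) by (simp add: m_def)
    then have m_e: "m \<in> convex hull e" unfolding uw(1) segment_convex_hull[symmetric] using open_closed_segment by blast
    obtain t0 where t0: "t0 \<in> T" "e \<subseteq> t0" using edge_in_triangle[OF e] by blast
    \<comment> \<open>A triangle with another edge through \<open>m\<close> shares with
      \<open>t0\<close> a face containing an inner point of \<open>e\<close>, hence all of
      \<open>e\<close>; the same argument inside that triangle puts both ends of \<open>e\<close>
      into the other edge.\<close>
    have m_other: "m \<notin> convex hull e'" if e': "e' \<in> edges" "e' \<noteq> e" for e'
    proof
      assume m: "m \<in> convex hull e'"
      obtain t' where t': "t' \<in> T" "e' \<subseteq> t'" "card e' = 2" "finite e'" using edge_in_triangle[OF e'(1)] .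
      have "m \<in> convex hull t0" "m \<in> convex hull t'" using m m_e t0(2) t'(2) hull_mono by blast+
      then have "m \<in> convex hull (t0 \<inter> t')" using meet_T[OF t0(1) t'(1)] by blast
      then have "{u, w} \<subseteq> t0 \<inter> t'"
        using affine_independent_segment_in_hull[OF indep_T[OF t0(1)] _ _ _ uw(2) m_open] t0(2) uw(1) by blast
      then have "{u, w} \<subseteq> e'"
        using affine_independent_segment_in_hull[OF indep_T[OF t'(1)] t'(2) _ _ uw(2) m_open m] by blast
      then have "e = e'" using t' uw card_subset_eq[of e' e] by simp
      then show False using e'(2) by simp
    qed
    let ?O = "\<Union>e'\<in>edges - {e}. convex hull e'"
    have "closed ?O" using finite_edges edge_in_triangle by (intro closed_UN_hulls) auto
    moreover have "m \<notin> ?O" using m_other by blast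
    ultimately obtain d where d: "d > 0" "ball m d \<inter> ?O = {}"
      by (metis disjoint_eq_subset_Compl open_Compl open_contains_ball ComplI)
    have m_vertex: "v \<noteq> m" if v: "v \<in> \<Union>T" for v
    proof
      assume "v = m"
      show False
      proof (cases "v \<in> e")
        case True
        then show ?thesis using uw \<open>v = m\<close> m_open by (auto simp: open_segment_def)
      next
        case False
        obtain e' where "e' \<in> edges" "v \<in> e'" using vertex_in_edge[OF v] .
        then show ?thesis using m_other[of e'] False \<open>v = m\<close> hull_inc by metis
      qed
    qed
    \<comment> \<open>Half of the radius suffices for the third corner, since
      \<open>dist m r \<le> dist p m + dist q m\<close>.\<close>
    let ?B = "ball m (d / 2)"
    have B: "open ?B" "?B \<noteq> {}" using d(1) by auto
    let ?A1 = "(\<lambda>v. affine hull {m, v}) ` \<Union>T"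
    have "aff_dim A < 3" if A: "A \<in> ?A1" for A
    proof -
      obtain v where "A = affine hull {m, v}" using A by blast
      then show ?thesis by simp
    qed
    then obtain p where p: "p \<in> ?B" "off_planes p" "\<And>A. A \<in> ?A1 \<Longrightarrow> p \<notin> A"
      using general_point_exists[OF B, of "{}" "{}" ?A1] finite_vertices by (metis empty_iff finite.emptyI finite_imageI)
    have p_dim: "aff_dim {m, v, p} = 2" if "v \<in> \<Union>T" for v
    proof -
      have "p \<notin> affine hull {m, v}" using p(3) that by blast
      then have "aff_dim (insert p {m, v}) = 2" using m_vertex[OF that] by (simp add: aff_dim_insert)
      moreover have "insert p {m, v} = {m, v, p}" by auto
      ultimately show ?thesis by simp
    qed
    \<comment> \<open>Avoiding \<open>?A2\<close> keeps \<open>q\<close>, \<open>m\<close>,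
      \<open>v\<close>, \<open>p\<close> affinely independent, so the plane of \<open>p\<close>,
      \<open>q\<close>, \<open>m\<close> contains no vertex. Avoiding \<open>?A3\<close> keeps the
      third corner \<open>?f q\<close> off the planes of the triangles, as \<open>?f\<close> is an
      affine involution.\<close>
    let ?A2 = "(\<lambda>v. affine hull {m, v, p}) ` \<Union>T"
    let ?f = "\<lambda>x. 3 *\<^sub>R m - p - x"
    let ?A3 = "(\<lambda>t. affine hull (?f ` t)) ` T"
    have "aff_dim A < 3" if A: "A \<in> ?A2 \<union> ?A3" for A
    proof -
      have f3: "aff_dim (?f ` t) < 3" if "t \<in> T" for t
      proof -
        have "card (?f ` t) \<le> 3" using card_image_le[OF fin_t[OF that], of ?f] card_T[OF that] by simp
        then show ?thesis using aff_dim_le_card[of "?f ` t"] fin_t[OF that] by simp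
      qed
      from A consider (1) v where "v \<in> \<Union>T" "A = affine hull {m, v, p}" | (2) t where "t \<in> T" "A = affine hull (?f ` t)"
        by fast
      then show ?thesis
      proof cases
        case 1
        then show ?thesis using p_dim[of v] by simp
      next
        case 2
        then show ?thesis using f3[of t] by simp
      qed
    qed
    moreover have "finite (?A2 \<union> ?A3)" using finite_vertices finite_T by blast
    ultimately obtain q where q: "q \<in> ?B" "off_planes q" "\<And>A. A \<in> ?A2 \<union> ?A3 \<Longrightarrow> q \<notin> A"
      using general_point_exists[OF B, of "{}" "{}" "?A2 \<union> ?A3"] by (metis empty_iff finite.emptyI)
    \<comment> \<open>This choice makes \<open>m\<close> the barycentre of \<open>p\<close>,
      \<open>q\<close>, \<open>r\<close>.\<close>
    define r where "r = 3 *\<^sub>R m - p - q"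
    have "off_planes r"
      unfolding off_planes_def
    proof (rule ballI, rule notI)
      fix t assume t: "t \<in> T" and "r \<in> affine hull t"
      have "?f ` (affine hull t) = affine hull (?f ` t)"
      proof -
        have "(+) (3 *\<^sub>R m - p) ` (affine hull (uminus ` t)) = affine hull ((+) (3 *\<^sub>R m - p) ` uminus ` t)"
          using affine_hull_translation by metis
        moreover have "affine hull (uminus ` t) = uminus ` (affine hull t)"
          by (rule affine_hull_linear_image[symmetric]) (simp add: bounded_linear_minus)
        ultimately show ?thesis by (simp add: image_image)
      qed
      moreover have "?f r = q" by (simp add: r_def)
      ultimately have "q \<in> affine hull (?f ` t)" using \<open>r \<in> affine hull t\<close> by (metis imageI)
      then show False using q(3) t by blast
    qed
    have dim4: "aff_dim {q, m, v, p} = 3" if "v \<in> \<Union>T" for v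
    proof -
      have "q \<notin> affine hull {m, v, p}" using q(3) that by blast
      then show ?thesis using p_dim[OF that] by (simp add: aff_dim_insert)
    qed
    have "aff_dim {p, q, m} < DIM(real^3)"
      using aff_dim_three_points[of p q m] by simp
    then obtain n \<beta> where n: "n \<noteq> 0" "{p, q, m} \<subseteq> {x. n \<bullet> x = \<beta>}"
      using aff_lowdim_subset_hyperplane by blast
    have nr: "n \<bullet> r = \<beta>" using n(2) by (simp add: r_def inner_diff_right)
    have nv: "n \<bullet> v \<noteq> \<beta>" if "v \<in> \<Union>T" for v
    proof (rule hyperplane_misses[OF n(1)])
      have "insert v {p, q, m} = {q, m, v, p}" by auto
      then show "aff_dim (insert v {p, q, m}) = 3" using dim4[OF that] by simp
    qed (use n(2) in auto)
    have "u \<in> \<Union>T" using t0 uw(1) by blast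
    have dim_mpq: "aff_dim {m, p, q} = 2"
    proof -
      have "{q, m, u, p} = insert u {m, p, q}" by auto
      then have "aff_dim (insert u {m, p, q}) = 3" using dim4[OF \<open>u \<in> \<Union>T\<close>] by simp
      then have "aff_dim {m, p, q} \<ge> 2" by (simp add: aff_dim_insert split: if_splits)
      then show ?thesis using aff_dim_three_points[of m p q] by linarith
    qed
    \<comment> \<open>With \<open>m\<close> on a side, the third corner would lie on the line of
      that side, and \<open>m\<close>, \<open>p\<close>, \<open>q\<close> would be
      collinear.\<close>
    have no_m: "m \<notin> closed_segment x y" if sub: "{p, q} \<subseteq> affine hull {m, x, y}" for x y
    proof
      assume "m \<in> closed_segment x y"
      then have "m \<in> affine hull {x, y}"
        unfolding segment_convex_hull using convex_hull_subset_affine_hull by blast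
      then have "affine hull {m, x, y} = affine hull {x, y}"
        by (simp add: hull_redundant)
      moreover have "{m, p, q} \<subseteq> affine hull {m, x, y}" using sub by (auto simp: hull_inc)
      ultimately have "aff_dim {m, p, q} \<le> aff_dim (affine hull {x, y})" using aff_dim_subset by metis
      then show False using dim_mpq by (simp split: if_splits)
    qed
    have in_hull: "3 *\<^sub>R m - x - y \<in> affine hull {m, x, y}" for x y
      using mem_affine_3[of "affine hull {m, x, y}" m x y 3 "-1" "-1"] by (simp add: hull_inc)
    have "p = 3 *\<^sub>R m - q - r" "q = 3 *\<^sub>R m - p - r" by (simp_all add: r_def)
    then have pqr: "m \<notin> closed_segment p q" "m \<notin> closed_segment q r" "m \<notin> closed_segment p r"
      using in_hull by (metis no_m empty_subsetI insert_subset hull_inc insertCI)+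
    have "dist m r < d"
    proof -
      have "m - r = (p - m) + (q - m)" by (simp add: r_def algebra_simps scaleR_left_distrib[of 2 1, simplified] flip: scaleR_2)
      then have "dist m r \<le> dist p m + dist q m" by (metis dist_norm norm_triangle_ineq)
      then show ?thesis using p(1) q(1) by (simp add: dist_commute)
    qed
    then have hull_ball: "convex hull {p, q, r} \<subseteq> ball m d"
      using p(1) q(1) d(1) by (intro hull_minimal convex_ball) auto
    have m_hull: "m \<in> convex hull {p, q, r}"
    proof -
      have "m = (1/3) *\<^sub>R p + (1/3) *\<^sub>R q + (1/3) *\<^sub>R r" by (simp add: r_def algebra_simps)
      then show ?thesis unfolding convex_hull_3 by fastforce
    qed
    \<comment> \<open>The average of \<open>n \<bullet> u\<close> and \<open>n \<bullet> w\<close>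
      is \<open>\<beta>\<close> while \<open>n \<bullet> u\<close> is not, so the ends of
      \<open>e\<close> lie on opposite sides of the plane.\<close>
    have e_plane: "convex hull e \<inter> {x. n \<bullet> x = \<beta>} = {m}"
    proof -
      have "n \<bullet> m = \<beta>" using n(2) by simp
      then have "n \<bullet> u + n \<bullet> w = 2 * \<beta>" by (simp add: m_def midpoint_def inner_add_right)
      moreover have "n \<bullet> u \<noteq> \<beta>" using nv \<open>u \<in> \<Union>T\<close> by blast
      ultimately have "(n \<bullet> u - \<beta>) * (n \<bullet> w - \<beta>) < 0"
        by (smt (verit) mult_less_0_iff)
      from segment_meets_hyperplane_once[OF this] show ?thesis
        using m_e n(2) unfolding uw(1) segment_convex_hull[symmetric] by (metis (no_types, lifting) IntI insert_subset mem_Collect_eq singletonD)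
    qed
    have s_plane: "convex hull {p, q, r} \<subseteq> {x. n \<bullet> x = \<beta>}"
      using n(2) nr by (intro hull_minimal convex_hyperplane) auto
    have seg_sub: "closed_segment p q \<subseteq> convex hull {p, q, r}" "closed_segment q r \<subseteq> convex hull {p, q, r}"
      "closed_segment p r \<subseteq> convex hull {p, q, r}"
      unfolding segment_convex_hull by (intro hull_mono; blast)+
    have other: "convex hull e' \<inter> convex hull {p, q, r} = {}" if "e' \<in> edges" "e' \<noteq> e" for e'
      using that d(2) hull_ball by blast
    have e_hull: "convex hull e \<inter> convex hull {p, q, r} = {m}" using e_plane s_plane m_hull m_e by blast
    have avoid: "avoids_edges x y" if xy: "closed_segment x y \<subseteq> convex hull {p, q, r}" "m \<notin> closed_segment x y" for x y
      unfolding avoids_edges_def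
    proof
      fix e' assume e': "e' \<in> edges"
      show "closed_segment x y \<inter> convex hull e' = {}"
      proof (cases "e' = e")
        case True
        have "closed_segment x y \<inter> convex hull e \<subseteq> {m}" unfolding e_hull[symmetric] using xy(1) by blast
        then show ?thesis using xy(2) True by blast
      next
        case False
        from other[OF e' this] show ?thesis using xy(1) by (simp add: disjoint_iff subset_iff) metis
      qed
    qed
    have av: "avoids_edges p q" "avoids_edges q r" "avoids_edges p r"
      using avoid[OF seg_sub(1) pqr(1)] avoid[OF seg_sub(2) pqr(2)] avoid[OF seg_sub(3) pqr(3)] .
    have "general_triangle p q r"
    proof -
      have "\<exists>n \<beta>. n \<bullet> p = \<beta> \<and> n \<bullet> q = \<beta> \<and> n \<bullet> r = \<beta> \<and> (\<forall>v\<in>\<Union>T. n \<bullet> v \<noteq> \<beta>)"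
        using n(2) nr nv by (intro exI[of _ n] exI[of _ \<beta>]) simp
      then show ?thesis unfolding general_triangle_def using p(2) q(2) \<open>off_planes r\<close> av by simp
    qed
    from general_triangle_sum_parity[OF this JT]
    have "even (card {t \<in> J. crosses p q t} + card {t \<in> J. crosses q r t} + card {t \<in> J. crosses p r t}
      + (\<Sum>e | e \<in> edges \<and> convex hull e \<inter> convex hull {p, q, r} \<noteq> {}. card {t \<in> J. e \<subseteq> t}))" .
    moreover have "{e' \<in> edges. convex hull e' \<inter> convex hull {p, q, r} \<noteq> {}} = {e}"
      using other e e_hull by blast
    moreover have "even (card {t \<in> J. crosses p q t} + card {t \<in> J. crosses q r t} + card {t \<in> J. crosses p r t})"
      using segment_jump_parity[OF JT J p(2) q(2) av(1)] segment_jump_parity[OF JT J q(2) \<open>off_planes r\<close> av(2)]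
        segment_jump_parity[OF JT J p(2) \<open>off_planes r\<close> av(3)] by (simp only: even_add) blast
    ultimately show ?thesis by simp
  qed
  then show ?thesis using JT unfolding J_def[symmetric] by (simp add: mod2_cycles_def)
qed

section \<open>Cycles are cuts\<close>

text \<open>Every edge lies in an even number of triangles of a cycle, so the sum over edges in
  \<open>general_triangle_sum_parity\<close> drops out.\<close>

lemma cycle_crossing_parity:
  assumes z: "z \<in> mod2_cycles T" and g: "general_triangle p q r"
  shows "odd (card {t \<in> z. crosses p r t}) \<longleftrightarrow> odd (card {t \<in> z. crosses p q t}) \<noteq> odd (card {t \<in> z. crosses q r t})"
proof -
  have zT: "z \<subseteq> T" and ev: "\<And>e. card e = 2 \<Longrightarrow> even (card {t \<in> z. e \<subseteq> t})"
    using z by (auto simp: mod2_cycles_def)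
  have "even (\<Sum>e | e \<in> edges \<and> convex hull e \<inter> convex hull {p, q, r} \<noteq> {}. card {t \<in> z. e \<subseteq> t})"
    by (intro dvd_sum ev) (simp add: edges_def)
  then show ?thesis using general_triangle_sum_parity[OF g zT] by (simp only: even_add) blast
qed

text \<open>Parity of crossings is controlled only for segments in general position with the base
  point \<open>b\<close>. At any other \<open>x\<close> the value is read off from the generic
  points nearby.\<close>

definition local_parity :: "(real^3) set set \<Rightarrow> real^3 \<Rightarrow> real^3 \<Rightarrow> bool \<Rightarrow> bool" where
  "local_parity z b x v \<longleftrightarrow> (\<exists>\<epsilon>>0. \<forall>r\<in>ball x \<epsilon>. off_planes r \<longrightarrow> general_pair b r \<longrightarrow>
     odd (card {t \<in> z. crosses b r t}) = v)"

lemma local_parity_exists: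
  assumes z: "z \<in> mod2_cycles T" and b: "off_planes b" and x: "x \<notin> support"
  shows "\<exists>v. local_parity z b x v"
proof -
  have zT: "z \<subseteq> T" using z by (simp add: mod2_cycles_def)
  obtain \<epsilon> where \<epsilon>: "\<epsilon> > 0" "ball x \<epsilon> \<subseteq> - support"
    using closed_support x open_contains_ball[of "- support"] by (metis ComplI open_Compl)
  have no: "card {t \<in> z. crosses r s t} = 0" if "r \<in> ball x \<epsilon>" "s \<in> ball x \<epsilon>" for r s
  proof -
    have "closed_segment r s \<subseteq> - support" using closed_segment_subset[OF that convex_ball] \<epsilon>(2) by blast
    then have "{t \<in> z. crosses r s t} = {}" using zT by (auto simp: crosses_def support_def)
    then show ?thesis by (metis card.empty)
  qed
  have eq: "odd (card {t \<in> z. crosses b r t}) = odd (card {t \<in> z. crosses b s t})"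
    if r: "r \<in> ball x \<epsilon>" "off_planes r" "general_pair b r" and s: "s \<in> ball x \<epsilon>" "off_planes s" "general_pair b s" for r s
  proof -
    \<comment> \<open>The points \<open>r\<close> and \<open>s\<close> need not be in general
      position to each other, so both are compared with a third point of the ball; segments inside
      the ball cross nothing.\<close>
    obtain m where m: "m \<in> ball x \<epsilon>" "off_planes m" "\<And>p. p \<in> {b, r, s} \<Longrightarrow> general_pair p m"
      "\<And>p q. (p, q) \<in> {(b, r), (b, s)} \<Longrightarrow> general_triple p q m"
      using general_point_exists[of "ball x \<epsilon>" "{b, r, s}" "{(b, r), (b, s)}" "{}"] \<epsilon>(1) b r s by auto
    have "general_triangle b r m" "general_triangle b s m"
      using m b r s by (simp_all add: general_triangleI)
    from this[THEN cycle_crossing_parity[OF z]] show ?thesis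
      unfolding no[OF r(1) m(1)] no[OF s(1) m(1)] by simp
  qed
  obtain r where r: "r \<in> ball x \<epsilon>" "off_planes r" "\<And>p. p \<in> {b} \<Longrightarrow> general_pair p r"
    using general_point_exists[of "ball x \<epsilon>" "{b}" "{}" "{}"] \<epsilon>(1) b by auto
  show ?thesis unfolding local_parity_def
    using \<epsilon>(1) eq[OF _ _ _ r(1,2)] r(3) by (intro exI[of _ "odd (card {t \<in> z. crosses b r t})"] exI[of _ \<epsilon>]) simp
qed

lemma local_parity_eq:
  assumes "local_parity z b x v" "off_planes x" "general_pair b x"
  shows "odd (card {t \<in> z. crosses b x t}) = v"
proof -
  obtain \<epsilon> where "\<epsilon> > 0"
    "\<forall>r\<in>ball x \<epsilon>. off_planes r \<longrightarrow> general_pair b r \<longrightarrow> odd (card {t \<in> z. crosses b r t}) = v"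
    using assms(1) unfolding local_parity_def by blast
  then show ?thesis using assms(2,3) by (simp add: Ball_def del: mem_ball)
qed

lemma local_parity_unique:
  assumes b: "off_planes b" and "local_parity z b x v" "local_parity z b x w"
  shows "v = w"
proof -
  obtain \<epsilon>1 where e1: "\<epsilon>1 > 0"
    and v: "\<forall>r\<in>ball x \<epsilon>1. off_planes r \<longrightarrow> general_pair b r \<longrightarrow> odd (card {t \<in> z. crosses b r t}) = v"
    using assms(2) unfolding local_parity_def by blast
  obtain \<epsilon>2 where e2: "\<epsilon>2 > 0"
    and w: "\<forall>r\<in>ball x \<epsilon>2. off_planes r \<longrightarrow> general_pair b r \<longrightarrow> odd (card {t \<in> z. crosses b r t}) = w"
    using assms(3) unfolding local_parity_def by blast
  obtain r where "r \<in> ball x (min \<epsilon>1 \<epsilon>2)" "off_planes r" "\<And>p. p \<in> {b} \<Longrightarrow> general_pair p r"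
  proof -
    have "ball x (min \<epsilon>1 \<epsilon>2) \<noteq> {}" using e1 e2 by simp
    from general_point_exists[OF open_ball this, of "{b}" "{}" "{}"] b that show thesis by auto
  qed
  then show ?thesis using v[rule_format, of r] w[rule_format, of r] by simp
qed

lemma open_local_parity: "open {x. local_parity z b x v}"
  unfolding open_contains_ball
proof
  fix x assume "x \<in> {x. local_parity z b x v}"
  then obtain \<epsilon> where e: "\<epsilon> > 0"
    "\<forall>r\<in>ball x \<epsilon>. off_planes r \<longrightarrow> general_pair b r \<longrightarrow> odd (card {t \<in> z. crosses b r t}) = v"
    unfolding local_parity_def by blast
  have "local_parity z b y v" if y: "y \<in> ball x \<epsilon>" for y
  proof -
    obtain \<delta> where "\<delta> > 0" "ball y \<delta> \<subseteq> ball x \<epsilon>" using openE[OF open_ball y] .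
    then show ?thesis unfolding local_parity_def using e(2) by blast
  qed
  then show "\<exists>e>0. ball x e \<subseteq> {x. local_parity z b x v}" using e(1) by blast
qed

text \<open>The points with parity \<open>v\<close> and those with parity \<open>\<not> v\<close>
  form disjoint open sets that cover the connected region.\<close>

lemma local_parity_region:
  assumes z: "z \<in> mod2_cycles T" and b: "off_planes b" and xy: "y \<in> region x" and v: "local_parity z b x v"
  shows "local_parity z b y v"
proof (rule ccontr)
  assume n: "\<not> local_parity z b y v"
  have sub: "region x \<subseteq> - support" unfolding region_def by (rule connected_component_subset)
  have x: "x \<in> region x" using xy unfolding region_def
    by (metis connected_component_eq_empty connected_component_refl_eq empty_iff mem_Collect_eq)
  have cov: "local_parity z b u v \<or> local_parity z b u (\<not> v)" if "u \<in> region x" for u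
  proof -
    have "u \<notin> support" using sub that by blast
    then obtain w where "local_parity z b u w" using local_parity_exists[OF z b] by blast
    then show ?thesis by (cases "w = v") auto
  qed
  have "connected (region x)" unfolding region_def by simp
  then show False
    using connectedD[OF _ open_local_parity open_local_parity, of "region x" z b v z b "\<not> v"]
      local_parity_unique[OF b] cov x xy v n by blast
qed

text \<open>The set \<open>G\<close> consists of the regions seen from a generic base point
  \<open>c\<close> with odd parity. For the triangle \<open>c\<close>, \<open>a t\<close>,
  \<open>b t\<close> the two parities differ exactly if the segment from \<open>a t\<close> to
  \<open>b t\<close> crosses the cycle oddly often, and that segment crosses only
  \<open>t\<close>.\<close>

lemma cycle_separates:
  assumes sides: "\<And>t. t \<in> T \<Longrightarrow> side_pair t (a t) (b t) \<and> general_pair (a t) (b t)"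
    and z: "z \<in> mod2_cycles T"
  shows "\<exists>G. z = separated_triangles (\<lambda>t. region (a t)) (\<lambda>t. region (b t)) T G"
proof -
  have zT: "z \<subseteq> T" using z by (simp add: mod2_cycles_def)
  have off: "off_planes (a t)" "off_planes (b t)" if "t \<in> T" for t
    using sides[OF that] by (auto simp: side_pair_def)
  have P: "finite (a ` T \<union> b ` T)" "\<And>p. p \<in> a ` T \<union> b ` T \<Longrightarrow> off_planes p" using off finite_T by auto
  have Q: "finite ((\<lambda>t. (a t, b t)) ` T)" "\<And>p q. (p, q) \<in> (\<lambda>t. (a t, b t)) ` T \<Longrightarrow> general_pair p q"
    using sides finite_T by auto
  obtain c where c: "c \<in> UNIV" "off_planes c" "\<And>p. p \<in> a ` T \<union> b ` T \<Longrightarrow> general_pair p c"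
    "\<And>p q. (p, q) \<in> (\<lambda>t. (a t, b t)) ` T \<Longrightarrow> general_triple p q c"
    by (rule general_point_exists[OF open_UNIV UNIV_not_empty P Q finite.emptyI]) (assumption, assumption, erule emptyE, rule that)
  define G where "G = {region x | x. x \<notin> support \<and> local_parity z c x True}"
  have G: "region x \<in> G \<longleftrightarrow> odd (card {t \<in> z. crosses c x t})" if "off_planes x" "general_pair c x" for x
  proof -
    have x: "x \<notin> support" using off_planes_off_support that(1) by blast
    obtain v where v: "local_parity z c x v" using local_parity_exists[OF z c(2) x] by blast
    have "region x \<in> G \<longleftrightarrow> v"
    proof
      assume "region x \<in> G"
      then obtain y where y: "y \<notin> support" "local_parity z c y True" "region x = region y" by (auto simp: G_def)
      have "x \<in> region y" unfolding y(3)[symmetric] using x by (simp add: region_def connected_component_refl)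
      from local_parity_region[OF z c(2) this y(2)] show v using local_parity_unique[OF c(2) v] by blast
    next
      assume v then show "region x \<in> G" using v x by (auto simp: G_def)
    qed
    then show ?thesis using local_parity_eq[OF v that] by blast
  qed
  have "t \<in> z \<longleftrightarrow> (region (a t) \<in> G) \<noteq> (region (b t) \<in> G)" if t: "t \<in> T" for t
  proof -
    have ac: "general_pair (a t) c" "general_pair (b t) c" "general_triple (a t) (b t) c" using c t by auto
    then have ca: "general_pair c (a t)" "general_pair c (b t)" using general_pair_commute by blast+
    have "general_triple c (a t) (b t)"
      using ac(3) by (simp add: general_triple_def insert_commute)
    then have "general_triangle c (a t) (b t)"
      using off[OF t] c(2) ca sides[OF t] by (intro general_triangleI) auto
    from cycle_crossing_parity[OF z this]
    have "odd (card {t' \<in> z. crosses (a t) (b t) t'}) \<longleftrightarrow> (region (a t) \<in> G) \<noteq> (region (b t) \<in> G)"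
      using G off[OF t] ca by blast
    moreover have "{t' \<in> z. crosses (a t) (b t) t'} = (if t \<in> z then {t} else {})"
      using sides[OF t] zT by (auto simp: side_pair_def)
    ultimately show ?thesis by (cases "t \<in> z") simp_all
  qed
  then show ?thesis using zT by (intro exI[of _ G]) (auto simp: separated_triangles_def)
qed

text \<open>The part of mod 2 Alexander duality that the proof needs.\<close>

theorem mod2_cycles_eq_cuts:
  "\<exists>s1 s2 :: (real^3) set \<Rightarrow> (real^3) set. mod2_cycles T = range (separated_triangles s1 s2 T)"
proof -
  have "\<forall>t. \<exists>a b. t \<in> T \<longrightarrow> side_pair t a b \<and> general_pair a b" using side_pair_exists by metis
  then obtain a b where ab: "\<And>t. t \<in> T \<Longrightarrow> side_pair t (a t) (b t) \<and> general_pair (a t) (b t)" by metis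
  have "mod2_cycles T = range (separated_triangles (\<lambda>t. region (a t)) (\<lambda>t. region (b t)) T)"
  proof
    show "mod2_cycles T \<subseteq> range (separated_triangles (\<lambda>t. region (a t)) (\<lambda>t. region (b t)) T)"
      using cycle_separates[of a b, OF ab] by blast
    show "range (separated_triangles (\<lambda>t. region (a t)) (\<lambda>t. region (b t)) T) \<subseteq> mod2_cycles T"
      using ab by (auto intro!: separated_triangles_in_cycles)
  qed
  then show ?thesis by blast
qed

end

section \<open>Cycles of a complex and of its subdivisions\<close>

text \<open>The vertices are unit vectors, so coordinates are barycentric, and the support of a
  point of the realisation is the face whose open simplex contains it.\<close>

definition supp :: "real^'a \<Rightarrow> 'a set" where
  "supp x = {i. x $ i \<noteq> 0}"

lemma mem_geometric_simplex:
  "x \<in> geometric_simplex s \<longleftrightarrow> (\<forall>i. 0 \<le> x $ i) \<and> (\<Sum>i\<in>UNIV. x $ i) = 1 \<and> supp x \<subseteq> s"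
proof
  assume "x \<in> geometric_simplex s"
  moreover have "geometric_simplex s \<subseteq> {x. (\<forall>i. 0 \<le> x $ i) \<and> (\<Sum>i\<in>UNIV. x $ i) = 1 \<and> supp x \<subseteq> s}"
    unfolding geometric_simplex_def
  proof (rule hull_minimal)
    show "(\<lambda>v. axis v 1) ` s \<subseteq> {x. (\<forall>i. 0 \<le> x $ i) \<and> (\<Sum>i\<in>UNIV. x $ i) = 1 \<and> supp x \<subseteq> s}"
      by (auto simp: axis_def supp_def split: if_splits)
    show "convex {x :: real^'a. (\<forall>i. 0 \<le> x $ i) \<and> (\<Sum>i\<in>UNIV. x $ i) = 1 \<and> supp x \<subseteq> s}" (is "convex ?D")
    proof (rule convexI)
      fix x y :: "real^'a" and u v :: real
      assume x: "x \<in> ?D" and y: "y \<in> ?D" and uv: "0 \<le> u" "0 \<le> v" "u + v = 1"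
      have "x $ i = 0 \<and> y $ i = 0" if "i \<notin> s" for i using x y that unfolding supp_def by blast
      then have "(u *\<^sub>R x + v *\<^sub>R y) $ i = 0" if "i \<notin> s" for i using that by simp
      then have "supp (u *\<^sub>R x + v *\<^sub>R y) \<subseteq> s" unfolding supp_def by blast
      moreover have "(\<Sum>i\<in>UNIV. (u *\<^sub>R x + v *\<^sub>R y) $ i) = 1"
        using x y uv by (simp add: sum.distrib flip: sum_distrib_left)
      ultimately show "u *\<^sub>R x + v *\<^sub>R y \<in> ?D" using x y uv by simp
    qed
  qed
  ultimately show "(\<forall>i. 0 \<le> x $ i) \<and> (\<Sum>i\<in>UNIV. x $ i) = 1 \<and> supp x \<subseteq> s" by blast
next
  assume x: "(\<forall>i. 0 \<le> x $ i) \<and> (\<Sum>i\<in>UNIV. x $ i) = 1 \<and> supp x \<subseteq> s"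
  then have out: "x $ i = 0" if "i \<notin> s" for i using that by (auto simp: supp_def)
  have "(\<Sum>i\<in>s. (x $ i) *\<^sub>R axis i 1) = x"
  proof -
    have "(\<Sum>i\<in>s. (x $ i) *\<^sub>R axis i 1) = (\<Sum>i\<in>UNIV. (x $ i) *\<^sub>R axis i (1::real))"
      using out by (intro sum.mono_neutral_left) auto
    also have "\<dots> = x" using basis_expansion[of x] by (simp add: scalar_mult_eq_scaleR)
    finally show ?thesis .
  qed
  moreover have "(\<Sum>i\<in>s. x $ i) = (\<Sum>i\<in>UNIV. x $ i)"
    using out by (intro sum.mono_neutral_left) auto
  then have "(\<Sum>i\<in>s. (x $ i) *\<^sub>R axis i 1) \<in> geometric_simplex s"
    unfolding geometric_simplex_def using x by (intro convex_sum) (auto simp: hull_inc)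
  ultimately show "x \<in> geometric_simplex s" by simp
qed

lemma supp_convex_combination:
  assumes "\<forall>i. 0 \<le> x $ i" "\<forall>i. 0 \<le> y $ i" "0 < u" "u < 1"
  shows "supp ((1 - u) *\<^sub>R x + u *\<^sub>R y) = supp x \<union> supp y"
  using assms by (auto simp: supp_def add_nonneg_eq_0_iff)

lemma convex_geometric_simplex: "convex (geometric_simplex s)"
  by (simp add: geometric_simplex_def)

text \<open>Points of full support form the open simplex; a segment from such a point to any point
  of the simplex stays in it up to its far end.\<close>

lemma open_simplex_combination:
  assumes x: "x \<in> geometric_simplex t" "supp x = t" and y: "y \<in> geometric_simplex t" and u: "0 < u" "u < 1"
  shows "(1 - u) *\<^sub>R x + u *\<^sub>R y \<in> geometric_simplex t" "supp ((1 - u) *\<^sub>R x + u *\<^sub>R y) = t"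
proof -
  show "(1 - u) *\<^sub>R x + u *\<^sub>R y \<in> geometric_simplex t"
    using convexD[OF convex_geometric_simplex x(1) y, of "1 - u" u] u by simp
  have "supp ((1 - u) *\<^sub>R x + u *\<^sub>R y) = supp x \<union> supp y"
    using x(1) y u by (intro supp_convex_combination) (auto simp: mem_geometric_simplex)
  then show "supp ((1 - u) *\<^sub>R x + u *\<^sub>R y) = t" using x(2) y by (auto simp: mem_geometric_simplex)
qed

lemma aff_dim_geometric_simplex: "aff_dim (geometric_simplex s) \<le> int (card s) - 1"
proof -
  have "aff_dim (geometric_simplex s) = aff_dim ((\<lambda>v. axis v (1::real)) ` s)"
    by (simp add: geometric_simplex_def aff_dim_convex_hull)
  also have "\<dots> \<le> int (card ((\<lambda>v. axis v (1::real)) ` s)) - 1" by (rule aff_dim_le_card) simp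
  also have "\<dots> \<le> int (card s) - 1" using card_image_le[of s "\<lambda>v. axis v (1::real)"] by simp
  finally show ?thesis .
qed

lemma affine_independent_hull_inject:
  fixes A B :: "'a::euclidean_space set"
  assumes "\<not> affine_dependent A" "\<not> affine_dependent B" "convex hull A = convex hull B"
  shows "A = B"
  using extreme_point_of_convex_hull_affine_independent[of A]
    extreme_point_of_convex_hull_affine_independent[of B] assms by auto

locale subdivided_complex =
  fixes K :: "'a::finite set set" and L :: "(real^'a) set set"
  assumes complex: "abstract_complex K" and dim_K: "has_dimension K 2" and sub: "subdivides L K"
begin

definition triangles :: "(real^'a) set set" where
  "triangles = {V. card V = 3 \<and> \<not> affine_dependent V \<and> convex hull V \<in> L}"

text \<open>For the vertex set \<open>V\<close> of a simplex of \<open>L\<close> this is its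
  carrier, the smallest face of \<open>K\<close> whose realisation contains the simplex.\<close>

definition carrier_face :: "(real^'a) set \<Rightarrow> 'a set" where
  "carrier_face V = (\<Union>x\<in>V. supp x)"

lemma finite_L: "finite L" and L_cover: "\<Union>L = realisation K"
  and L_simplex': "S \<in> L \<Longrightarrow> \<exists>n. n simplex S"
  and L_face: "S \<in> L \<Longrightarrow> F face_of S \<Longrightarrow> F \<in> L"
  and L_meet: "S \<in> L \<Longrightarrow> S' \<in> L \<Longrightarrow> (S \<inter> S') face_of S"
  and L_sub: "S \<in> L \<Longrightarrow> \<exists>s\<in>K. S \<subseteq> geometric_simplex s"
  using sub unfolding subdivides_def simplicial_complex_def by auto

lemma L_simplex:
  assumes "S \<in> L"
  obtains C where "\<not> affine_dependent C" "S = convex hull C" "finite C"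
proof -
  obtain n where "n simplex S" using L_simplex'[OF assms] by blast
  then obtain C where "\<not> affine_dependent C" "S = convex hull C" unfolding simplex_def by blast
  then show thesis using that aff_independent_finite by blast
qed

lemma K_card: "s \<in> K \<Longrightarrow> card s \<le> 3"
  using dim_K by (auto simp: has_dimension_def)

lemma K_down: "s \<in> K \<Longrightarrow> t \<subseteq> s \<Longrightarrow> t \<noteq> {} \<Longrightarrow> t \<in> K"
  using complex by (auto simp: abstract_complex_def)

lemma faces2: "t \<in> faces K 2 \<longleftrightarrow> t \<in> K \<and> card t = 3"
  by (simp add: faces_def)

lemma triangles_D:
  assumes "V \<in> triangles"
  shows "card V = 3" "\<not> affine_dependent V" "convex hull V \<in> L" "finite V"
  using assms by (auto simp: triangles_def intro: aff_independent_finite)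

lemma finite_triangles: "finite triangles"
proof (rule finite_imageD)
  show "finite ((\<lambda>V. convex hull V) ` triangles)"
    by (rule finite_subset[OF _ finite_L]) (auto simp: triangles_def)
  show "inj_on (\<lambda>V. convex hull V) triangles"
    using affine_independent_hull_inject triangles_D(2) unfolding inj_on_def by blast
qed

lemma L_hull_in_carrier:
  assumes "convex hull C \<in> L" "C \<noteq> {}"
  shows "carrier_face C \<in> K" "convex hull C \<subseteq> geometric_simplex (carrier_face C)"
    "\<And>s. C \<subseteq> geometric_simplex s \<Longrightarrow> carrier_face C \<subseteq> s"
proof -
  obtain s where s: "s \<in> K" "convex hull C \<subseteq> geometric_simplex s" using L_sub[OF assms(1)] by blast
  have C: "x \<in> geometric_simplex s" if "x \<in> C" for x using subsetD[OF s(2) hull_inc[OF that]] .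
  have CC: "C \<subseteq> geometric_simplex (carrier_face C)"
  proof (intro subsetI)
    fix x assume x: "x \<in> C"
    then have "supp x \<subseteq> carrier_face C" by (auto simp: carrier_face_def)
    then show "x \<in> geometric_simplex (carrier_face C)" using C[OF x] by (simp add: mem_geometric_simplex)
  qed
  from CC show "convex hull C \<subseteq> geometric_simplex (carrier_face C)"
    by (intro hull_minimal convex_geometric_simplex)
  show le: "carrier_face C \<subseteq> s'" if "C \<subseteq> geometric_simplex s'" for s'
    using that unfolding carrier_face_def UN_subset_iff subset_iff[of C] mem_geometric_simplex by blast
  obtain x where x: "x \<in> C" using assms(2) by blast
  have "supp x \<noteq> {}"
  proof
    assume "supp x = {}"
    then have "(\<Sum>i\<in>UNIV. x $ i) = 0" by (auto simp: supp_def)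
    then show False using C[OF x] by (simp add: mem_geometric_simplex)
  qed
  then have ne: "carrier_face C \<noteq> {}" using x by (auto simp: carrier_face_def)
  have "C \<subseteq> geometric_simplex s" using C by blast
  from K_down[OF s(1) le[OF this] ne] show "carrier_face C \<in> K" .
qed

text \<open>Dimensions are compared. As the faces of \<open>K\<close> have at most three vertices,
  the carrier of a triangle of \<open>L\<close> is therefore a triangle of \<open>K\<close>.\<close>

lemma carrier_card:
  assumes "\<not> affine_dependent C" "convex hull C \<in> L" "C \<noteq> {}"
  shows "card C \<le> card (carrier_face C)"
proof -
  have "aff_dim C \<le> aff_dim (geometric_simplex (carrier_face C))"
    using L_hull_in_carrier(2)[OF assms(2,3)] by (intro aff_dim_subset) (meson hull_subset order_trans)
  then show ?thesis
    using aff_dim_geometric_simplex[of "carrier_face C"] aff_dim_affine_independent[OF assms(1)] by linarith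
qed

lemma triangle_carrier:
  assumes "V \<in> triangles"
  shows "carrier_face V \<in> faces K 2" "convex hull V \<subseteq> geometric_simplex (carrier_face V)"
proof -
  note V = triangles_D[OF assms]
  have ne: "V \<noteq> {}" using V(1) by auto
  show "convex hull V \<subseteq> geometric_simplex (carrier_face V)" by (rule L_hull_in_carrier(2)[OF V(3) ne])
  show "carrier_face V \<in> faces K 2"
    using L_hull_in_carrier(1)[OF V(3) ne] K_card carrier_card[OF V(2,3) ne] V(1)
    unfolding faces2 by (metis le_antisym)
qed

lemma nonneg_sum1:
  assumes "S \<in> L" "x \<in> S"
  shows "\<forall>i. 0 \<le> x $ i" "(\<Sum>i\<in>UNIV. x $ i) = 1"
  using L_sub[OF assms(1)] assms(2) mem_geometric_simplex by blast+

text \<open>The intersection is a face of each triangle, and affine independence makes the two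
  vertex sets that span it equal.\<close>

lemma triangles_meet:
  assumes "V \<in> triangles" "V' \<in> triangles"
  shows "convex hull V \<inter> convex hull V' = convex hull (V \<inter> V')"
proof -
  note V = triangles_D[OF assms(1)] and V' = triangles_D[OF assms(2)]
  obtain c c' where c: "c \<subseteq> V" "convex hull V \<inter> convex hull V' = convex hull c"
    and c': "c' \<subseteq> V'" "convex hull V \<inter> convex hull V' = convex hull c'"
    using L_meet[OF V(3) V'(3)] L_meet[OF V'(3) V(3)] face_of_convex_hull_affine_independent[OF V(2)]
      face_of_convex_hull_affine_independent[OF V'(2)] by (metis Int_commute)
  have "\<not> affine_dependent c" "\<not> affine_dependent c'"
    using c(1) c'(1) V(2) V'(2) affine_dependent_subset by blast+
  then have "c = c'" using affine_independent_hull_inject[of c c'] c(2) c'(2) by simp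
  then have "convex hull V \<inter> convex hull V' \<subseteq> convex hull (V \<inter> V')"
    using c c' by (metis Int_greatest hull_mono)
  then show ?thesis by (simp add: hull_mono subset_antisym)
qed

lemma sub_hull_in_L:
  assumes "\<not> affine_dependent C" "convex hull C \<in> L" "c \<subseteq> C"
  shows "convex hull c \<in> L"
  using assms L_face face_of_convex_hull_affine_independent by blast

text \<open>Infinitely many points converging to \<open>p\<close> from \<open>x\<close> fall into
  one of the finitely many simplices of \<open>L\<close>; being closed, it contains \<open>p\<close>
  as well.\<close>

lemma star_point:
  assumes s: "s \<in> K" and p: "p \<in> geometric_simplex s" and x: "x \<in> geometric_simplex s" "supp x = s"
  shows "\<exists>S\<in>L. p \<in> S \<and> (\<exists>\<epsilon>. 0 < \<epsilon> \<and> \<epsilon> < 1 \<and> (1 - \<epsilon>) *\<^sub>R p + \<epsilon> *\<^sub>R x \<in> S)"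
proof -
  \<comment> \<open>The offset 2 keeps every weight strictly below 1.\<close>
  define y where "y k = (1 - 1 / (real k + 2)) *\<^sub>R p + (1 / (real k + 2)) *\<^sub>R x" for k :: nat
  have y: "y k \<in> geometric_simplex s" for k
  proof -
    have "y k \<in> closed_segment p x" unfolding y_def in_segment by (rule exI[of _ "1 / (real k + 2)"]) simp
    then show ?thesis using closed_segment_subset[OF p x(1) convex_geometric_simplex] by blast
  qed
  then have "\<forall>k. \<exists>S\<in>L. y k \<in> S"
    using s L_cover unfolding realisation_def by (metis UN_I UnionE)
  then obtain Sf where Sf: "\<And>k. Sf k \<in> L" "\<And>k. y k \<in> Sf k" by metis
  have "Sf ` UNIV \<subseteq> L" using Sf(1) by auto
  then have "finite (Sf ` UNIV)" using finite_L finite_subset by blast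
  then obtain k0 where inf: "infinite {k. Sf k = Sf k0}"
    using pigeonhole_infinite[of UNIV Sf] by auto
  let ?S = "Sf k0"
  obtain C where C: "?S = convex hull C" "finite C" using L_simplex[OF Sf(1)] by blast
  have cl: "closed ?S" unfolding C(1) using C(2) by (intro compact_imp_closed finite_imp_compact_convex_hull)
  have lim: "y \<longlonglongrightarrow> p"
  proof -
    have "(\<lambda>k. 1 / (real k + 2)) \<longlonglongrightarrow> 0"
      using LIMSEQ_ignore_initial_segment[OF lim_inverse_n', of 2] by (simp add: add.commute)
    then have "y \<longlonglongrightarrow> (1 - 0) *\<^sub>R p + 0 *\<^sub>R x" unfolding y_def by (intro tendsto_intros)
    then show ?thesis by simp
  qed
  have "p \<in> ?S"
  proof (rule ccontr)
    assume "p \<notin> ?S"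
    then have "\<forall>\<^sub>F k in sequentially. y k \<in> - ?S" using cl by (intro topological_tendstoD[OF lim]) auto
    then obtain N where N: "\<And>k. k \<ge> N \<Longrightarrow> y k \<notin> ?S" unfolding eventually_sequentially by auto
    obtain k where "k \<ge> N" "Sf k = Sf k0" using inf unfolding infinite_nat_iff_unbounded_le by blast
    then show False using N Sf(2)[of k] by auto
  qed
  moreover have "y k0 \<in> ?S" "0 < 1 / (real k0 + 2)" "1 / (real k0 + 2) < 1" using Sf(2) by auto
  ultimately show ?thesis unfolding y_def using Sf(1) by blast
qed

end

section \<open>Triangles of the subdivision around an edge\<close>

lemma affine_hull_extend:
  assumes "a \<in> affine hull X" "(1 - \<epsilon>) *\<^sub>R a + \<epsilon> *\<^sub>R b \<in> affine hull X" "\<epsilon> \<noteq> (0::real)"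
  shows "b \<in> affine hull X"
proof -
  have "(1 - 1 / \<epsilon>) *\<^sub>R a + (1 / \<epsilon>) *\<^sub>R ((1 - \<epsilon>) *\<^sub>R a + \<epsilon> *\<^sub>R b) = b"
  proof -
    have "(1 - 1 / \<epsilon>) + (1 / \<epsilon>) * (1 - \<epsilon>) = 0" "(1 / \<epsilon>) * \<epsilon> = 1" using assms(3) by (simp_all add: field_simps)
    then show ?thesis by (simp only: scaleR_add_right scaleR_scaleR add.assoc[symmetric] scaleR_add_left[symmetric]) simp
  qed
  moreover have "(1 - 1 / \<epsilon>) *\<^sub>R a + (1 / \<epsilon>) *\<^sub>R ((1 - \<epsilon>) *\<^sub>R a + \<epsilon> *\<^sub>R b) \<in> affine hull X"
    using assms(1,2) affine_affine_hull[of X] unfolding affine_alt by blast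
  ultimately show ?thesis by simp
qed

lemma midpoint_in_affine_hull: "midpoint u v \<in> affine hull {u, v}"
  using midpoint_in_closed_segment[of u v] convex_hull_subset_affine_hull
  unfolding segment_convex_hull by blast

context subdivided_complex
begin

text \<open>The simplex that \<open>star_point\<close> finds at the midpoint in direction
  \<open>x\<close> contains an inner point of the edge, so the edge is a face of it. It contains a
  point off the line of the edge, so it has a further vertex, and it has no fourth one since its
  carrier lies in \<open>t\<close>.\<close>

lemma edge_side:
  assumes uv: "u \<noteq> v" "convex hull {u, v} \<in> L" and t: "t \<in> faces K 2" "{u, v} \<subseteq> geometric_simplex t"
    and x: "x \<in> geometric_simplex t" "supp x = t" "x \<notin> affine hull {u, v}"
  shows "\<exists>w \<epsilon>. w \<noteq> u \<and> w \<noteq> v \<and> {u, v, w} \<in> triangles \<and> carrier_face {u, v, w} = t \<and> 0 < \<epsilon>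
    \<and> (1 - \<epsilon>) *\<^sub>R midpoint u v + \<epsilon> *\<^sub>R x \<in> convex hull {u, v, w}"
proof -
  let ?m = "midpoint u v" and ?e = "convex hull {u, v}"
  have tK: "t \<in> K" "card t = 3" using t(1) by (auto simp: faces2)
  have m_open: "?m \<in> open_segment u v" using uv(1) by simp
  then have m_e: "?m \<in> ?e" unfolding segment_convex_hull[symmetric] using open_closed_segment by blast
  have m_t: "?m \<in> geometric_simplex t"
    using m_e hull_minimal[OF t(2), of convex] convex_geometric_simplex by blast
  obtain S \<epsilon> where S: "S \<in> L" "?m \<in> S" and \<epsilon>: "0 < \<epsilon>" "\<epsilon> < 1" "(1 - \<epsilon>) *\<^sub>R ?m + \<epsilon> *\<^sub>R x \<in> S"
    using star_point[OF tK(1) m_t x(1,2)] by blast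
  let ?y = "(1 - \<epsilon>) *\<^sub>R ?m + \<epsilon> *\<^sub>R x"
  have y_aff: "?y \<notin> affine hull {u, v}"
    using affine_hull_extend[OF midpoint_in_affine_hull] \<epsilon>(1) x(3) by (metis less_irrefl)
  obtain s where s: "s \<in> K" "S \<subseteq> geometric_simplex s" using L_sub[OF S(1)] by blast
  have "supp ?y = supp ?m \<union> supp x"
    using m_t x(1) \<epsilon> by (intro supp_convex_combination) (auto simp: mem_geometric_simplex)
  moreover have "?y \<in> geometric_simplex s" using s(2) \<epsilon>(3) by blast
  ultimately have "t \<subseteq> s" using x(2) by (simp add: mem_geometric_simplex)
  then have "s = t" using K_card[OF s(1)] tK(2) by (metis card_seteq finite_code)
  obtain C where C: "\<not> affine_dependent C" "S = convex hull C" "finite C" using L_simplex[OF S(1)] .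
  have face_e: "?e \<inter> S face_of ?e" and face_S: "?e \<inter> S face_of S"
    using L_meet[OF uv(2) S(1)] L_meet[OF S(1) uv(2)] by (simp_all add: Int_commute)
  have "u \<in> ?e" "v \<in> ?e" by (simp_all add: hull_inc)
  then have "u \<in> ?e \<inter> S" "v \<in> ?e \<inter> S" using face_e m_open m_e S(2) unfolding face_of_def by blast+
  then have "?e \<subseteq> S" using face_e by (intro order_trans[OF hull_minimal[of _ "?e \<inter> S"]]) (auto simp: face_of_def)
  then have "?e face_of convex hull C" using face_S C(2) by (simp add: Int_absorb2)
  then obtain c where c: "c \<subseteq> C" "?e = convex hull c" using face_of_convex_hull_affine_independent[OF C(1)] by blast
  have "c = {u, v}"
    using affine_independent_hull_inject[of c "{u, v}"] c C(1) affine_dependent_subset affine_independent_2 by metis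
  then have uvC: "{u, v} \<subseteq> C" using c by simp
  have "C \<noteq> {u, v}"
    using \<epsilon>(3) C(2) y_aff convex_hull_subset_affine_hull by blast
  then obtain w where w: "w \<in> C" "w \<noteq> u" "w \<noteq> v" using uvC by blast
  have Cn: "C \<noteq> {}" using w by blast
  have CL: "convex hull C \<in> L" using S C by simp
  have ct: "carrier_face C \<subseteq> t"
    using L_hull_in_carrier(3)[OF CL Cn, of t] s(2) C(2) \<open>s = t\<close> by (metis hull_subset order_trans)
  then have "card C \<le> 3"
    using carrier_card[OF C(1) CL Cn] tK(2) card_mono[of t "carrier_face C"] by simp
  moreover have "{u, v, w} \<subseteq> C" "card {u, v, w} = 3" using uvC w uv(1) by auto
  ultimately have Ceq: "C = {u, v, w}" using C(3) by (metis card_seteq)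
  then have tri: "{u, v, w} \<in> triangles" using C(1) CL uv(1) w by (simp add: triangles_def)
  have "card (carrier_face C) = 3" using triangle_carrier(1)[OF tri] Ceq by (simp add: faces2)
  then have "carrier_face C = t" using ct tK(2) by (metis card_subset_eq finite_code)
  then show ?thesis using Ceq tri w \<epsilon> C(2) by blast
qed

lemma plane_of_carrier:
  assumes "V \<in> triangles" "x \<in> geometric_simplex (carrier_face V)"
  shows "x \<in> affine hull V"
proof -
  note V = triangles_D[OF assms(1)]
  let ?t = "carrier_face V"
  have "card ?t = 3" using triangle_carrier(1)[OF assms(1)] by (simp add: faces2)
  then have "aff_dim (geometric_simplex ?t) \<le> 2" using aff_dim_geometric_simplex[of ?t] by simp
  moreover have "aff_dim V = 2" using aff_dim_affine_independent[OF V(2)] V(1) by simp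
  moreover have "V \<subseteq> geometric_simplex ?t" using triangle_carrier(2)[OF assms(1)] by (meson hull_subset order_trans)
  ultimately have "aff_dim (affine hull V) = aff_dim (affine hull (geometric_simplex ?t))"
    "affine hull V \<subseteq> affine hull (geometric_simplex ?t)"
    using aff_dim_subset[of V "geometric_simplex ?t"] by (simp_all add: hull_mono)
  moreover have "affine hull V \<noteq> {}" using V(1) by auto
  ultimately have "affine hull V = affine hull (geometric_simplex ?t)"
    using affine_dim_equal affine_affine_hull by blast
  then show ?thesis using assms(2) by (simp add: hull_inc)
qed

text \<open>Both triangles lie on the same side of their common edge, so both contain the points
  close to its midpoint in direction \<open>w2\<close>. Distinct triangles would share only that
  edge, which puts \<open>w2\<close> on its line.\<close>

lemma same_side:
  assumes tri: "{u, v, w1} \<in> triangles" "{u, v, w2} \<in> triangles"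
    and w: "w2 = \<alpha> *\<^sub>R u + \<beta> *\<^sub>R v + \<gamma> *\<^sub>R w1" "\<alpha> + \<beta> + \<gamma> = 1" "0 < \<gamma>"
  shows "w1 = w2"
proof (rule ccontr)
  assume ne: "w1 \<noteq> w2"
  have d1: "u \<noteq> v" "w1 \<noteq> u" "w1 \<noteq> v" using triangles_D(1)[OF tri(1)] by (auto simp: card_insert_if split: if_splits)
  have d2: "w2 \<noteq> u" "w2 \<noteq> v" using triangles_D(1)[OF tri(2)] by (auto simp: card_insert_if split: if_splits)
  \<comment> \<open>Small enough that shifting the weights \<open>(1 - \<epsilon>) / 2\<close> of
    \<open>u\<close> and \<open>v\<close> by \<open>\<epsilon> * \<alpha>\<close> and
    \<open>\<epsilon> * \<beta>\<close> leaves them nonnegative.\<close>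
  define \<epsilon> where "\<epsilon> = 1 / (2 * (\<bar>\<alpha>\<bar> + \<bar>\<beta>\<bar> + 1))"
  have eps: "0 < \<epsilon>" "\<epsilon> < 1" "2 * \<epsilon> * (\<bar>\<alpha>\<bar> + \<bar>\<beta>\<bar> + 1) = 1" by (auto simp: \<epsilon>_def field_simps)
  have "2 * (\<epsilon> * \<bar>\<alpha>\<bar>) + 2 * (\<epsilon> * \<bar>\<beta>\<bar>) + 2 * \<epsilon> = 1" using eps(3) by (simp add: algebra_simps)
  moreover have "0 \<le> \<epsilon> * (\<bar>\<alpha>\<bar> + \<alpha>)" "0 \<le> \<epsilon> * (\<bar>\<beta>\<bar> + \<beta>)" "0 \<le> \<epsilon> * \<bar>\<alpha>\<bar>" "0 \<le> \<epsilon> * \<bar>\<beta>\<bar>" using eps(1) by auto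
  ultimately have nn: "0 \<le> (1 - \<epsilon>) / 2 + \<epsilon> * \<alpha>" "0 \<le> (1 - \<epsilon>) / 2 + \<epsilon> * \<beta>"
    using eps(1) unfolding distrib_left by (simp_all only: diff_divide_distrib)
  let ?z = "(1 - \<epsilon>) *\<^sub>R midpoint u v + \<epsilon> *\<^sub>R w2"
  have "?z = ((1 - \<epsilon>) / 2 + \<epsilon> * \<alpha>) *\<^sub>R u + ((1 - \<epsilon>) / 2 + \<epsilon> * \<beta>) *\<^sub>R v + (\<epsilon> * \<gamma>) *\<^sub>R w1"
    by (simp add: w(1) midpoint_def scaleR_add_right scaleR_add_left)
  moreover have "((1 - \<epsilon>) / 2 + \<epsilon> * \<alpha>) + ((1 - \<epsilon>) / 2 + \<epsilon> * \<beta>) + \<epsilon> * \<gamma> = 1"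
  proof -
    have "((1 - \<epsilon>) / 2 + \<epsilon> * \<alpha>) + ((1 - \<epsilon>) / 2 + \<epsilon> * \<beta>) + \<epsilon> * \<gamma> = 1 - \<epsilon> + \<epsilon> * (\<alpha> + \<beta> + \<gamma>)"
      by (simp add: algebra_simps)
    then show ?thesis using w(2) by simp
  qed
  moreover have "0 \<le> \<epsilon> * \<gamma>" using eps(1) w(3) by simp
  ultimately have "?z \<in> convex hull {u, v, w1}" unfolding convex_hull_3 using nn by blast
  moreover have "?z \<in> convex hull {u, v, w2}"
  proof -
    have "midpoint u v \<in> convex hull {u, v, w2}"
      using midpoint_in_closed_segment[of u v] hull_mono[of "{u, v}" "{u, v, w2}" convex]
      unfolding segment_convex_hull by blast
    then show ?thesis
      using eps convex_convex_hull[of "{u, v, w2}"] hull_inc[of w2 "{u, v, w2}" convex] unfolding convex_alt by simp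
  qed
  ultimately have "?z \<in> convex hull ({u, v, w1} \<inter> {u, v, w2})" using triangles_meet[OF tri] by blast
  moreover have "{u, v, w1} \<inter> {u, v, w2} = {u, v}" using ne d1 d2 by auto
  ultimately have "?z \<in> affine hull {u, v}" using convex_hull_subset_affine_hull by fastforce
  then have "w2 \<in> affine hull {u, v}"
    using affine_hull_extend[OF midpoint_in_affine_hull] eps(1) by (metis less_irrefl)
  moreover have "{u, v, w2} - {w2} = {u, v}" using d2 by auto
  ultimately show False using triangles_D(2)[OF tri(2)] unfolding affine_dependent_def by auto
qed

lemma triangle_apex:
  assumes "V \<in> triangles" "{u, v} \<subseteq> V" "u \<noteq> v"
  obtains w where "V = {u, v, w}" "w \<noteq> u" "w \<noteq> v" "w \<notin> affine hull {u, v}"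
proof -
  note V = triangles_D[OF assms(1)]
  have "card (V - {u, v}) = 1" using V(1,4) assms(2,3) by (simp add: card_Diff_subset)
  then obtain w where w: "V - {u, v} = {w}" using card_1_singletonE by blast
  then have Vw: "V = {u, v, w}" "w \<noteq> u" "w \<noteq> v" using assms(2) by blast+
  have "V - {w} = {u, v}" using w assms(2) by blast
  moreover have "w \<in> V" using w by blast
  ultimately have "w \<notin> affine hull {u, v}" using V(2) unfolding affine_dependent_def by metis
  then show thesis using that Vw by blast
qed

text \<open>The edge lies in a side of \<open>t\<close>, so all of \<open>t\<close> is on one side
  of it. The coordinate at the opposite vertex \<open>i\<close> measures this: it vanishes on
  \<open>e\<close> and is positive at the third vertex of any triangle over \<open>t\<close> at
  \<open>e\<close>.\<close>

lemma boundary_edge_unique_triangle: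
  assumes e: "card e = 2" "convex hull e \<in> L" and t: "t \<in> faces K 2" "carrier_face e \<subseteq> t" "card (carrier_face e) = 2"
  shows "\<exists>!V. V \<in> triangles \<and> e \<subseteq> V \<and> carrier_face V = t"
proof -
  obtain u v where uv: "e = {u, v}" "u \<noteq> v" using e(1) by (auto simp: card_2_iff)
  have tc: "card t = 3" using t(1) by (simp add: faces2)
  obtain i where i: "i \<in> t" "i \<notin> carrier_face e" using t(2,3) tc by (metis subsetI subset_antisym numeral_eq_iff semiring_norm(89))
  have zero: "x $ i = 0" if "x \<in> e" for x using that i(2) by (auto simp: carrier_face_def supp_def)
  have et: "e \<subseteq> geometric_simplex t"
  proof
    fix x assume x: "x \<in> e"
    then have "x \<in> convex hull e" by (simp add: hull_inc)
    then have "x \<in> geometric_simplex (carrier_face e)" using L_hull_in_carrier(2)[OF e(2)] uv by blast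
    then show "x \<in> geometric_simplex t" using t(2) by (auto simp: mem_geometric_simplex)
  qed
  \<comment> \<open>The barycentre of \<open>t\<close> gives a direction off the line of the
    edge.\<close>
  define x :: "real^'a" where "x = (\<chi> j. if j \<in> t then 1 / 3 else 0)"
  have x: "supp x = t" "x \<in> geometric_simplex t"
    using tc by (auto simp: supp_def x_def mem_geometric_simplex sum.If_cases)
  have xe: "x \<notin> affine hull {u, v}"
  proof
    assume "x \<in> affine hull {u, v}"
    then obtain a b where "x = a *\<^sub>R u + b *\<^sub>R v" by (auto simp: affine_hull_2)
    then have "x $ i = 0" using zero uv by simp
    then show False using i(1) by (simp add: x_def)
  qed
  obtain w where w: "{u, v, w} \<in> triangles" "carrier_face {u, v, w} = t"
    using edge_side[OF uv(2) _ t(1) _ x(2,1) xe] e(2) et uv(1) by blast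
  show ?thesis
  proof (rule ex_ex1I)
    show "\<exists>V. V \<in> triangles \<and> e \<subseteq> V \<and> carrier_face V = t" using w uv(1) by blast
  next
    fix V1 V2 assume "V1 \<in> triangles \<and> e \<subseteq> V1 \<and> carrier_face V1 = t" "V2 \<in> triangles \<and> e \<subseteq> V2 \<and> carrier_face V2 = t"
    then have V: "V1 \<in> triangles" "e \<subseteq> V1" "carrier_face V1 = t" "V2 \<in> triangles" "e \<subseteq> V2" "carrier_face V2 = t" by auto
    obtain w1 where w1: "V1 = {u, v, w1}" using triangle_apex[OF V(1) _ uv(2)] V(2) uv(1) by metis
    obtain w2 where w2: "V2 = {u, v, w2}" using triangle_apex[OF V(4) _ uv(2)] V(5) uv(1) by metis
    have g: "w1 \<in> geometric_simplex t" "w2 \<in> geometric_simplex t"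
      using triangle_carrier(2)[OF V(1)] triangle_carrier(2)[OF V(4)] V(3,6) w1 w2 hull_inc[of w1 V1 convex] hull_inc[of w2 V2 convex] by auto
    have pos: "w1 $ i > 0" "w2 $ i > 0"
    proof -
      have "w1 $ i \<noteq> 0" using V(3) i(1) zero uv(1) unfolding w1 by (auto simp: carrier_face_def supp_def)
      moreover have "w2 $ i \<noteq> 0" using V(6) i(1) zero uv(1) unfolding w2 by (auto simp: carrier_face_def supp_def)
      ultimately show "w1 $ i > 0" "w2 $ i > 0" using g by (auto simp: mem_geometric_simplex order_less_le)
    qed
    have "w2 \<in> affine hull V1" using plane_of_carrier[OF V(1)] V(3) g(2) by simp
    then obtain a b c where abc: "a + b + c = 1" "w2 = a *\<^sub>R u + b *\<^sub>R v + c *\<^sub>R w1"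
      unfolding w1 affine_hull_3 by blast
    then have "w2 $ i = c * w1 $ i" using zero uv(1) by simp
    then have "c > 0" using pos by (metis zero_less_mult_pos2)
    then show "V1 = V2" using same_side[of u v w1 w2 a b c] V abc w1 w2 by simp
  qed
qed

text \<open>The inside of \<open>e\<close> lies in an open triangle of \<open>K\<close>, which
  extends to both sides of \<open>e\<close>. One side is taken by \<open>V0\<close>,
  \<open>edge_side\<close> finds a triangle on the other, and \<open>same_side\<close> admits only
  one on each.\<close>

lemma interior_edge_two_triangles:
  assumes V0: "V0 \<in> triangles" "e \<subseteq> V0" and e: "card e = 2" "card (carrier_face e) = 3"
  shows "card {V \<in> triangles. e \<subseteq> V} = 2"
proof -
  obtain u v where uv: "e = {u, v}" "u \<noteq> v" using e(1) by (auto simp: card_2_iff)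
  obtain w0 where w0: "V0 = {u, v, w0}" "w0 \<noteq> u" "w0 \<noteq> v" "w0 \<notin> affine hull {u, v}"
    using triangle_apex[OF V0(1) _ uv(2)] V0(2) uv(1) by metis
  let ?t = "carrier_face e"
  have carr: "carrier_face V = ?t" if "V \<in> triangles" "e \<subseteq> V" for V
  proof -
    have "?t \<subseteq> carrier_face V" using that(2) by (auto simp: carrier_face_def)
    moreover have "card (carrier_face V) = 3" using triangle_carrier(1)[OF that(1)] by (simp add: faces2)
    ultimately show ?thesis using e(2) by (metis card_subset_eq finite_code)
  qed
  have t: "?t \<in> faces K 2" using carr[OF V0] triangle_carrier(1)[OF V0(1)] by simp
  have eL: "convex hull {u, v} \<in> L" using sub_hull_in_L[of V0 e] V0 triangles_D[OF V0(1)] uv(1) by simp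
  have V0t: "x \<in> geometric_simplex ?t" if "x \<in> V0" for x
    using triangle_carrier(2)[OF V0(1)] carr[OF V0] hull_inc[OF that, of convex] by auto
  let ?m = "midpoint u v"
  have uvt: "u \<in> geometric_simplex ?t" "v \<in> geometric_simplex ?t" "w0 \<in> geometric_simplex ?t" using V0t w0 by auto
  have m_pos: "?m $ i > 0" if "i \<in> ?t" for i
  proof -
    have "u $ i \<noteq> 0 \<or> v $ i \<noteq> 0" using that uv(1) by (auto simp: carrier_face_def supp_def)
    moreover have "u $ i \<ge> 0" "v $ i \<ge> 0" using uvt by (auto simp: mem_geometric_simplex)
    ultimately show ?thesis by (auto simp: midpoint_def)
  qed
  \<comment> \<open>Below every coordinate of the midpoint in the carrier; as those of
    \<open>w0\<close> are at most 1, moving away from \<open>w0\<close> with this weight keeps them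
    positive.\<close>
  define \<delta> where "\<delta> = Min ((\<lambda>i. ?m $ i) ` ?t) / 2"
  have tne: "?t \<noteq> {}" using e(2) by auto
  have \<delta>: "\<delta> > 0" "\<And>i. i \<in> ?t \<Longrightarrow> \<delta> < ?m $ i"
  proof -
    have M: "Min ((\<lambda>i. ?m $ i) ` ?t) > 0" using m_pos tne by simp
    then show "\<delta> > 0" by (simp add: \<delta>_def)
    show "\<delta> < ?m $ i" if "i \<in> ?t" for i
    proof -
      have "Min ((\<lambda>i. ?m $ i) ` ?t) \<le> ?m $ i" using that by simp
      then show ?thesis using M unfolding \<delta>_def by linarith
    qed
  qed
  \<comment> \<open>The negative weight places \<open>x\<close> beyond the midpoint as seen from
    \<open>w0\<close>.\<close>
  define x where "x = (1 - (- \<delta>)) *\<^sub>R ?m + (- \<delta>) *\<^sub>R w0"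
  have out: "u $ i = 0" "v $ i = 0" "w0 $ i = 0" if "i \<notin> ?t" for i
    using uvt that by (auto simp: mem_geometric_simplex supp_def)
  have x_in: "x $ i > 0" if "i \<in> ?t" for i
  proof -
    have "w0 $ i \<le> (\<Sum>j\<in>UNIV. w0 $ j)" using uvt(3) by (intro member_le_sum) (auto simp: mem_geometric_simplex)
    then have "w0 $ i \<le> 1" using uvt(3) by (simp add: mem_geometric_simplex)
    then have "\<delta> * w0 $ i \<le> \<delta>" using \<delta>(1) by simp
    moreover have "0 \<le> \<delta> * ?m $ i" using \<delta>(1) m_pos[OF that] by simp
    moreover have "x $ i = ?m $ i + \<delta> * ?m $ i - \<delta> * w0 $ i" by (simp add: x_def algebra_simps)
    ultimately show ?thesis using \<delta>(2)[OF that] by linarith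
  qed
  have x_out: "x $ i = 0" if "i \<notin> ?t" for i using out[OF that] by (simp add: x_def midpoint_def)
  have supp_x: "supp x = ?t"
  proof (intro equalityI subsetI)
    fix i assume "i \<in> supp x" then show "i \<in> ?t" using x_out by (auto simp: supp_def)
  next
    fix i assume "i \<in> ?t" from x_in[OF this] show "i \<in> supp x" by (simp add: supp_def)
  qed
  have "(\<Sum>i\<in>UNIV. x $ i) = (1 + \<delta>) * ((\<Sum>i\<in>UNIV. u $ i) + (\<Sum>i\<in>UNIV. v $ i)) / 2 - \<delta> * (\<Sum>i\<in>UNIV. w0 $ i)"
    by (simp add: x_def midpoint_def sum.distrib sum_subtractf sum_negf flip: sum_distrib_left sum_divide_distrib)
  then have x_sum: "(\<Sum>i\<in>UNIV. x $ i) = 1" using uvt by (simp add: mem_geometric_simplex field_simps)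
  have "0 \<le> x $ i" for i using x_in[of i] x_out[of i] by (cases "i \<in> ?t") auto
  then have x_t: "x \<in> geometric_simplex ?t" using x_sum supp_x by (simp add: mem_geometric_simplex)
  have x_aff: "x \<notin> affine hull {u, v}"
    using affine_hull_extend[OF midpoint_in_affine_hull, of "- \<delta>" u v w0] w0(4) \<delta>(1) by (auto simp: x_def)
  obtain w1 \<epsilon> where w1: "w1 \<noteq> u" "w1 \<noteq> v" "{u, v, w1} \<in> triangles" and \<epsilon>: "0 < \<epsilon>"
    and y: "(1 - \<epsilon>) *\<^sub>R ?m + \<epsilon> *\<^sub>R x \<in> convex hull {u, v, w1}"
    using edge_side[OF uv(2) eL t _ x_t supp_x x_aff] uvt by blast
  \<comment> \<open>Otherwise a point beyond the edge would also lie in \<open>V0\<close>; solving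
    for \<open>w0\<close>, whose coefficient \<open>?k\<close> is positive, puts \<open>w0\<close>
    on the line of \<open>u\<close> and \<open>v\<close>.\<close>
  have "w1 \<noteq> w0"
  proof
    assume "w1 = w0"
    then obtain a b c where abc: "a + b + c = 1" "c \<ge> 0" "(1 - \<epsilon>) *\<^sub>R ?m + \<epsilon> *\<^sub>R x = a *\<^sub>R u + b *\<^sub>R v + c *\<^sub>R w0"
      using y unfolding convex_hull_3 by blast
    let ?k = "c + \<epsilon> * \<delta>"
    have k: "?k > 0" using abc(2) \<epsilon> \<delta>(1) by (simp add: add_nonneg_pos)
    have "(1 - \<epsilon>) *\<^sub>R ?m + \<epsilon> *\<^sub>R x = (1 + \<epsilon> * \<delta>) *\<^sub>R ?m - (\<epsilon> * \<delta>) *\<^sub>R w0"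
      by (simp add: x_def algebra_simps)
    then have eq: "a *\<^sub>R u + b *\<^sub>R v + c *\<^sub>R w0 = (1 + \<epsilon> * \<delta>) *\<^sub>R ?m - (\<epsilon> * \<delta>) *\<^sub>R w0" using abc(3) by simp
    have "?k *\<^sub>R w0 = (a *\<^sub>R u + b *\<^sub>R v + c *\<^sub>R w0) - a *\<^sub>R u - b *\<^sub>R v + (\<epsilon> * \<delta>) *\<^sub>R w0"
      by (simp add: scaleR_add_left)
    then have "?k *\<^sub>R w0 = (1 + \<epsilon> * \<delta>) *\<^sub>R ?m - a *\<^sub>R u - b *\<^sub>R v" unfolding eq by simp
    also have "\<dots> = ((1 + \<epsilon> * \<delta>) / 2 - a) *\<^sub>R u + ((1 + \<epsilon> * \<delta>) / 2 - b) *\<^sub>R v"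
      by (simp add: midpoint_def scaleR_add_right scaleR_diff_left)
    finally have "(1 / ?k) *\<^sub>R (?k *\<^sub>R w0) = (1 / ?k) *\<^sub>R (((1 + \<epsilon> * \<delta>) / 2 - a) *\<^sub>R u + ((1 + \<epsilon> * \<delta>) / 2 - b) *\<^sub>R v)" by simp
    then have "w0 = (((1 + \<epsilon> * \<delta>) / 2 - a) / ?k) *\<^sub>R u + (((1 + \<epsilon> * \<delta>) / 2 - b) / ?k) *\<^sub>R v"
      using k by (simp add: scaleR_add_right)
    moreover have "((1 + \<epsilon> * \<delta>) / 2 - a) / ?k + ((1 + \<epsilon> * \<delta>) / 2 - b) / ?k = 1"
    proof -
      have "((1 + \<epsilon> * \<delta>) / 2 - a) + ((1 + \<epsilon> * \<delta>) / 2 - b) = ?k" using abc(1) by simp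
      then show ?thesis using k by (simp flip: add_divide_distrib)
    qed
    ultimately have "w0 \<in> affine hull {u, v}" unfolding affine_hull_2 by blast
    then show False using w0(4) by simp
  qed
  \<comment> \<open>Any third vertex on the side of \<open>w0\<close> is \<open>w0\<close> itself,
    so every other one has a negative last coordinate relative to \<open>u\<close>,
    \<open>v\<close>, \<open>w0\<close>.\<close>
  have coords: "\<exists>\<alpha> \<beta> \<gamma>. w = \<alpha> *\<^sub>R u + \<beta> *\<^sub>R v + \<gamma> *\<^sub>R w0 \<and> \<alpha> + \<beta> + \<gamma> = 1 \<and> \<gamma> < 0"
    if w: "{u, v, w} \<in> triangles" "w \<noteq> w0" for w
  proof -
    have "w \<in> geometric_simplex ?t"
      using triangle_carrier(2)[OF w(1)] carr[OF w(1)] uv(1) hull_inc[of w "{u, v, w}" convex] by auto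
    then have "w \<in> affine hull V0" using plane_of_carrier[OF V0(1)] carr[OF V0] by simp
    then obtain a b c where abc: "a + b + c = 1" "w = a *\<^sub>R u + b *\<^sub>R v + c *\<^sub>R w0"
      unfolding w0(1) affine_hull_3 by blast
    have "\<not> c > 0" using same_side[of u v w0 w a b c] V0(1) w0(1) w abc by auto
    moreover have "c \<noteq> 0"
    proof
      assume "c = 0"
      then have "w \<in> affine hull {u, v}" using abc unfolding affine_hull_2 by auto
      moreover have "w \<noteq> u" "w \<noteq> v" using triangles_D(1)[OF w(1)] by (auto simp: card_insert_if split: if_splits)
      then have "{u, v, w} - {w} = {u, v}" by auto
      ultimately show False using triangles_D(2)[OF w(1)] unfolding affine_dependent_def by auto
    qed
    ultimately show ?thesis using abc by (intro exI[of _ a] exI[of _ b] exI[of _ c]) auto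
  qed
  have "V \<in> {V0, {u, v, w1}}" if V: "V \<in> triangles" "e \<subseteq> V" for V
  proof -
    obtain w where w: "V = {u, v, w}" using triangle_apex[OF V(1) _ uv(2)] V(2) uv(1) by metis
    show ?thesis
    proof (cases "w = w0")
      case True then show ?thesis using w w0(1) by simp
    next
      case False
      obtain a b c where abc: "w = a *\<^sub>R u + b *\<^sub>R v + c *\<^sub>R w0" "a + b + c = 1" "c < 0"
        using coords[of w] V w False by blast
      obtain a1 b1 c1 where abc1: "w1 = a1 *\<^sub>R u + b1 *\<^sub>R v + c1 *\<^sub>R w0" "a1 + b1 + c1 = 1" "c1 < 0"
        using coords[OF w1(3) \<open>w1 \<noteq> w0\<close>] by blast
      \<comment> \<open>Two negative coordinates have a positive quotient, so \<open>w\<close> and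
        \<open>w1\<close> are on the same side.\<close>
      let ?r = "c / c1"
      have "?r *\<^sub>R w1 = (?r * a1) *\<^sub>R u + (?r * b1) *\<^sub>R v + c *\<^sub>R w0"
        using abc1(3) by (simp add: abc1(1) scaleR_add_right)
      then have "w = (a - ?r * a1) *\<^sub>R u + (b - ?r * b1) *\<^sub>R v + ?r *\<^sub>R w1"
        by (simp add: abc(1) scaleR_diff_left)
      moreover have "(a - ?r * a1) + (b - ?r * b1) + ?r = 1"
      proof -
        have "(a - ?r * a1) + (b - ?r * b1) + ?r = (a + b) - ?r * (a1 + b1 - 1)" by (simp add: algebra_simps add_divide_distrib)
        also have "a1 + b1 - 1 = - c1" using abc1(2) by simp
        finally show ?thesis using abc(2) abc1(3) by simp
      qed
      moreover have "?r > 0" using abc(3) abc1(3) by (simp add: divide_neg_neg)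
      ultimately have "w1 = w" using same_side[OF w1(3)] V(1) w by blast
      then show ?thesis using w by simp
    qed
  qed
  then have "{V \<in> triangles. e \<subseteq> V} = {V0, {u, v, w1}}" using V0 w1(3) uv(1) by auto
  moreover have "V0 \<noteq> {u, v, w1}" using w0 w1 \<open>w1 \<noteq> w0\<close> by auto
  ultimately show ?thesis by simp
qed

lemma edge_hull_in_L:
  assumes "V \<in> triangles" "e \<subseteq> V"
  shows "convex hull e \<in> L" "\<not> affine_dependent e"
  using sub_hull_in_L triangles_D[OF assms(1)] assms(2) affine_dependent_subset by blast+

lemma carrier_mono: "e \<subseteq> V \<Longrightarrow> carrier_face e \<subseteq> carrier_face V"
  by (auto simp: carrier_face_def)

lemma triangle_carrier_card: "V \<in> triangles \<Longrightarrow> card (carrier_face V) = 3"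
  using triangle_carrier(1) by (simp add: faces2)

lemma carrier_face_edge_card:
  assumes "V \<in> triangles" "e \<subseteq> V" "card e = 2"
  shows "card (carrier_face e) = 2 \<or> card (carrier_face e) = 3"
proof -
  have "e \<noteq> {}" using assms(3) by auto
  then have "2 \<le> card (carrier_face e)"
    using carrier_card[of e] edge_hull_in_L[OF assms(1,2)] assms(3) by simp
  moreover have "card (carrier_face e) \<le> 3"
    using card_mono[OF _ carrier_mono[OF assms(2)]] triangle_carrier_card[OF assms(1)] by simp
  ultimately show ?thesis by linarith
qed

lemma interior_edge_carrier:
  assumes "V \<in> triangles" "e \<subseteq> V" "card (carrier_face e) = 3"
  shows "carrier_face V = carrier_face e"
  using card_subset_eq[OF _ carrier_mono[OF assms(2)]] triangle_carrier_card[OF assms(1)] assms(3) by simp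

text \<open>Over an edge of \<open>K\<close>, a triangle of \<open>L\<close> at \<open>e\<close> is
  determined by its carrier, so \<open>carrier_face\<close> is a bijection.\<close>

lemma boundary_edge_count:
  assumes e: "card e = 2" "convex hull e \<in> L" "card (carrier_face e) = 2" and z: "z \<subseteq> faces K 2"
  shows "card {V \<in> triangles. carrier_face V \<in> z \<and> e \<subseteq> V} = card {t \<in> z. carrier_face e \<subseteq> t}"
proof -
  have uniq: "\<exists>!V. V \<in> triangles \<and> e \<subseteq> V \<and> carrier_face V = t" if "t \<in> z" "carrier_face e \<subseteq> t" for t
    using boundary_edge_unique_triangle[OF e(1,2) _ that(2) e(3)] z that(1) by blast
  have "bij_betw carrier_face {V \<in> triangles. carrier_face V \<in> z \<and> e \<subseteq> V} {t \<in> z. carrier_face e \<subseteq> t}"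
  proof (rule bij_betw_imageI)
    show "inj_on carrier_face {V \<in> triangles. carrier_face V \<in> z \<and> e \<subseteq> V}"
    proof (rule inj_onI)
      fix V V' assume "V \<in> {V \<in> triangles. carrier_face V \<in> z \<and> e \<subseteq> V}"
        "V' \<in> {V \<in> triangles. carrier_face V \<in> z \<and> e \<subseteq> V}" "carrier_face V = carrier_face V'"
      then show "V = V'" using uniq[of "carrier_face V"] carrier_mono[of e V] by auto
    qed
    show "carrier_face ` {V \<in> triangles. carrier_face V \<in> z \<and> e \<subseteq> V} = {t \<in> z. carrier_face e \<subseteq> t}"
    proof (intro equalityI subsetI)
      fix t assume "t \<in> carrier_face ` {V \<in> triangles. carrier_face V \<in> z \<and> e \<subseteq> V}"
      then show "t \<in> {t \<in> z. carrier_face e \<subseteq> t}" using carrier_mono by blast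
    next
      fix t assume t: "t \<in> {t \<in> z. carrier_face e \<subseteq> t}"
      then obtain V where "V \<in> triangles" "e \<subseteq> V" "carrier_face V = t" using uniq[of t] by blast
      then show "t \<in> carrier_face ` {V \<in> triangles. carrier_face V \<in> z \<and> e \<subseteq> V}" using t by blast
    qed
  qed
  then show ?thesis by (rule bij_betw_same_card)
qed

text \<open>An edge of \<open>L\<close> over an edge of \<open>K\<close> inherits its degree. An
  edge inside a triangle of \<open>K\<close> lies in two triangles of \<open>L\<close>, both with
  that carrier and hence both chosen or both left out.\<close>

lemma subdivided_cycle:
  assumes z: "z \<in> mod2_cycles (faces K 2)"
  shows "{V \<in> triangles. carrier_face V \<in> z} \<in> mod2_cycles triangles"
proof -
  have zF: "z \<subseteq> faces K 2" and zev: "\<And>e. card e = 2 \<Longrightarrow> even (card {t \<in> z. e \<subseteq> t})"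
    using z by (auto simp: mod2_cycles_def)
  have "even (card {V \<in> {V \<in> triangles. carrier_face V \<in> z}. e \<subseteq> V})" if e: "card e = 2" for e
  proof (cases "\<exists>V\<in>triangles. e \<subseteq> V")
    case False
    then have "{V \<in> {V \<in> triangles. carrier_face V \<in> z}. e \<subseteq> V} = {}" by blast
    then show ?thesis by (metis card.empty even_zero)
  next
    case True
    then obtain V0 where V0: "V0 \<in> triangles" "e \<subseteq> V0" by blast
    from carrier_face_edge_card[OF V0 e] show ?thesis
    proof
      assume c: "card (carrier_face e) = 2"
      have "{V \<in> {V \<in> triangles. carrier_face V \<in> z}. e \<subseteq> V} = {V \<in> triangles. carrier_face V \<in> z \<and> e \<subseteq> V}" by blast
      then show ?thesis using boundary_edge_count[OF e edge_hull_in_L(1)[OF V0] c zF] zev[OF c] by simp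
    next
      assume c: "card (carrier_face e) = 3"
      have "{V \<in> {V \<in> triangles. carrier_face V \<in> z}. e \<subseteq> V} = (if carrier_face e \<in> z then {V \<in> triangles. e \<subseteq> V} else {})"
        using interior_edge_carrier[OF _ _ c] by auto
      then show ?thesis using interior_edge_two_triangles[OF V0 e c] by simp
    qed
  qed
  then show ?thesis by (auto simp: mod2_cycles_def)
qed

section \<open>Pieces of the subdivision over a face\<close>

text \<open>The simplex that \<open>star_point\<close> finds at an end of \<open>s\<close> in
  direction of the midpoint contains two points over \<open>s\<close>. Its vertices supported in
  \<open>s\<close> span both, so there are two such vertices, and \<open>carrier_card\<close> makes
  their carrier all of \<open>s\<close>.\<close>

lemma exists_edge_on_face:
  assumes "s \<in> K" "card s = 2"
  shows "\<exists>e. card e = 2 \<and> convex hull e \<in> L \<and> carrier_face e = s"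
proof -
  obtain i j where ij: "s = {i, j}" "i \<noteq> j" using assms(2) by (auto simp: card_2_iff)
  define p :: "real^'a" where "p = axis i 1"
  define x :: "real^'a" where "x = (1 / 2) *\<^sub>R axis i 1 + (1 / 2) *\<^sub>R axis j 1"
  have p: "p \<in> geometric_simplex s" using ij unfolding p_def geometric_simplex_def by (simp add: hull_inc)
  have "axis j 1 \<in> geometric_simplex s" using ij unfolding geometric_simplex_def by (simp add: hull_inc)
  then have xg: "x \<in> geometric_simplex s"
    using p convexD[OF convex_geometric_simplex, of p s "axis j 1" "1/2" "1/2"] by (simp add: x_def p_def)
  have xs: "supp x = s" using ij by (auto simp: supp_def x_def axis_def)
  obtain S \<epsilon> where S: "S \<in> L" "p \<in> S" "0 < \<epsilon>" "(1 - \<epsilon>) *\<^sub>R p + \<epsilon> *\<^sub>R x \<in> S"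
    using star_point[OF assms(1) p xg xs] by blast
  let ?y = "(1 - \<epsilon>) *\<^sub>R p + \<epsilon> *\<^sub>R x"
  have "?y $ j \<noteq> 0" "p $ j = 0" using ij S(3) by (auto simp: p_def x_def axis_def)
  then have py: "p \<noteq> ?y" by metis
  obtain C where C: "\<not> affine_dependent C" "S = convex hull C" "finite C" using L_simplex[OF S(1)] .
  let ?C = "{c \<in> C. supp c \<subseteq> s}"
  have nn: "0 \<le> c $ k" if "c \<in> C" for c k
    using nonneg_sum1(1)[OF S(1)] that C(2) hull_inc[of c C convex] by blast
  \<comment> \<open>Coordinates of the vertices are nonnegative, so nothing cancels a coordinate
    outside \<open>s\<close>; vertices having one get weight 0.\<close>
  have in_C: "q \<in> convex hull ?C" if q: "q \<in> S" "supp q \<subseteq> s" for q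
  proof -
    obtain a where a: "\<forall>c\<in>C. 0 \<le> a c" "sum a C = 1" "(\<Sum>c\<in>C. a c *\<^sub>R c) = q"
      using q(1) C(2,3) by (auto simp: convex_hull_finite)
    have zero: "a c = 0" if c: "c \<in> C" "\<not> supp c \<subseteq> s" for c
    proof -
      obtain k where k: "k \<notin> s" "c $ k \<noteq> 0" using c(2) by (auto simp: supp_def)
      have "(\<Sum>c\<in>C. a c * c $ k) = q $ k" unfolding a(3)[symmetric] by (simp add: sum_component)
      also have "\<dots> = 0" using q(2) k(1) by (auto simp: supp_def)
      finally have "a c * c $ k = 0"
        using sum_nonneg_eq_0_iff[of C "\<lambda>c. a c * c $ k"] a(1) nn C(3) c(1) by simp
      then show ?thesis using k(2) by simp
    qed
    have "sum a ?C = 1" "(\<Sum>c\<in>?C. a c *\<^sub>R c) = q"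
      using a zero C(3) by (auto simp: sum.mono_neutral_right[of C ?C a] sum.mono_neutral_right[of C ?C "\<lambda>c. a c *\<^sub>R c"]
        intro: trans[OF sum.mono_neutral_left])
    then show ?thesis using a(1) C(3) by (auto simp: convex_hull_finite intro!: exI[of _ a])
  qed
  have "supp p \<subseteq> s" "supp ?y \<subseteq> s"
    using p xg convex_geometric_simplex[of s] ij by (auto simp: p_def x_def supp_def axis_def split: if_splits)
  then have hull: "p \<in> convex hull ?C" "?y \<in> convex hull ?C" using in_C[OF S(2)] in_C[OF S(4)] by simp_all
  have "\<exists>u v. u \<in> ?C \<and> v \<in> ?C \<and> u \<noteq> v"
  proof (rule ccontr)
    assume "\<not> ?thesis"
    then have "?C = {} \<or> (\<exists>u. ?C = {u})" by blast
    then show False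
    proof
      assume "?C = {}"
      then show False using hull(1) by (metis convex_hull_empty empty_iff)
    next
      assume "\<exists>u. ?C = {u}"
      then obtain u where "?C = {u}" by blast
      then have "p = u" "?y = u" using hull by (metis convex_hull_singleton singletonD)+
      then show False using py by simp
    qed
  qed
  then obtain u v where uv: "u \<in> C" "v \<in> C" "supp u \<subseteq> s" "supp v \<subseteq> s" "u \<noteq> v" by blast
  have e: "{u, v} \<subseteq> C" "card {u, v} = 2" using uv by auto
  have eL: "convex hull {u, v} \<in> L" using sub_hull_in_L[OF C(1) _ e(1)] S(1) C(2) by simp
  have "carrier_face {u, v} \<subseteq> s" using uv by (auto simp: carrier_face_def)
  moreover have "2 \<le> card (carrier_face {u, v})"
    using carrier_card[of "{u, v}"] eL e affine_independent_2 by simp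
  ultimately have "carrier_face {u, v} = s" using assms(2) card_seteq[of s "carrier_face {u, v}"] by simp
  then show ?thesis using e eL by blast
qed

lemma triangle_over_face:
  assumes "t \<in> faces K 2"
  shows "\<exists>V\<in>triangles. carrier_face V = t"
proof -
  have t: "t \<in> K" "card t = 3" using assms by (auto simp: faces2)
  then obtain s where s: "s \<subseteq> t" "card s = 2" using obtain_subset_with_card_n[of 2 t] by auto
  have "s \<noteq> {}" using s(2) by auto
  from K_down[OF t(1) s(1) this] have "s \<in> K" .
  then obtain e where "card e = 2" "convex hull e \<in> L" "carrier_face e = s" using exists_edge_on_face s(2) by blast
  then show ?thesis using boundary_edge_unique_triangle[of e t] assms s by blast
qed

text \<open>A simplex of \<open>L\<close> that contains \<open>x\<close> and a second point in the
  same open triangle has carrier \<open>t\<close> and at least two vertices. If it is only an edge,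
  \<open>edge_side\<close> extends it to a triangle over \<open>t\<close>.\<close>

lemma open_face_covered:
  assumes t: "t \<in> faces K 2" and x: "x \<in> geometric_simplex t" "supp x = t"
  shows "\<exists>V\<in>triangles. carrier_face V = t \<and> x \<in> convex hull V"
proof -
  have tK: "t \<in> K" "card t = 3" using t by (auto simp: faces2)
  obtain i where i: "i \<in> t" using tK(2) by fastforce
  \<comment> \<open>A direction different from \<open>x\<close> itself, so that the simplex found is
    not a single point.\<close>
  define x' where "x' = midpoint x (axis i 1)"
  have ai: "axis i 1 \<in> geometric_simplex t" using i unfolding geometric_simplex_def by (simp add: hull_inc)
  have x'_comb: "x' = (1 - 1 / 2) *\<^sub>R x + (1 / 2) *\<^sub>R axis i 1" by (simp add: x'_def midpoint_def scaleR_add_right)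
  have x't: "x' \<in> geometric_simplex t" "supp x' = t"
    unfolding x'_comb by (rule open_simplex_combination[OF x ai]; simp)+
  have "x \<noteq> axis i 1"
  proof
    assume "x = axis i 1"
    then have "t \<subseteq> {i}" using x(2) by (auto simp: supp_def axis_def split: if_splits)
    then show False using tK(2) card_mono[of "{i}" t] by simp
  qed
  then have "x' \<noteq> x" by (simp add: x'_def)
  obtain S \<epsilon> where S: "S \<in> L" "x \<in> S" "0 < \<epsilon>" "(1 - \<epsilon>) *\<^sub>R x + \<epsilon> *\<^sub>R x' \<in> S"
    using star_point[OF tK(1) x(1) x't] by blast
  have ne: "(1 - \<epsilon>) *\<^sub>R x + \<epsilon> *\<^sub>R x' \<noteq> x"
  proof
    assume "(1 - \<epsilon>) *\<^sub>R x + \<epsilon> *\<^sub>R x' = x"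
    then have "\<epsilon> *\<^sub>R (x' - x) = 0" by (simp add: algebra_simps)
    then show False using S(3) \<open>x' \<noteq> x\<close> by simp
  qed
  obtain C where C: "\<not> affine_dependent C" "S = convex hull C" "finite C" using L_simplex[OF S(1)] .
  have CL: "convex hull C \<in> L" "C \<noteq> {}" using S C by auto
  obtain s where s: "s \<in> K" "S \<subseteq> geometric_simplex s" using L_sub[OF S(1)] by blast
  have "x \<in> geometric_simplex s" using s(2) S(2) by blast
  then have "t \<subseteq> s" using x(2) by (simp add: mem_geometric_simplex)
  then have st: "s = t" using K_card[OF s(1)] tK(2) by (metis card_seteq finite_code)
  have Ct: "C \<subseteq> geometric_simplex t" using s(2) C(2) st by (metis hull_subset order_trans)
  have "carrier_face C \<subseteq> t" by (rule L_hull_in_carrier(3)[OF CL Ct])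
  moreover have "x \<in> geometric_simplex (carrier_face C)" using L_hull_in_carrier(2)[OF CL] S(2) C(2) by blast
  then have "t \<subseteq> carrier_face C" using x(2) by (simp add: mem_geometric_simplex)
  ultimately have carr: "carrier_face C = t" by blast
  then have "card C \<le> 3" using carrier_card[OF C(1) CL] tK(2) by simp
  moreover have "card C \<noteq> 0" using C(3) CL(2) by simp
  moreover have "card C \<noteq> 1"
  proof
    assume "card C = 1"
    then obtain c where "C = {c}" by (auto simp: card_1_singleton_iff)
    then show False using S ne C(2) by simp
  qed
  ultimately consider "card C = 3" | "card C = 2" by linarith
  then show ?thesis
  proof cases
    case 1
    then have "C \<in> triangles" using C(1) CL by (simp add: triangles_def)
    then show ?thesis using carr S(2) C(2) by blast
  next
    case 2
    then obtain u v where uv: "C = {u, v}" "u \<noteq> v" by (auto simp: card_2_iff)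
    \<comment> \<open>The three vertices of \<open>t\<close> are affinely independent, so they are
      not all on one line.\<close>
    have "\<exists>k\<in>t. axis k 1 \<notin> affine hull {u, v}"
    proof (rule ccontr)
      assume "\<not> ?thesis"
      then have "(\<lambda>k. axis k (1::real)) ` t \<subseteq> affine hull {u, v}" by blast
      then have "aff_dim ((\<lambda>k. axis k (1::real)) ` t :: (real^'a) set) \<le> aff_dim (affine hull {u, v})" by (rule aff_dim_subset)
      then have "aff_dim ((\<lambda>k. axis k (1::real)) ` t :: (real^'a) set) \<le> 1" using uv(2) by simp
      moreover have "inj_on (\<lambda>k. axis k (1::real) :: real^'a) t" by (auto simp: inj_on_def axis_eq_axis)
      then have "card ((\<lambda>k. axis k (1::real) :: real^'a) ` t) = 3" using tK(2) by (simp add: card_image)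
      moreover have "\<not> affine_dependent ((\<lambda>k. axis k (1::real) :: real^'a) ` t)"
      proof -
        have "(\<lambda>k. axis k (1::real) :: real^'a) ` t \<subseteq> Basis" by auto
        then show ?thesis using independent_mono[OF independent_Basis] affine_dependent_imp_dependent by blast
      qed
      ultimately show False using aff_dim_affine_independent by fastforce
    qed
    then obtain k where k: "k \<in> t" "axis k 1 \<notin> affine hull {u, v}" by blast
    have ak: "axis k 1 \<in> geometric_simplex t" using k(1) unfolding geometric_simplex_def by (simp add: hull_inc)
    define q where "q = (1 - 1 / 2) *\<^sub>R x + (1 / 2) *\<^sub>R axis k 1"
    have xuv: "x \<in> affine hull {u, v}" using S(2) C(2) uv(1) convex_hull_subset_affine_hull by blast
    have q: "q \<in> geometric_simplex t" "supp q = t"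
      unfolding q_def by (rule open_simplex_combination[OF x ak]; simp)+
    have q3: "q \<notin> affine hull {u, v}"
      using affine_hull_extend[OF xuv, of "1/2" "axis k 1"] k(2) by (auto simp: q_def)
    obtain w where w: "{u, v, w} \<in> triangles" "carrier_face {u, v, w} = t"
      using edge_side[OF uv(2) _ t _ q q3] CL(1) Ct uv(1) by blast
    have "convex hull {u, v} \<subseteq> convex hull {u, v, w}" by (rule hull_mono) blast
    then show ?thesis using w S(2) C(2) uv(1) by blast
  qed
qed

text \<open>In the relative interior all vertices have positive weight, so no coordinate is lost. A
  vertex of any triangle that lies in the hull of \<open>W\<close> is a vertex of \<open>W\<close>,
  hence not interior.\<close>

lemma triangle_interior_point:
  assumes W: "W \<in> triangles"
  shows "\<exists>x\<in>convex hull W. supp x = carrier_face W \<and> x \<notin> \<Union>triangles"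
proof -
  note W' = triangles_D[OF W]
  have "convex hull W \<noteq> {}" using W'(1) by auto
  then have "rel_interior (convex hull W) \<noteq> {}" using rel_interior_eq_empty[of "convex hull W"] convex_convex_hull by blast
  then obtain x where x: "x \<in> rel_interior (convex hull W)" by blast
  then obtain a where a: "\<forall>w\<in>W. 0 < a w" "(\<Sum>w\<in>W. a w *\<^sub>R w) = x"
    unfolding rel_interior_convex_hull_explicit[OF W'(2)] by blast
  have xW: "x \<in> convex hull W" using x rel_interior_subset by blast
  have nn: "0 \<le> w $ i" if "w \<in> W" for w i
    using nonneg_sum1(1)[OF W'(3)] that hull_inc[of w W convex] by blast
  have "x $ i = 0 \<longleftrightarrow> (\<forall>w\<in>W. w $ i = 0)" for i
  proof -
    have "x $ i = (\<Sum>w\<in>W. a w * w $ i)" unfolding a(2)[symmetric] by (simp add: sum_component)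
    also have "\<dots> = 0 \<longleftrightarrow> (\<forall>w\<in>W. a w * w $ i = 0)"
      using nn a(1) W'(4) by (intro sum_nonneg_eq_0_iff) (auto simp: less_imp_le)
    also have "\<dots> \<longleftrightarrow> (\<forall>w\<in>W. w $ i = 0)" using a(1) by force
    finally show ?thesis .
  qed
  then have "supp x = carrier_face W" by (auto simp: supp_def carrier_face_def)
  moreover have "x \<notin> \<Union>triangles"
  proof
    assume "x \<in> \<Union>triangles"
    then obtain V where V: "V \<in> triangles" "x \<in> V" by blast
    have "x \<in> convex hull (W \<inter> V)" using triangles_meet[OF W V(1)] xW hull_inc[OF V(2), of convex] by blast
    then have "x \<in> W"
      using affine_independent_vertex_in_hull[OF triangles_D(2)[OF V(1)], of "W \<inter> V" x] V(2) by blast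
    then have "convex hull {x} face_of convex hull W"
      unfolding face_of_convex_hull_affine_independent[OF W'(2)] by blast
    moreover have "convex hull W \<noteq> {x}"
    proof
      assume "convex hull W = {x}"
      then have "W \<subseteq> {x}" by (metis hull_subset)
      then show False using W'(1) card_mono[of "{x}" W] by simp
    qed
    ultimately show False using face_of_disjoint_rel_interior[of "{x}" "convex hull W"] x by simp
  qed
  ultimately show ?thesis using xW by blast
qed

lemma open_face_connected:
  assumes W: "W \<in> triangles" and N: "finite N"
  shows "connected ({x \<in> geometric_simplex (carrier_face W). supp x = carrier_face W} - N)"
proof (rule connected_convex_diff_countable)
  let ?t = "carrier_face W"
  let ?O = "{x \<in> geometric_simplex ?t. supp x = ?t}"
  show "convex ?O"
  proof (rule convexI)
    fix x y :: "real^'a" and u v :: real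
    assume xy: "x \<in> ?O" "y \<in> ?O" and uv: "0 \<le> u" "0 \<le> v" "u + v = 1"
    have u: "u = 1 - v" using uv by simp
    show "u *\<^sub>R x + v *\<^sub>R y \<in> ?O"
    proof (cases "v = 0 \<or> v = 1")
      case True
      then show ?thesis using xy u by auto
    next
      case False
      then have v01: "0 < v" "v < 1" using uv by auto
      show ?thesis unfolding u using open_simplex_combination[of x ?t y v] xy v01 by simp
    qed
  qed
  show "\<not> collinear ?O"
  proof -
    obtain b where b: "b \<in> convex hull W" "supp b = ?t" using triangle_interior_point[OF W] by blast
    have bt: "b \<in> geometric_simplex ?t" using b(1) triangle_carrier(2)[OF W] by blast
    have "y \<in> affine hull ?O" if y: "y \<in> geometric_simplex ?t" for y
    proof -
      let ?q = "(1 - 1 / 2) *\<^sub>R b + (1 / 2) *\<^sub>R y"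
      have "supp ?q = ?t" "?q \<in> geometric_simplex ?t"
        by (rule open_simplex_combination[OF bt b(2) y]; simp)+
      then have "?q \<in> affine hull ?O" by (simp add: hull_inc)
      moreover have "b \<in> affine hull ?O" using b(2) bt by (simp add: hull_inc)
      ultimately show ?thesis using affine_hull_extend[of b ?O "1 / 2" y] by simp
    qed
    then have "W \<subseteq> affine hull ?O" using triangle_carrier(2)[OF W] hull_subset[of W convex] by blast
    then have "aff_dim W \<le> aff_dim ?O" using aff_dim_subset[of W "affine hull ?O"] by simp
    then show ?thesis
      using aff_dim_affine_independent[OF triangles_D(2)[OF W]] triangles_D(1)[OF W] by (simp add: collinear_aff_dim)
  qed
  show "countable N" using N by (simp add: countable_finite)
qed

text \<open>The pieces in \<open>z\<close> and those outside form two closed sets covering the open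
  triangle, so by connectedness they share a point that is no vertex. It lies inside an edge that
  belongs to exactly two pieces, one in \<open>z\<close> and one not, against the even
  degree.\<close>

lemma cycle_carrier_constant:
  assumes z: "z \<in> mod2_cycles triangles" and V: "V \<in> z" and V': "V' \<in> triangles" "carrier_face V' = carrier_face V"
  shows "V' \<in> z"
proof (rule ccontr)
  assume nz: "V' \<notin> z"
  have zT: "z \<subseteq> triangles" and zev: "\<And>e. card e = 2 \<Longrightarrow> even (card {t \<in> z. e \<subseteq> t})"
    using z by (auto simp: mod2_cycles_def)
  have VT: "V \<in> triangles" using V zT by blast
  let ?t = "carrier_face V"
  let ?O = "{x \<in> geometric_simplex ?t. supp x = ?t} - \<Union>triangles"
  let ?A = "\<Union>W\<in>{W \<in> z. carrier_face W = ?t}. convex hull W"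
  let ?B = "\<Union>W\<in>{W \<in> triangles - z. carrier_face W = ?t}. convex hull W"
  have "finite (\<Union>triangles)" using finite_triangles triangles_D(4) by blast
  then have conn: "connected ?O" by (rule open_face_connected[OF VT])
  have fin: "finite {W \<in> z. carrier_face W = ?t}" "finite {W \<in> triangles - z. carrier_face W = ?t}"
    using finite_triangles finite_subset[OF zT finite_triangles] by auto
  have cl: "closed ?A" "closed ?B" using fin triangles_D(4) zT by (auto intro!: closed_UN_hulls)
  have cov: "?O \<subseteq> ?A \<union> ?B"
  proof
    fix x assume "x \<in> ?O"
    then obtain W where "W \<in> triangles" "carrier_face W = ?t" "x \<in> convex hull W"
      using open_face_covered[OF triangle_carrier(1)[OF VT]] by blast
    then show "x \<in> ?A \<union> ?B" by blast
  qed
  have meets: "\<exists>x. x \<in> ?O \<and> x \<in> convex hull W" if W: "W \<in> triangles" "carrier_face W = ?t" for W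
  proof -
    obtain x where x: "x \<in> convex hull W" "supp x = carrier_face W" "x \<notin> \<Union>triangles"
      using triangle_interior_point[OF W(1)] by blast
    then have "x \<in> geometric_simplex ?t" using triangle_carrier(2)[OF W(1)] W(2) by auto
    then show ?thesis using x W(2) by auto
  qed
  have "?A \<inter> ?O \<noteq> {}" using meets[OF VT refl] V by blast
  moreover have "?B \<inter> ?O \<noteq> {}" using meets[OF V'] V' nz by blast
  ultimately have "?A \<inter> ?B \<inter> ?O \<noteq> {}" using conn cl cov unfolding connected_closed by blast
  then obtain x W W' where x: "x \<in> ?O" and W: "W \<in> z" "carrier_face W = ?t" "x \<in> convex hull W"
    and W': "W' \<in> triangles" "W' \<notin> z" "carrier_face W' = ?t" "x \<in> convex hull W'" by blast
  have WT: "W \<in> triangles" using W(1) zT by blast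
  have WW: "W \<noteq> W'" using W(1) W'(2) by blast
  let ?e = "W \<inter> W'"
  have xe: "x \<in> convex hull ?e" using triangles_meet[OF WT W'(1)] W(3) W'(4) by blast
  have fe: "finite ?e" using triangles_D(4)[OF WT] by blast
  have "?e \<noteq> W" using WW card_subset_eq[of W' W] triangles_D[OF WT] triangles_D[OF W'(1)] by (metis Int_lower2)
  then have "card ?e < 3" using psubset_card_mono[of W ?e] triangles_D[OF WT] by auto
  moreover have "card ?e \<noteq> 0" using xe fe by auto
  moreover have "card ?e \<noteq> 1"
  proof
    assume "card ?e = 1"
    then obtain c where "?e = {c}" using card_1_singletonE by blast
    then have "x = c" "c \<in> W" using xe by auto
    then show False using x WT by blast
  qed
  ultimately have e2: "card ?e = 2" by linarith
  have eL: "convex hull ?e \<in> L" "?e \<noteq> {}" using edge_hull_in_L(1)[OF WT] e2 by auto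
  have "x \<in> geometric_simplex (carrier_face ?e)" using L_hull_in_carrier(2)[OF eL] xe by blast
  then have "?t \<subseteq> carrier_face ?e" using x by (auto simp: mem_geometric_simplex)
  moreover have "carrier_face ?e \<subseteq> ?t" using carrier_mono[of ?e W] W(2) by simp
  ultimately have "card (carrier_face ?e) = 3" using triangle_carrier_card[OF VT] by simp
  then have c2: "card {U \<in> triangles. ?e \<subseteq> U} = 2" using interior_edge_two_triangles[OF WT _ e2] by simp
  have "{W, W'} = {U \<in> triangles. ?e \<subseteq> U}"
    using c2 WT W'(1) WW finite_triangles by (intro card_subset_eq) auto
  then have "{U \<in> z. ?e \<subseteq> U} = {W}" using W(1) W'(2) zT by blast
  then show False using zev[OF e2] by simp
qed

text \<open>The cycle of \<open>K\<close> is the set of carriers. The degree of an edge of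
  \<open>K\<close> is tested on any edge of \<open>L\<close> lying over it.\<close>

lemma cycle_is_subdivided:
  assumes z': "z' \<in> mod2_cycles triangles"
  shows "\<exists>z\<in>mod2_cycles (faces K 2). z' = {V \<in> triangles. carrier_face V \<in> z}"
proof (intro bexI)
  let ?z = "carrier_face ` z'"
  have zT: "z' \<subseteq> triangles" and zev: "\<And>e. card e = 2 \<Longrightarrow> even (card {t \<in> z'. e \<subseteq> t})"
    using z' by (auto simp: mod2_cycles_def)
  show eq: "z' = {V \<in> triangles. carrier_face V \<in> ?z}"
    using zT cycle_carrier_constant[OF z'] by blast
  have zF: "?z \<subseteq> faces K 2" using zT triangle_carrier(1) by blast
  have "even (card {t \<in> ?z. s \<subseteq> t})" if s: "card s = 2" for s
  proof (cases "{t \<in> ?z. s \<subseteq> t} = {}")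
    case True
    then show ?thesis by (metis card.empty even_zero)
  next
    case False
    then obtain t where t: "t \<in> ?z" "s \<subseteq> t" by blast
    then have "t \<in> faces K 2" using zF by blast
    then have "t \<in> K" by (simp add: faces2)
    moreover have "s \<noteq> {}" using s by auto
    ultimately have "s \<in> K" using K_down t(2) by metis
    then obtain e where e: "card e = 2" "convex hull e \<in> L" "carrier_face e = s" using exists_edge_on_face s by blast
    have "{V \<in> z'. e \<subseteq> V} = {V \<in> triangles. carrier_face V \<in> ?z \<and> e \<subseteq> V}" using eq by blast
    then show ?thesis using boundary_edge_count[OF e(1,2) _ zF] e(3) s zev[OF e(1)] by simp
  qed
  then show "?z \<in> mod2_cycles (faces K 2)" using zF by (simp add: mod2_cycles_def)
qed

end

section \<open>Transport to space along the embedding\<close>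

lemma mod2_cycles_image_iff:
  assumes f: "inj_on f (\<Union>T)" and z: "z \<subseteq> T"
  shows "(`) f ` z \<in> mod2_cycles ((`) f ` T) \<longleftrightarrow> z \<in> mod2_cycles T"
proof -
  have count: "card {t \<in> (`) f ` z. f ` e \<subseteq> t} = card {t \<in> z. e \<subseteq> t}" if e: "e \<subseteq> \<Union>T" for e
  proof -
    have iff: "f ` e \<subseteq> f ` t \<longleftrightarrow> e \<subseteq> t" if "t \<in> T" for t
      using inj_on_image_subset_iff[OF f e, of t] that by blast
    have "{t \<in> (`) f ` z. f ` e \<subseteq> t} = (`) f ` {t \<in> z. e \<subseteq> t}" using iff z by auto
    moreover have "inj_on ((`) f) {t \<in> z. e \<subseteq> t}"
      using z by (intro inj_on_subset[OF inj_on_image_Pow[OF f]]) auto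
    ultimately show ?thesis by (simp add: card_image)
  qed
  have card_e: "card (f ` e) = card e" if "e \<subseteq> \<Union>T" for e
    using that f by (intro card_image) (rule inj_on_subset)
  show ?thesis
  proof
    assume L: "(`) f ` z \<in> mod2_cycles ((`) f ` T)"
    have "even (card {t \<in> z. e \<subseteq> t})" if "card e = 2" for e
    proof (cases "e \<subseteq> \<Union>T")
      case True
      have "\<forall>e. card e = 2 \<longrightarrow> even (card {t \<in> (`) f ` z. e \<subseteq> t})"
        using L unfolding mod2_cycles_def by simp
      then have "even (card {t \<in> (`) f ` z. f ` e \<subseteq> t})"
        using card_e[OF True] that by simp
      then show ?thesis using count[OF True] by simp
    next
      case False
      then have "{t \<in> z. e \<subseteq> t} = {}" using z by blast
      then show ?thesis by (metis card.empty even_zero)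
    qed
    then show "z \<in> mod2_cycles T" using z by (simp add: mod2_cycles_def)
  next
    assume R: "z \<in> mod2_cycles T"
    have "even (card {t \<in> (`) f ` z. e \<subseteq> t})" if "card e = 2" for e
    proof (cases "e \<subseteq> f ` \<Union>T")
      case True
      then obtain e' where e': "e' \<subseteq> \<Union>T" "e = f ` e'" by (meson subset_imageE)
      then show ?thesis using R count[OF e'(1)] card_e[OF e'(1)] that by (simp add: mod2_cycles_def)
    next
      case False
      have "\<not> e \<subseteq> f ` t" if "t \<in> z" for t
      proof
        assume "e \<subseteq> f ` t"
        moreover have "f ` t \<subseteq> f ` \<Union>T" using that z by (intro image_mono) blast
        ultimately show False using False by (metis order_trans)
      qed
      then have "{t \<in> (`) f ` z. e \<subseteq> t} = {}" by auto
      then show ?thesis by (metis card.empty even_zero)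
    qed
    then show "(`) f ` z \<in> mod2_cycles ((`) f ` T)" using z by (auto simp: mod2_cycles_def)
  qed
qed

locale embedded_complex = subdivided_complex K L for K :: "'a::finite set set" and L +
  fixes f :: "real^'a \<Rightarrow> real^3"
  assumes emb: "linear_embedding L f"
begin

lemma triangle_sub_realisation: "V \<in> triangles \<Longrightarrow> convex hull V \<subseteq> \<Union>L"
  using triangles_D(3) by blast

lemma f_inj: "inj_on f (\<Union>L)"
  using emb by (simp add: linear_embedding_def)

lemma f_hull:
  assumes "V \<in> triangles" "c \<subseteq> V"
  shows "f ` (convex hull c) = convex hull (f ` c)"
proof -
  obtain A b where A: "linear A" "\<And>x. x \<in> convex hull V \<Longrightarrow> f x = A x + b"
    using emb triangles_D(3)[OF assms(1)] unfolding linear_embedding_def by blast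
  have cV: "convex hull c \<subseteq> convex hull V" by (rule hull_mono[OF assms(2)])
  have f_eq: "f ` X = (+) b ` A ` X" if "X \<subseteq> convex hull V" for X
    unfolding image_image by (rule image_cong[OF refl]) (use A(2) that in \<open>simp add: add.commute subset_iff\<close>)
  have "f ` (convex hull c) = (+) b ` A ` (convex hull c)" by (rule f_eq[OF cV])
  also have "\<dots> = (+) b ` (convex hull (A ` c))"
    using convex_hull_linear_image[OF A(1)] by simp
  also have "\<dots> = convex hull ((+) b ` A ` c)" by (simp add: convex_hull_translation)
  also have "(+) b ` A ` c = f ` c"
    by (rule f_eq[OF order_trans[OF hull_subset cV], symmetric])
  finally show ?thesis .
qed

lemma vertices_in_L: "\<Union>triangles \<subseteq> \<Union>L"
proof
  fix x assume "x \<in> \<Union>triangles"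
  then obtain V where "V \<in> triangles" "x \<in> V" by blast
  then show "x \<in> \<Union>L" using triangle_sub_realisation[of V] hull_inc[of x V convex] by blast
qed

lemma f_triangle_complex: "triangle_complex ((`) f ` triangles)"
proof
  show "finite ((`) f ` triangles)" using finite_triangles by simp
next
  fix t assume "t \<in> (`) f ` triangles"
  then obtain V where V: "V \<in> triangles" "t = f ` V" by blast
  have injV: "inj_on f V" using V(1) vertices_in_L by (intro inj_on_subset[OF f_inj]) blast
  show "card t = 3" using card_image[OF injV] triangles_D(1)[OF V(1)] V(2) by simp
  show "\<not> affine_dependent t"
  proof
    assume "affine_dependent t"
    moreover have "finite t" using V triangles_D(4) by simp
    \<comment> \<open>A dependent image has a Radon partition; by injectivity of \<open>f\<close>,
      disjoint vertex sets of \<open>V\<close> would then have meeting hulls, against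
      independence.\<close>
    ultimately obtain M P where MP: "M \<inter> P = {}" "M \<union> P = t" "convex hull M \<inter> convex hull P \<noteq> {}"
      using Radon_partition by metis
    define M' P' where "M' = V \<inter> f -` M" and "P' = V \<inter> f -` P"
    have sub: "M' \<subseteq> V" "P' \<subseteq> V" and dis: "M' \<inter> P' = {}" using MP(1) by (auto simp: M'_def P'_def)
    have "M \<subseteq> f ` V" "P \<subseteq> f ` V" using MP(2) V(2) by blast+
    then have im: "f ` M' = M" "f ` P' = P" unfolding M'_def P'_def by blast+
    have L: "convex hull M' \<subseteq> \<Union>L" "convex hull P' \<subseteq> \<Union>L"
      using hull_mono[OF sub(1), of convex] hull_mono[OF sub(2), of convex] triangle_sub_realisation[OF V(1)] by auto
    have "f ` (convex hull M') \<inter> f ` (convex hull P') \<noteq> {}"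
      using MP(3) f_hull[OF V(1) sub(1)] f_hull[OF V(1) sub(2)] im by simp
    then have "convex hull M' \<inter> convex hull P' \<noteq> {}"
      using inj_on_image_Int[OF f_inj L] by (metis image_empty)
    moreover have "(affine hull M') \<inter> (affine hull P') = {}"
      using disjoint_affine_hull[OF triangles_D(2)[OF V(1)] sub dis] .
    ultimately show False using convex_hull_subset_affine_hull by blast
  qed
next
  fix t t' assume "t \<in> (`) f ` triangles" "t' \<in> (`) f ` triangles"
  then obtain V V' where V: "V \<in> triangles" "t = f ` V" and V': "V' \<in> triangles" "t' = f ` V'" by blast
  have "convex hull t \<inter> convex hull t' = f ` (convex hull V) \<inter> f ` (convex hull V')"
    using f_hull[OF V(1)] f_hull[OF V'(1)] V(2) V'(2) by simp
  also have "\<dots> = f ` (convex hull V \<inter> convex hull V')"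
    using inj_on_image_Int[OF f_inj triangle_sub_realisation[OF V(1)] triangle_sub_realisation[OF V'(1)]] by simp
  also have "\<dots> = f ` (convex hull (V \<inter> V'))" using triangles_meet[OF V(1) V'(1)] by simp
  also have "\<dots> = convex hull (f ` (V \<inter> V'))" using f_hull[OF V(1)] by simp
  also have "f ` (V \<inter> V') = t \<inter> t'"
    unfolding V(2) V'(2) using V(1) V'(1) vertices_in_L by (intro inj_on_image_Int[OF f_inj]) blast+
  finally show "convex hull t \<inter> convex hull t' = convex hull (t \<inter> t')" .
qed

text \<open>A face of \<open>K\<close> takes its two regions from one chosen piece
  \<open>\<rho> t\<close> over it. This suffices, as a cycle of the subdivision contains all pieces
  of a face or none.\<close>

lemma face_cycles_eq_cuts:
  "\<exists>s1 s2 :: 'a set \<Rightarrow> (real^3) set. mod2_cycles (faces K 2) = range (separated_triangles s1 s2 (faces K 2))"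
proof -
  interpret T: triangle_complex "(`) f ` triangles" by (rule f_triangle_complex)
  obtain \<sigma>1 \<sigma>2 :: "(real^3) set \<Rightarrow> (real^3) set"
    where \<sigma>: "mod2_cycles ((`) f ` triangles) = range (separated_triangles \<sigma>1 \<sigma>2 ((`) f ` triangles))"
    using T.mod2_cycles_eq_cuts by blast
  have f_vert: "inj_on f (\<Union>triangles)" by (rule inj_on_subset[OF f_inj vertices_in_L])
  have f_mem: "f ` V \<in> (`) f ` z \<longleftrightarrow> V \<in> z" if "V \<in> triangles" "z \<subseteq> triangles" for V z
  proof -
    have "inj_on ((`) f) triangles" by (intro inj_on_subset[OF inj_on_image_Pow[OF f_vert]]) auto
    then show ?thesis using that inj_on_image_mem_iff by metis
  qed
  obtain \<rho> where \<rho>: "\<And>t. t \<in> faces K 2 \<Longrightarrow> \<rho> t \<in> triangles \<and> carrier_face (\<rho> t) = t"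
    using triangle_over_face by metis
  let ?cut = "separated_triangles (\<lambda>t. \<sigma>1 (f ` \<rho> t)) (\<lambda>t. \<sigma>2 (f ` \<rho> t)) (faces K 2)"
  let ?cut' = "separated_triangles \<sigma>1 \<sigma>2 ((`) f ` triangles)"
  have key: "z = ?cut G"
    if z: "z \<subseteq> faces K 2" and G: "(`) f ` {V \<in> triangles. carrier_face V \<in> z} = ?cut' G" for z G
  proof -
    have "t \<in> z \<longleftrightarrow> (\<sigma>1 (f ` \<rho> t) \<in> G) \<noteq> (\<sigma>2 (f ` \<rho> t) \<in> G)" if t: "t \<in> faces K 2" for t
    proof -
      have "t \<in> z \<longleftrightarrow> \<rho> t \<in> {V \<in> triangles. carrier_face V \<in> z}" using \<rho>[OF t] by simp
      also have "\<dots> \<longleftrightarrow> f ` \<rho> t \<in> (`) f ` {V \<in> triangles. carrier_face V \<in> z}" using f_mem \<rho>[OF t] by simp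
      also have "\<dots> \<longleftrightarrow> (\<sigma>1 (f ` \<rho> t) \<in> G) \<noteq> (\<sigma>2 (f ` \<rho> t) \<in> G)"
        unfolding G using \<rho>[OF t] by (auto simp: separated_triangles_def)
      finally show ?thesis .
    qed
    then show ?thesis using z by (auto simp: separated_triangles_def)
  qed
  have "mod2_cycles (faces K 2) = range (?cut)"
  proof (intro equalityI subsetI)
    fix z assume z: "z \<in> mod2_cycles (faces K 2)"
    then have zF: "z \<subseteq> faces K 2" by (simp add: mod2_cycles_def)
    have "(`) f ` {V \<in> triangles. carrier_face V \<in> z} \<in> mod2_cycles ((`) f ` triangles)"
      using mod2_cycles_image_iff[OF f_vert] subdivided_cycle[OF z] by simp
    then obtain G where "(`) f ` {V \<in> triangles. carrier_face V \<in> z} = ?cut' G"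
      unfolding \<sigma> by blast
    from key[OF zF this] show "z \<in> range (?cut)" by blast
  next
    fix z assume "z \<in> range (?cut)"
    then obtain G where zG: "z = ?cut G" by blast
    let ?S = "?cut' G"
    have "?S \<subseteq> (`) f ` triangles" by (auto simp: separated_triangles_def)
    then obtain z' where z': "z' \<subseteq> triangles" "?S = (`) f ` z'" by (meson subset_imageE)
    have "(`) f ` z' \<in> mod2_cycles ((`) f ` triangles)" unfolding \<sigma> z'(2)[symmetric] by blast
    then have "z' \<in> mod2_cycles triangles" using mod2_cycles_image_iff[OF f_vert z'(1)] by simp
    then obtain y where y: "y \<in> mod2_cycles (faces K 2)" "z' = {V \<in> triangles. carrier_face V \<in> y}"
      using cycle_is_subdivided by blast
    have "y \<subseteq> faces K 2" using y(1) by (simp add: mod2_cycles_def)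
    from key[OF this] have "y = z" unfolding zG using y(2) z'(2) by simp
    then show "z \<in> mod2_cycles (faces K 2)" using y(1) by simp
  qed
  then show ?thesis by blast
qed

end

section \<open>Counting\<close>

text \<open>Each edge of \<open>t\<close> lies in another triangle of \<open>z\<close>, and these
  three are distinct because two edges of \<open>t\<close> already contain all its vertices.\<close>

lemma mod2_cycle_card_ge_4:
  assumes z: "z \<in> mod2_cycles F" and fin: "finite F" and F: "\<And>t. t \<in> F \<Longrightarrow> card t = 3" and t: "t \<in> z"
  shows "4 \<le> card z"
proof -
  have zF: "z \<subseteq> F" and ev: "\<And>e. card e = 2 \<Longrightarrow> even (card {t \<in> z. e \<subseteq> t})"
    using z by (auto simp: mod2_cycles_def)
  have fz: "finite z" using zF fin finite_subset by blast
  have t3: "card t = 3" using t zF F by blast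
  then have ft: "finite t" by (metis card.infinite zero_neq_numeral)
  let ?E = "{e. e \<subseteq> t \<and> card e = 2}"
  have E3: "card ?E = 3" using n_subsets[OF ft, of 2] t3 by (simp add: choose_two)
  have "\<exists>t'. t' \<in> z - {t} \<and> e \<subseteq> t'" if e: "e \<in> ?E" for e
  proof (rule ccontr)
    assume "\<not> ?thesis"
    then have "{t' \<in> z. e \<subseteq> t'} = {t}" using e t by blast
    then show False using ev[of e] e by simp
  qed
  then obtain g where g: "\<And>e. e \<in> ?E \<Longrightarrow> g e \<in> z - {t} \<and> e \<subseteq> g e" by metis
  have "inj_on g ?E"
  proof (rule inj_onI)
    fix e e' assume e: "e \<in> ?E" "e' \<in> ?E" "g e = g e'"
    show "e = e'"
    proof (rule ccontr)
      assume ne: "e \<noteq> e'"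
      have "finite e" "finite e'" using e ft finite_subset by auto
      have "\<not> e' \<subseteq> e" using ne e \<open>finite e\<close> card_subset_eq[of e e'] by auto
      then have "card (e \<union> e') > card e" using \<open>finite e\<close> \<open>finite e'\<close> by (intro psubset_card_mono) auto
      then have "card (e \<union> e') = card t" using e t3 ft card_mono[of t "e \<union> e'"] by simp
      then have "e \<union> e' = t" using e ft card_subset_eq[of t "e \<union> e'"] by blast
      moreover have "e \<union> e' \<subseteq> g e" using g[OF e(1)] g[OF e(2)] e(3) by simp
      moreover have "g e \<in> z" "g e \<noteq> t" using g[OF e(1)] by auto
      moreover have "card (g e) = 3" using \<open>g e \<in> z\<close> zF F by blast
      ultimately show False using t3 card_subset_eq[of "g e" t] by (metis card.infinite zero_neq_numeral)
    qed
  qed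
  then have "3 \<le> card (z - {t})" using card_inj_on_le[of g ?E "z - {t}"] g fz E3 by auto
  then show ?thesis using fz t by simp
qed

text \<open>With \<open>card (mod2_cycles F) = 2 ^ b\<close> this says
  \<open>2 * (b + 1) \<le> card F\<close>. The set \<open>R\<close> in the proof collects the nodes
  with nonempty boundary.\<close>

lemma cut_space_bound:
  fixes s1 s2 :: "'b set \<Rightarrow> 'r"
  assumes fin: "finite F" and F: "\<And>t. t \<in> F \<Longrightarrow> card t = 3" and F2: "2 \<le> card F"
    and cuts: "mod2_cycles F = range (separated_triangles s1 s2 F)"
  shows "4 * (card (mod2_cycles F))\<^sup>2 \<le> 2 ^ card F"
proof -
  let ?S = "separated_triangles s1 s2 F"
  define R where "R = {U. ?S {U} \<noteq> {}}"
  have "R \<subseteq> s1 ` F \<union> s2 ` F" by (auto simp: R_def separated_triangles_def)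
  then have finR: "finite R" using fin by (meson finite_UnI finite_imageI finite_subset)
  have inR: "s1 t \<in> R \<and> s2 t \<in> R" if "t \<in> F" "s1 t \<noteq> s2 t" for t
    using that by (auto simp: R_def separated_triangles_def)
  have cap: "?S G = ?S (G \<inter> R)" for G
  proof -
    have "(s1 t \<in> G) \<noteq> (s2 t \<in> G) \<longleftrightarrow> (s1 t \<in> G \<inter> R) \<noteq> (s2 t \<in> G \<inter> R)" if "t \<in> F" for t
      using inR[OF that] by (cases "s1 t = s2 t") auto
    then show ?thesis unfolding separated_triangles_def by blast
  qed
  \<comment> \<open>Both ends of an edge that is no loop belong to \<open>R\<close>, so
    complementing within \<open>R\<close> flips both memberships.\<close>
  have compl: "?S G = ?S (R - G)" for G
  proof -
    have "(s1 t \<in> G) \<noteq> (s2 t \<in> G) \<longleftrightarrow> (s1 t \<in> R - G) \<noteq> (s2 t \<in> R - G)" if "t \<in> F" for t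
      using inR[OF that] by (cases "s1 t = s2 t") auto
    then show ?thesis unfolding separated_triangles_def by blast
  qed
  have fS: "finite (?S G)" for G using fin by (auto simp: separated_triangles_def)
  have "4 * card R \<le> 2 * card F"
  proof -
    have "4 * card R \<le> (\<Sum>U\<in>R. card (?S {U}))"
    proof -
      have "4 \<le> card (?S {U})" if U: "U \<in> R" for U
      proof -
        obtain t where "t \<in> ?S {U}" using U by (auto simp: R_def)
        moreover have "?S {U} \<in> mod2_cycles F" using cuts by blast
        ultimately show ?thesis using mod2_cycle_card_ge_4[OF _ fin F] by blast
      qed
      then have "(\<Sum>U\<in>R. 4) \<le> (\<Sum>U\<in>R. card (?S {U}))" by (intro sum_mono)
      then show ?thesis by simp
    qed
    also have "\<dots> = (\<Sum>U\<in>R. card {t \<in> F. t \<in> ?S {U}})"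
      by (intro sum.cong arg_cong[of _ _ card]) (auto simp: separated_triangles_def)
    also have "\<dots> = (\<Sum>t\<in>F. card {U \<in> R. t \<in> ?S {U}})"
      by (rule sum_multicount_gen[OF finR fin]) simp
    also have "\<dots> \<le> (\<Sum>t\<in>F. 2)"
    proof (rule sum_mono)
      fix t
      have "{U \<in> R. t \<in> ?S {U}} \<subseteq> {s1 t, s2 t}" by (auto simp: separated_triangles_def)
      then have "card {U \<in> R. t \<in> ?S {U}} \<le> card {s1 t, s2 t}" by (intro card_mono) auto
      also have "\<dots> \<le> 2" by (simp add: card_insert_if)
      finally show "card {U \<in> R. t \<in> ?S {U}} \<le> 2" .
    qed
    finally show ?thesis by simp
  qed
  then have R_le: "2 * card R \<le> card F" by simp
  show ?thesis
  proof (cases "R = {}")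
    \<comment> \<open>Only the empty cycle is left, and the bound reads
      \<open>4 \<le> 2 ^ card F\<close>; this is where \<open>F2\<close> enters.\<close>
    case True
    then have "?S G = ?S {}" for G using cap[of G] by simp
    then have "mod2_cycles F \<subseteq> {?S {}}" unfolding cuts by auto
    then have "card (mod2_cycles F) \<le> card {?S {}}" by (intro card_mono) auto
    then have "card (mod2_cycles F) \<le> 1" by simp
    from power_mono[OF this, of 2] have "(card (mod2_cycles F))\<^sup>2 \<le> 1" by simp
    moreover have "(2::nat) ^ 2 \<le> 2 ^ card F" using F2 by (intro power_increasing) auto
    ultimately show ?thesis by simp
  next
    case False
    then obtain U0 where U0: "U0 \<in> R" by blast
    \<comment> \<open>Of two complementary sets the one without \<open>U0\<close> is taken, which
      leaves \<open>2 ^ (card R - 1)\<close> candidates.\<close>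
    have "mod2_cycles F \<subseteq> ?S ` Pow (R - {U0})"
    proof
      fix z assume "z \<in> mod2_cycles F"
      then obtain G where G: "z = ?S (G \<inter> R)" unfolding cuts using cap by blast
      show "z \<in> ?S ` Pow (R - {U0})"
      proof (cases "U0 \<in> G")
        case True
        then have "R - G \<inter> R \<in> Pow (R - {U0})" by blast
        then show ?thesis using G compl[of "G \<inter> R"] by blast
      next
        case False
        then have "G \<inter> R \<in> Pow (R - {U0})" by blast
        then show ?thesis using G by blast
      qed
    qed
    then have "card (mod2_cycles F) \<le> card (Pow (R - {U0}))"
      using finR by (intro surj_card_le) auto
    also have "\<dots> = 2 ^ (card R - 1)" using finR U0 by (simp add: card_Pow)
    finally have "(card (mod2_cycles F))\<^sup>2 \<le> (2 ^ (card R - 1))\<^sup>2" by (intro power_mono) auto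
    then have "4 * (card (mod2_cycles F))\<^sup>2 \<le> 2 ^ (2 * (card R - 1) + 2)"
      by (simp add: power_add power_mult[symmetric] mult.commute)
    also have "\<dots> \<le> 2 ^ card F"
    proof -
      have "card R \<ge> 1" using U0 finR by (metis One_nat_def Suc_leI card_gt_0_iff empty_iff)
      then show ?thesis using R_le by (intro power_increasing) auto
    qed
    finally show ?thesis .
  qed
qed

section \<open>Chains, cycles and boundaries over the field with two elements\<close>

lemma bit_sum_eq_0_iff:
  fixes c :: "'b \<Rightarrow> bit"
  assumes "finite A"
  shows "(\<Sum>s\<in>A. c s) = 0 \<longleftrightarrow> even (card {s \<in> A. c s \<noteq> 0})"
  using assms
proof (induction A rule: finite_induct)
  case (insert a A)
  show ?case
  proof (cases "c a = 0")
    case True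
    then have "{s \<in> insert a A. c s \<noteq> 0} = {s \<in> A. c s \<noteq> 0}" by auto
    then show ?thesis using insert True by simp
  next
    case False
    then have "{s \<in> insert a A. c s \<noteq> 0} = insert a {s \<in> A. c s \<noteq> 0}" by auto
    moreover have "c a = 1" using False by (cases "c a") auto
    ultimately show ?thesis using insert by (cases "\<Sum>s\<in>A. c s") auto
  qed
qed simp

lemma bit_add_self: "(x::bit) + x = 0"
  by (cases x) auto

text \<open>Rank and nullity in multiplicative form: every nonempty fibre is a translate of the
  kernel, and translation by \<open>d\<close> is its own inverse as
  \<open>1 + 1 = 0\<close>.\<close>

lemma card_bit_kernel_image:
  fixes f :: "('b \<Rightarrow> bit) \<Rightarrow> ('c \<Rightarrow> bit)"
  assumes fin: "finite A" and closed: "\<And>c d. c \<in> A \<Longrightarrow> d \<in> A \<Longrightarrow> (\<lambda>s. c s + d s) \<in> A"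
    and add: "\<And>c d. c \<in> A \<Longrightarrow> d \<in> A \<Longrightarrow> f (\<lambda>s. c s + d s) = (\<lambda>s. f c s + f d s)"
  shows "card (f ` A) * card {c \<in> A. f c = (\<lambda>_. 0)} = card A"
proof -
  let ?Z = "{c \<in> A. f c = (\<lambda>_. 0)}"
  have fiber: "card {c \<in> A. f c = y} = card ?Z" if y: "y \<in> f ` A" for y
  proof -
    obtain d where d: "d \<in> A" "f d = y" using y by blast
    let ?h = "\<lambda>c s. c s + d s"
    have hh: "?h (?h c) = c" for c
      by (rule ext) (simp only: add.assoc bit_add_self add_0_right)
    have "bij_betw ?h {c \<in> A. f c = y} ?Z"
    proof (rule bij_betwI[of _ _ _ ?h])
      show "?h \<in> {c \<in> A. f c = y} \<rightarrow> ?Z"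
      proof
        fix c assume "c \<in> {c \<in> A. f c = y}"
        then have c: "c \<in> A" "f c = y" by auto
        have "f (?h c) = (\<lambda>_. 0)" by (simp only: add[OF c(1) d(1)] c(2) d(2) bit_add_self)
        then show "?h c \<in> ?Z" using closed[OF c(1) d(1)] by blast
      qed
      show "?h \<in> ?Z \<rightarrow> {c \<in> A. f c = y}"
      proof
        fix c assume "c \<in> ?Z"
        then have c: "c \<in> A" "f c = (\<lambda>_. 0)" by auto
        have "f (?h c) = y" by (simp only: add[OF c(1) d(1)] c(2) d(2) add_0_left)
        then show "?h c \<in> {c \<in> A. f c = y}" using closed[OF c(1) d(1)] by blast
      qed
    qed (use hh in auto)
    then show ?thesis by (rule bij_betw_same_card)
  qed
  have "card A = (\<Sum>y\<in>f ` A. card {c \<in> A. f c = y})"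
    using sum.image_gen[OF fin, of "\<lambda>_. 1::nat" f] by simp
  also have "\<dots> = card (f ` A) * card ?Z" using fiber by simp
  finally show ?thesis by simp
qed

lemma card_chains2: "card (chains2 K i) = 2 ^ f_number K i"
proof -
  have "bij_betw (\<lambda>c. {s. c s \<noteq> 0}) (chains2 K i) (Pow (faces K i))"
  proof (rule bij_betwI[of _ _ _ "\<lambda>A s. of_bool (s \<in> A)"])
    fix c :: "'a set \<Rightarrow> bit"
    show "(\<lambda>s. of_bool (s \<in> {s. c s \<noteq> 0})) = c"
    proof
      fix s show "of_bool (s \<in> {s. c s \<noteq> 0}) = c s" by (cases "c s") auto
    qed
  qed (auto simp: chains2_def)
  then show ?thesis using bij_betw_same_card by (fastforce simp: card_Pow f_number_def)
qed

lemma finite_chains2: "finite (chains2 K i)"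
proof (rule ccontr)
  assume "infinite (chains2 K i)"
  then show False using card_chains2[of K i] by simp
qed

lemma chains2_add: "c \<in> chains2 K i \<Longrightarrow> d \<in> chains2 K i \<Longrightarrow> (\<lambda>s. c s + d s) \<in> chains2 K i"
  by (auto simp: chains2_def)

lemma boundary2_add: "boundary2 K (\<lambda>s. c s + d s) = (\<lambda>t. boundary2 K c t + boundary2 K d t)"
proof (rule ext)
  fix t show "boundary2 K (\<lambda>s. c s + d s) t = boundary2 K c t + boundary2 K d t"
    by (cases "t \<in> K") (simp_all only: boundary2_def if_True if_False sum.distrib add_0_right)
qed

lemma boundary2_in_chains2:
  assumes "c \<in> chains2 K (i + 1)"
  shows "boundary2 K c \<in> chains2 K i"
  unfolding chains2_def
proof (rule CollectI, intro allI impI)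
  fix t assume b: "boundary2 K c t \<noteq> 0"
  then have t: "t \<in> K" by (auto simp: boundary2_def split: if_splits)
  have "\<exists>s. s \<in> K \<and> t \<subseteq> s \<and> card s = card t + 1 \<and> c s \<noteq> 0"
  proof (rule ccontr)
    assume "\<not> ?thesis"
    then have "boundary2 K c t = 0" by (auto simp: boundary2_def intro!: sum.neutral)
    then show False using b by simp
  qed
  then show "t \<in> faces K i" using assms t by (auto simp: chains2_def faces_def)
qed

text \<open>A chain is determined by its support, and its boundary can be nonzero only at pairs,
  where it is the parity of the degree.\<close>

lemma card_cycles2_2:
  assumes K: "abstract_complex K"
  shows "card {c \<in> chains2 K 2. boundary2 K c = (\<lambda>_. 0)} = card (mod2_cycles (faces K 2))"
proof -
  have bd: "boundary2 K c = (\<lambda>_. 0) \<longleftrightarrow> {s. c s \<noteq> 0} \<in> mod2_cycles (faces K 2)" if c: "c \<in> chains2 K 2" for c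
  proof -
    have cs: "s \<in> K \<and> card s = 3" if "c s \<noteq> 0" for s using c that by (auto simp: chains2_def faces_def)
    have z: "{s. c s \<noteq> 0} \<subseteq> faces K 2" using c by (auto simp: chains2_def)
    have val: "boundary2 K c e = 0 \<longleftrightarrow> even (card {s \<in> {s. c s \<noteq> 0}. e \<subseteq> s})" if e: "card e = 2" for e
    proof (cases "e \<in> K")
      case True
      have "{s \<in> {s \<in> K. e \<subseteq> s \<and> card s = card e + 1}. c s \<noteq> 0} = {s \<in> {s. c s \<noteq> 0}. e \<subseteq> s}"
        using cs e by auto
      then show ?thesis using True bit_sum_eq_0_iff[of "{s \<in> K. e \<subseteq> s \<and> card s = card e + 1}" c]
        by (simp add: boundary2_def)
    next
      case False
      have "e \<noteq> {}" using e by auto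
      then have "{s \<in> {s. c s \<noteq> 0}. e \<subseteq> s} = {}" using False cs K unfolding abstract_complex_def by blast
      then have "even (card {s \<in> {s. c s \<noteq> 0}. e \<subseteq> s})" by (metis card.empty even_zero)
      moreover have "boundary2 K c e = 0" using False by (simp add: boundary2_def)
      ultimately show ?thesis by (simp only: simp_thms)
    qed
    have other: "boundary2 K c e = 0" if e2: "card e \<noteq> 2" for e
    proof -
      have "c s = 0" if "card s = card e + 1" for s using cs[of s] that e2 by (cases "c s = 0") auto
      then show ?thesis by (auto simp: boundary2_def intro!: sum.neutral)
    qed
    have "boundary2 K c = (\<lambda>_. 0) \<longleftrightarrow> (\<forall>e. card e = 2 \<longrightarrow> boundary2 K c e = 0)"
      using other by (auto simp: fun_eq_iff)
    also have "\<dots> \<longleftrightarrow> {s. c s \<noteq> 0} \<in> mod2_cycles (faces K 2)"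
      using val z by (auto simp: mod2_cycles_def)
    finally show ?thesis .
  qed
  have "bij_betw (\<lambda>c. {s. c s \<noteq> 0}) {c \<in> chains2 K 2. boundary2 K c = (\<lambda>_. 0)} (mod2_cycles (faces K 2))"
  proof (rule bij_betwI[of _ _ _ "\<lambda>A s. of_bool (s \<in> A)"])
    fix c :: "'a set \<Rightarrow> bit"
    show "(\<lambda>s. of_bool (s \<in> {s. c s \<noteq> 0})) = c"
    proof
      fix s show "of_bool (s \<in> {s. c s \<noteq> 0}) = c s" by (cases "c s") auto
    qed
  next
    show "(\<lambda>A s. of_bool (s \<in> A)) \<in> mod2_cycles (faces K 2) \<rightarrow> {c \<in> chains2 K 2. boundary2 K c = (\<lambda>_. 0)}"
    proof
      fix A assume A: "A \<in> mod2_cycles (faces K 2)"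
      then have c: "(\<lambda>s. of_bool (s \<in> A)) \<in> chains2 K 2" by (auto simp: mod2_cycles_def chains2_def)
      moreover have "{s. (of_bool (s \<in> A) :: bit) \<noteq> 0} = A" by auto
      ultimately show "(\<lambda>s. of_bool (s \<in> A)) \<in> {c \<in> chains2 K 2. boundary2 K c = (\<lambda>_. 0)}"
        using bd[OF c] A by simp
    qed
  qed (use bd in auto)
  then show ?thesis by (rule bij_betw_same_card)
qed

text \<open>Among the \<open>A\<close> that generate at least \<open>2 ^ card A\<close> elements,
  one with the largest subgroup is taken. By Lagrange a generator outside the subgroup at least
  doubles it and keeps the condition, so none is left.\<close>

lemma (in group) exists_small_generating_set:
  assumes fin: "finite (carrier G)"
  shows "\<exists>A. finite A \<and> A \<subseteq> carrier G \<and> generate G A = carrier G \<and> 2 ^ card A \<le> card (carrier G)"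
proof -
  let ?P = "\<lambda>A. A \<subseteq> carrier G \<and> 2 ^ card A \<le> card (generate G A)"
  define S where "S = (\<lambda>A. card (generate G A)) ` {A. ?P A}"
  have P0: "?P {}" using generate_empty by simp
  have finP: "finite {A. ?P A}" by (rule finite_subset[OF _ iffD2[OF finite_Pow_iff fin]]) blast
  have "finite S" unfolding S_def by (rule finite_imageI[OF finP])
  have "card (generate G {}) \<in> S" unfolding S_def using P0 by (intro imageI CollectI)
  then have "Max S \<in> S" using Max_in[OF \<open>finite S\<close>] by blast
  then obtain A where A: "?P A" and A_max: "card (generate G A) = Max S" unfolding S_def by auto
  have max: "card (generate G B) \<le> card (generate G A)" if "?P B" for B
    unfolding A_max using that by (intro Max_ge[OF \<open>finite S\<close>]) (simp add: S_def)
  have sub: "generate G A \<subseteq> carrier G" using A generate_incl by blast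
  have "generate G A = carrier G"
  proof (rule ccontr)
    assume "generate G A \<noteq> carrier G"
    then obtain x where x: "x \<in> carrier G" "x \<notin> generate G A" using sub by blast
    let ?B = "insert x A"
    have BG: "?B \<subseteq> carrier G" using x(1) A by simp
    have gA: "subgroup (generate G A) G" and gB: "subgroup (generate G ?B) G"
      using A BG generate_is_subgroup by auto
    have le: "generate G A \<subseteq> generate G ?B" by (rule mono_generate) blast
    have x_in: "x \<in> generate G ?B" by (rule generate.incl) simp
    have finB: "finite (generate G ?B)" using generate_incl[OF BG] fin finite_subset by blast
    interpret B: group "G\<lparr>carrier := generate G ?B\<rparr>" using gB subgroup_imp_group by blast
    have gAB: "subgroup (generate G A) (G\<lparr>carrier := generate G ?B\<rparr>)" using subgroup_incl[OF gA gB le] .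
    obtain k where k: "card (generate G ?B) = card (generate G A) * k"
    proof
      show "card (generate G ?B) = card (generate G A) * card (rcosets\<^bsub>G\<lparr>carrier := generate G ?B\<rparr>\<^esub> generate G A)"
        using B.lagrange[OF gAB] by (simp add: order_def mult.commute)
    qed
    have "card (generate G A) < card (generate G ?B)"
      using le x(2) x_in finB by (intro psubset_card_mono) auto
    then have "k \<noteq> 0" "k \<noteq> 1" "card (generate G A) < card (generate G ?B)" using k by auto
    then have "2 \<le> k" by linarith
    then have "2 * card (generate G A) \<le> card (generate G ?B)" unfolding k by simp
    moreover have "card ?B \<le> card A + 1" by (simp add: card_insert_le_m1 card_insert_if)
    then have "(2::nat) ^ card ?B \<le> 2 ^ (card A + 1)" by (intro power_increasing) auto
    ultimately have "?P ?B" using A BG by simp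
    then show False using max[of ?B] \<open>card (generate G A) < card (generate G ?B)\<close> by linarith
  qed
  then show ?thesis using A fin finite_subset by auto
qed

lemma boundary_of_edge:
  assumes "{v, w} \<in> K" "v \<noteq> w" and "{v} \<in> K" "{w} \<in> K" and "{} \<notin> K"
  shows "boundary2 K (\<lambda>s. of_bool (s = {v, w})) = (\<lambda>s. of_bool (s = {v}) + of_bool (s = {w}))"
proof
  fix t
  show "boundary2 K (\<lambda>s. of_bool (s = {v, w})) t = of_bool (t = {v}) + of_bool (t = {w})"
  proof (cases "t \<in> K")
    case False
    then show ?thesis using assms by (auto simp: boundary2_def)
  next
    case True
    let ?A = "{s \<in> K. t \<subseteq> s \<and> card s = card t + 1}"
    have "boundary2 K (\<lambda>s. of_bool (s = {v, w})) t = (\<Sum>s\<in>?A. of_bool (s = {v, w}))"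
      using True by (simp add: boundary2_def)
    also have "\<dots> = (if {v, w} \<in> ?A then 1 else 0)" by (simp add: of_bool_def)
    also have "{v, w} \<in> ?A \<longleftrightarrow> t = {v} \<or> t = {w}"
    proof
      assume "{v, w} \<in> ?A"
      then have "t \<subseteq> {v, w}" "card t = 1" using assms(2) by auto
      then show "t = {v} \<or> t = {w}" by (auto simp: card_1_singleton_iff)
    next
      assume "t = {v} \<or> t = {w}"
      then show "{v, w} \<in> ?A" using assms by auto
    qed
    also have "(if t = {v} \<or> t = {w} then 1 else 0) = (of_bool (t = {v}) + of_bool (t = {w}) :: bit)"
      using assms(2) by auto
    finally show ?thesis .
  qed
qed

text \<open>No face contains both a vertex homologous to \<open>v\<close> and one that is not. The
  two kinds of faces give disjoint closed sets covering the realisation, so connectedness leaves no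
  second kind.\<close>

lemma vertex_difference_is_boundary:
  fixes K :: "'a::finite set set"
  assumes K: "abstract_complex K" and conn: "connected (realisation K)" and v: "v \<in> \<Union>K" "w \<in> \<Union>K"
  shows "(\<lambda>s. of_bool (s = {v}) + of_bool (s = {w})) \<in> boundary2 K ` chains2 K 1"
proof (rule ccontr)
  assume n: "\<not> ?thesis"
  let ?B = "boundary2 K ` chains2 K 1"
  define V1 where "V1 = {u \<in> \<Union>K. (\<lambda>s. of_bool (s = {v}) + of_bool (s = {u})) \<in> ?B}"
  have add: "(\<lambda>s. b s + d s) \<in> ?B" if bd: "b \<in> ?B" "d \<in> ?B" for b d
  proof -
    obtain b' where b': "b' \<in> chains2 K 1" "b = boundary2 K b'" using bd(1) by blast
    obtain d' where d': "d' \<in> chains2 K 1" "d = boundary2 K d'" using bd(2) by blast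
    have "(\<lambda>s. b s + d s) = boundary2 K (\<lambda>s. b' s + d' s)" by (simp only: b'(2) d'(2) boundary2_add)
    then show ?thesis using chains2_add[OF b'(1) d'(1)] by blast
  qed
  have ne: "{} \<notin> K" and down: "\<And>s t. s \<in> K \<Longrightarrow> t \<subseteq> s \<Longrightarrow> t \<noteq> {} \<Longrightarrow> t \<in> K"
    using K by (auto simp: abstract_complex_def)
  have zero: "(\<lambda>_. 0) \<in> ?B"
    by (rule image_eqI[of _ _ "\<lambda>_. 0"]) (auto simp: boundary2_def chains2_def)
  \<comment> \<open>Adding the boundary of the edge \<open>{x, y}\<close> cancels \<open>{x}\<close>
    and leaves \<open>{y}\<close>.\<close>
  have step: "y \<in> V1" if s: "s \<in> K" "x \<in> s" "y \<in> s" "x \<in> V1" for s x y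
  proof (cases "x = y")
    case False
    have K3: "{x, y} \<in> K" "{x} \<in> K" "{y} \<in> K" using down[OF s(1)] s by auto
    have c1: "(\<lambda>s. of_bool (s = {x, y})) \<in> chains2 K 1" using K3 False by (auto simp: chains2_def faces_def)
    have "(\<lambda>s. of_bool (s = {x}) + of_bool (s = {y})) \<in> ?B"
      by (rule image_eqI[where f = "boundary2 K", OF boundary_of_edge[OF K3(1) False K3(2,3) ne, symmetric] c1])
    from add[OF _ this, of "\<lambda>s. of_bool (s = {v}) + of_bool (s = {x})"]
    have "(\<lambda>s. of_bool (s = {v}) + of_bool (s = {x}) + (of_bool (s = {x}) + of_bool (s = {y}))) \<in> ?B"
      using s(4) by (simp only: V1_def mem_Collect_eq simp_thms)
    moreover have "of_bool P + of_bool Q + (of_bool Q + of_bool R) = (of_bool P + of_bool R :: bit)" for P Q R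
      by (cases P; cases Q; cases R) auto
    ultimately have "(\<lambda>s. of_bool (s = {v}) + of_bool (s = {y})) \<in> ?B" by (simp only:)
    then show ?thesis using s(1,3) unfolding V1_def by blast
  qed (use s in simp)
  have closed_g: "closed (geometric_simplex s)" for s :: "'a set"
    unfolding geometric_simplex_def by (intro compact_imp_closed finite_imp_compact_convex_hull) simp
  let ?X = "\<Union>s\<in>{s \<in> K. s \<subseteq> V1}. geometric_simplex s"
  let ?Y = "\<Union>s\<in>{s \<in> K. s \<inter> V1 = {}}. geometric_simplex s"
  have cl: "closed ?X" "closed ?Y" using closed_g by (auto intro!: closed_UN)
  have cov: "realisation K \<subseteq> ?X \<union> ?Y"
  proof -
    have "s \<subseteq> V1 \<or> s \<inter> V1 = {}" if "s \<in> K" for s using step[OF that] by blast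
    then show ?thesis unfolding realisation_def by blast
  qed
  have disj: "?X \<inter> ?Y = {}"
  proof (rule ccontr)
    assume "?X \<inter> ?Y \<noteq> {}"
    then obtain x s t where x: "x \<in> geometric_simplex s" "s \<subseteq> V1" "x \<in> geometric_simplex t" "t \<inter> V1 = {}" by blast
    then have "supp x \<subseteq> s" "supp x \<subseteq> t" by (simp_all add: mem_geometric_simplex)
    then have "supp x = {}" using x(2,4) by blast
    then have "(\<Sum>i\<in>UNIV. x $ i) = 0" by (auto simp: supp_def)
    then show False using x by (simp add: mem_geometric_simplex)
  qed
  have vert: "axis u 1 \<in> geometric_simplex {u}" for u :: 'a by (simp add: geometric_simplex_def)
  have sing: "{u} \<in> K" if "u \<in> \<Union>K" for u using that down by blast
  have "(\<lambda>s. of_bool (s = {v}) + of_bool (s = {v})) = (\<lambda>_. 0 :: bit)" by (simp only: bit_add_self)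
  then have "v \<in> V1" using v(1) zero unfolding V1_def by (simp only: mem_Collect_eq simp_thms)
  then have X: "axis v 1 \<in> ?X" using sing[OF v(1)] vert[of v] by (intro UN_I[of "{v}"]) simp_all
  have "w \<notin> V1" using n unfolding V1_def by blast
  then have Y: "axis w 1 \<in> ?Y" using sing[OF v(2)] vert[of w] by (intro UN_I[of "{w}"]) simp_all
  have real: "axis v 1 \<in> realisation K" "axis w 1 \<in> realisation K"
    unfolding realisation_def using sing[OF v(1)] sing[OF v(2)] vert[of v] vert[of w]
    by (blast intro: UN_I)+
  have "?X \<inter> ?Y \<inter> realisation K = {}" using disj by simp
  from connected_closedD[OF conn this cov cl] show False using X Y real by (simp add: disjoint_iff) blast
qed

text \<open>The chains \<open>{v0} + {v}\<close> are boundaries, and their sums over different sets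
  of vertices \<open>v\<close> other than \<open>v0\<close> are different.\<close>

lemma card_boundaries_0:
  fixes K :: "'a::finite set set"
  assumes K: "abstract_complex K" and conn: "connected (realisation K)" and ne: "\<Union>K \<noteq> {}"
  shows "2 ^ (card (\<Union>K) - 1) \<le> card (boundary2 K ` chains2 K 1)"
proof -
  let ?B = "boundary2 K ` chains2 K 1"
  obtain v0 where v0: "v0 \<in> \<Union>K" using ne by blast
  define b :: "'a set \<Rightarrow> 'a set \<Rightarrow> bit" where
    "b S = (\<lambda>s. \<Sum>v\<in>S. of_bool (s = {v0}) + of_bool (s = {v}))" for S
  have "b S \<in> ?B" if "S \<subseteq> \<Union>K - {v0}" for S
    using finite[of S] that
  proof (induction S rule: finite_induct)
    case empty
    then show ?case by (intro image_eqI[of _ _ "\<lambda>_. 0"]) (auto simp: b_def boundary2_def chains2_def)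
  next
    case (insert v S)
    obtain c where c: "c \<in> chains2 K 1" "b S = boundary2 K c" using insert by auto
    have "v \<in> \<Union>K" using insert.prems by blast
    from vertex_difference_is_boundary[OF K conn v0 this]
    obtain d where d: "d \<in> chains2 K 1" "(\<lambda>s. of_bool (s = {v0}) + of_bool (s = {v})) = boundary2 K d" by blast
    have "b (insert v S) = (\<lambda>s. boundary2 K d s + boundary2 K c s)"
      unfolding d(2)[symmetric] c(2)[symmetric] b_def by (rule ext) (simp only: sum.insert[OF insert.hyps])
    also have "\<dots> = boundary2 K (\<lambda>s. d s + c s)" by (rule boundary2_add[symmetric])
    finally show ?case using chains2_add[OF d(1) c(1)] by blast
  qed
  then have sub: "b ` Pow (\<Union>K - {v0}) \<subseteq> ?B" by blast
  have val: "b S {v} = of_bool (v \<in> S)" if "v \<noteq> v0" for S v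
  proof -
    have "b S {v} = (\<Sum>u\<in>S. of_bool (v = u))" using that unfolding b_def by (intro sum.cong) auto
    also have "\<dots> = of_bool (v \<in> S)" by (simp add: of_bool_def)
    finally show ?thesis .
  qed
  have "inj_on b (Pow (\<Union>K - {v0}))"
  proof (rule inj_onI)
    fix S S' assume S: "S \<in> Pow (\<Union>K - {v0})" "S' \<in> Pow (\<Union>K - {v0})" "b S = b S'"
    have "v \<in> S \<longleftrightarrow> v \<in> S'" for v
    proof (cases "v = v0")
      case False
      then show ?thesis using val[OF False, of S] val[OF False, of S'] S(3) by (cases "v \<in> S"; cases "v \<in> S'") auto
    qed (use S in blast)
    then show "S = S'" by blast
  qed
  then have "card (Pow (\<Union>K - {v0})) \<le> card ?B"
    using sub finite_chains2 by (metis card_inj_on_le finite_imageI)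
  then show ?thesis using v0 by (simp add: card_Pow)
qed

text \<open>Between \<open>t\<close> and a face with two more vertices there are exactly two faces,
  so the coefficient of the larger face enters twice and cancels.\<close>

lemma boundary2_boundary2:
  fixes K :: "'a::finite set set"
  assumes K: "abstract_complex K" and c: "c \<in> chains2 K 2"
  shows "boundary2 K (boundary2 K c) = (\<lambda>_. 0)"
proof
  fix t
  have down: "\<And>s t. s \<in> K \<Longrightarrow> t \<subseteq> s \<Longrightarrow> t \<noteq> {} \<Longrightarrow> t \<in> K" using K by (auto simp: abstract_complex_def)
  show "boundary2 K (boundary2 K c) t = 0"
  proof (cases "t \<in> K")
    case t: True
    let ?A = "{e \<in> K. t \<subseteq> e \<and> card e = card t + 1}"
    have ft: "t \<noteq> {}" using t K by (auto simp: abstract_complex_def)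
    let ?E = "\<lambda>s. {e \<in> ?A. s \<in> K \<and> e \<subseteq> s \<and> card s = card e + 1}"
    have "boundary2 K (boundary2 K c) t = (\<Sum>e\<in>?A. \<Sum>s\<in>{s \<in> UNIV. s \<in> K \<and> e \<subseteq> s \<and> card s = card e + 1}. c s)"
      using t by (simp add: boundary2_def)
    also have "\<dots> = (\<Sum>s\<in>UNIV. \<Sum>e\<in>?E s. c s)"
      by (rule sum.swap_restrict) auto
    also have "\<dots> = 0"
    proof (rule sum.neutral, rule ballI)
      fix s :: "'a set"
      show "(\<Sum>e\<in>?E s. c s) = 0"
      proof (cases "s \<in> K \<and> t \<subseteq> s \<and> card s = card t + 2")
        case True
        then have "card (s - t) = 2" by (simp add: card_Diff_subset)
        then obtain x y where xy: "s - t = {x, y}" "x \<noteq> y" by (auto simp: card_2_iff)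
        have "?E s = {insert x t, insert y t}"
        proof (intro equalityI subsetI)
          fix e assume e: "e \<in> ?E s"
          then have "card (e - t) = 1" by (simp add: card_Diff_subset)
          then obtain z where z: "e - t = {z}" using card_1_singletonE by blast
          then have "e = insert z t" "z \<in> s - t" using e by auto
          then show "e \<in> {insert x t, insert y t}" using xy(1) by auto
        next
          fix e assume "e \<in> {insert x t, insert y t}"
          then obtain z where z: "e = insert z t" "z \<in> s - t" using xy by blast
          then show "e \<in> ?E s" using True down[of s e] by auto
        qed
        moreover have "insert x t \<noteq> insert y t" using xy by blast
        ultimately show ?thesis using bit_add_self by simp
      next
        case False
        then have "?E s = {}" by auto
        then show ?thesis by (metis sum.empty)
      qed
    qed
    finally show ?thesis .
  qed (simp add: boundary2_def)
qed

lemma comm_group_cycle_group2: "comm_group (cycle_group2 K i)"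
proof (rule comm_groupI)
  fix x y assume "x \<in> carrier (cycle_group2 K i)" "y \<in> carrier (cycle_group2 K i)"
  then have "x \<in> chains2 K i" "y \<in> chains2 K i" "boundary2 K x = (\<lambda>_. 0)" "boundary2 K y = (\<lambda>_. 0)"
    by (auto simp: cycle_group2_def)
  moreover from this have "boundary2 K (\<lambda>s. x s + y s) = (\<lambda>_. 0)" by (simp only: boundary2_add add_0_left)
  ultimately show "x \<otimes>\<^bsub>cycle_group2 K i\<^esub> y \<in> carrier (cycle_group2 K i)"
    using chains2_add[of x K i y]
    by (simp only: cycle_group2_def partial_object.simps monoid.simps mem_Collect_eq simp_thms)
next
  show "\<one>\<^bsub>cycle_group2 K i\<^esub> \<in> carrier (cycle_group2 K i)"
    by (auto simp: cycle_group2_def chains2_def boundary2_def)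
next
  fix x assume "x \<in> carrier (cycle_group2 K i)"
  moreover have "x \<otimes>\<^bsub>cycle_group2 K i\<^esub> x = \<one>\<^bsub>cycle_group2 K i\<^esub>" by (simp only: cycle_group2_def monoid.simps bit_add_self)
  ultimately show "\<exists>y\<in>carrier (cycle_group2 K i). y \<otimes>\<^bsub>cycle_group2 K i\<^esub> x = \<one>\<^bsub>cycle_group2 K i\<^esub>" by blast
qed (simp_all only: cycle_group2_def monoid.simps ac_simps add_0_left)

lemma card_homology_group2_1:
  fixes K :: "'a::finite set set"
  assumes K: "abstract_complex K"
  shows "card (carrier (homology_group2 K 1)) * card (boundary2 K ` chains2 K 2) = card (carrier (cycle_group2 K 1))"
    and "group (homology_group2 K 1)" and "finite (carrier (homology_group2 K 1))"
proof -
  let ?Z = "cycle_group2 K 1" and ?B = "boundary2 K ` chains2 K 2"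
  interpret Z: comm_group ?Z by (rule comm_group_cycle_group2)
  have carr: "carrier ?Z = {c \<in> chains2 K 1. boundary2 K c = (\<lambda>_. 0)}" by (simp add: cycle_group2_def)
  have mult: "x \<otimes>\<^bsub>?Z\<^esub> y = (\<lambda>s. x s + y s)" for x y by (simp only: cycle_group2_def monoid.simps)
  have one: "\<one>\<^bsub>?Z\<^esub> = (\<lambda>_. 0)" by (simp add: cycle_group2_def)
  have fin: "finite (carrier ?Z)" unfolding carr by (rule finite_subset[OF _ finite_chains2[of K 1]]) blast
  have sub: "?B \<subseteq> carrier ?Z"
    using boundary2_boundary2[OF K] boundary2_in_chains2[of _ K 1] unfolding carr by (auto simp: numeral_2_eq_2)
  have "subgroup ?B ?Z"
  proof (rule Z.subgroupI[OF sub])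
    show "?B \<noteq> {}" by (auto simp: chains2_def)
  next
    fix x assume x: "x \<in> ?B"
    have "x \<otimes>\<^bsub>?Z\<^esub> x = \<one>\<^bsub>?Z\<^esub>" by (simp only: mult one bit_add_self)
    then have "inv\<^bsub>?Z\<^esub> x = x" using Z.inv_equality x sub by blast
    then show "inv\<^bsub>?Z\<^esub> x \<in> ?B" using x by simp
  next
    fix x y assume "x \<in> ?B" "y \<in> ?B"
    then obtain c d where cd: "c \<in> chains2 K 2" "x = boundary2 K c" "d \<in> chains2 K 2" "y = boundary2 K d" by blast
    have "x \<otimes>\<^bsub>?Z\<^esub> y = boundary2 K (\<lambda>s. c s + d s)" by (simp only: mult cd boundary2_add)
    then show "x \<otimes>\<^bsub>?Z\<^esub> y \<in> ?B" using chains2_add[OF cd(1,3)] by blast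
  qed
  then have norm: "?B \<lhd> ?Z" by (rule Z.subgroup_imp_normal)
  have H: "homology_group2 K 1 = ?Z Mod ?B" by (simp add: homology_group2_def numeral_2_eq_2)
  then have carrH: "carrier (homology_group2 K 1) = rcosets\<^bsub>?Z\<^esub> ?B" by (simp add: FactGroup_def)
  show "group (homology_group2 K 1)" unfolding H using norm by (rule normal.factorgroup_is_group)
  show "card (carrier (homology_group2 K 1)) * card ?B = card (carrier ?Z)"
    unfolding carrH using Z.lagrange[OF \<open>subgroup ?B ?Z\<close>] by (simp add: order_def)
  show "finite (carrier (homology_group2 K 1))"
    unfolding carrH RCOSETS_def using fin by auto
qed

text \<open>\<open>betti2\<close> is a least size, so one small generating set bounds it from above;
  it enters the theorem with a minus sign on the larger side, where an upper bound is called
  for.\<close>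

lemma betti2_1_bound:
  fixes K :: "'a::finite set set"
  assumes K: "abstract_complex K"
  shows "2 ^ betti2 K 1 \<le> card (carrier (homology_group2 K 1))"
proof -
  interpret H: group "homology_group2 K 1" by (rule card_homology_group2_1(2)[OF K])
  obtain A where A: "finite A" "A \<subseteq> carrier (homology_group2 K 1)"
    "generate (homology_group2 K 1) A = carrier (homology_group2 K 1)" "2 ^ card A \<le> card (carrier (homology_group2 K 1))"
    using H.exists_small_generating_set[OF card_homology_group2_1(3)[OF K]] by blast
  have "betti2 K 1 \<le> card A" unfolding betti2_def by (rule Least_le) (use A in blast)
  then have "(2::nat) ^ betti2 K 1 \<le> 2 ^ card A" by (intro power_increasing) auto
  then show ?thesis using A(4) by linarith
qed

text \<open>The hypothesis \<open>f_number K 2 \<ge> 2\<close> excludes complexes with a single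
  triangle: these have no nonzero 2-cycle, so by the Euler characteristic the right-hand side is 0
  and the inequality would read 1 \<le> 0.\<close>

theorem proposition8:
  fixes K :: "'a::finite set set" and n :: nat
  assumes "abstract_complex K"
    and "has_dimension K 2"
    and "connected (realisation K)"
    and "card (\<Union>K) = n"
    and "PL_embeds K TYPE(real^3)"
    and "f_number K 2 \<ge> 2"
  shows "int (f_number K 2) \<le> 2 * (int (f_number K 1) - int (betti2 K 1) - int n)"
proof -
  obtain L and f :: "real^'a \<Rightarrow> real^3" where "subdivides L K" "linear_embedding L f"
    using assms(5) unfolding PL_embeds_def by blast
  then interpret embedded_complex K L f by unfold_locales (use assms in auto)
  obtain s1 s2 :: "'a set \<Rightarrow> (real^3) set"
    where cuts: "mod2_cycles (faces K 2) = range (separated_triangles s1 s2 (faces K 2))"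
    using face_cycles_eq_cuts by blast
  have F: "card t = 3" if "t \<in> faces K 2" for t using that by (simp add: faces_def)
  have cut: "4 * (card (mod2_cycles (faces K 2)))\<^sup>2 \<le> 2 ^ f_number K 2"
    unfolding f_number_def
    by (rule cut_space_bound[OF finite F _ cuts]) (use assms(6) in \<open>simp_all add: f_number_def\<close>)
  \<comment> \<open>Orders of the groups of homology classes, cycles and boundaries; the digit is
    the degree of the chains, and \<open>h\<close> has degree 1.\<close>
  define h z1 z2 b0 b1 where "h = card (carrier (homology_group2 K 1))" and "z1 = card (carrier (cycle_group2 K 1))"
    and "z2 = card (mod2_cycles (faces K 2))" and "b0 = card (boundary2 K ` chains2 K 1)"
    and "b1 = card (boundary2 K ` chains2 K 2)"
  have "faces K 2 \<noteq> {}" using assms(2) by (simp add: has_dimension_def)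
  then have ne: "\<Union>K \<noteq> {}" by (auto simp: faces_def) (metis card.empty ex_in_conv nat.distinct(1) numeral_3_eq_3)
  then have n: "n \<ge> 1" using assms(4) by (metis One_nat_def Suc_leI card_gt_0_iff finite)
  have ker: "card (boundary2 K ` chains2 K i) * card {c \<in> chains2 K i. boundary2 K c = (\<lambda>_. 0)} = 2 ^ f_number K i" for i
    unfolding card_chains2[symmetric]
    by (rule card_bit_kernel_image[OF finite_chains2]) (rule chains2_add, assumption+, rule boundary2_add)
  have e1: "b1 * z2 = 2 ^ f_number K 2"
    using ker[of 2] unfolding card_cycles2_2[OF assms(1)] b1_def z2_def .
  have e2: "b0 * z1 = 2 ^ f_number K 1"
    using ker[of 1] by (simp add: b0_def z1_def cycle_group2_def)
  have e3: "h * b1 = z1" using card_homology_group2_1(1)[OF assms(1)] by (simp add: h_def b1_def z1_def)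
  have e4: "2 ^ (n - 1) \<le> b0" using card_boundaries_0[OF assms(1,3) ne] assms(4) by (simp add: b0_def)
  have e5: "2 ^ betti2 K 1 \<le> h" using betti2_1_bound[OF assms(1)] by (simp add: h_def)
  have c4: "4 * z2\<^sup>2 \<le> 2 ^ f_number K 2" using cut by (simp add: z2_def)
  let ?\<beta> = "betti2 K 1"
  have sq: "4 * (2 ^ m)\<^sup>2 = (2::nat) ^ (2 + 2 * m)" and sq': "(2 ^ m)\<^sup>2 = (2::nat) ^ (2 * m)" for m :: nat
    by (simp_all add: power_mult[symmetric] mult.commute)
  have "2 ^ (n - 1) * (2 ^ ?\<beta> * b1) \<le> b0 * (h * b1)" using e4 e5 by (intro mult_mono) auto
  also have "\<dots> = 2 ^ f_number K 1" using e2 e3 by simp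
  finally have le: "(2 ^ (n - 1) * (2 ^ ?\<beta> * b1)) * z2 \<le> 2 ^ f_number K 1 * z2" by (rule mult_le_mono1)
  have "2 ^ (n - 1 + ?\<beta> + f_number K 2) = 2 ^ (n - 1) * 2 ^ ?\<beta> * (b1 * z2)" unfolding e1 by (simp add: power_add)
  also have "\<dots> = (2 ^ (n - 1) * (2 ^ ?\<beta> * b1)) * z2" by (simp only: mult.assoc)
  also note le
  finally have "2 ^ (n - 1 + ?\<beta> + f_number K 2) \<le> 2 ^ f_number K 1 * z2" .
  \<comment> \<open>Squaring turns the factor \<open>z2\<close> into \<open>z2\<^sup>2\<close>,
    whose bound \<open>c4\<close> encodes
    \<open>2 * (\<beta>\<^sub>2 + 1) \<le> f\<^sub>2\<close>.\<close>
  then have "(2 ^ (n - 1 + ?\<beta> + f_number K 2))\<^sup>2 \<le> (2 ^ f_number K 1 * z2)\<^sup>2" by (rule power_mono[OF _ zero_le])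
  then have "4 * (2 ^ (n - 1 + ?\<beta> + f_number K 2))\<^sup>2 \<le> (2 ^ f_number K 1)\<^sup>2 * (4 * z2\<^sup>2)"
    by (simp add: power_mult_distrib)
  also have "\<dots> \<le> (2 ^ f_number K 1)\<^sup>2 * 2 ^ f_number K 2" using c4 by simp
  finally have "(2::nat) ^ (2 + 2 * (n - 1 + ?\<beta> + f_number K 2)) \<le> 2 ^ (2 * f_number K 1 + f_number K 2)"
    unfolding sq[of "n - 1 + ?\<beta> + f_number K 2"] sq'[of "f_number K 1"] power_add[of 2 "2 * f_number K 1"] .
  then have "2 + 2 * (n - 1 + ?\<beta> + f_number K 2) \<le> 2 * f_number K 1 + f_number K 2"
    by (rule power_le_imp_le_exp[rotated]) simp
  \<comment> \<open>The subtraction \<open>n - 1\<close> is truncated, so \<open>n \<ge> 1\<close>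
    is used in passing to integers.\<close>
  then show ?thesis using n by (cases n) auto
qed

end
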